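(* Let $G$ be a non-abelian finite $p$-group of order $p^n$ with $|\mathcal{M}(G)|=p^{\frac12 n(n-1)-5}$. Then $n\le 7$. Moreover, if $n=7$ then $G\cong E_1\times\mathbb{Z}_p^{(4)}$ (with $p$ odd), and if $n=6$ then $G\cong D_8\times \mathbb{Z}_2^{(3)}$.
   Context: $\mathcal{M}(G)$ denotes the Schur multiplier of $G$. $\mathbb{Z}_{p}^{(m)}$ denotes the direct product of $m$ copies of the cyclic group of order $p$. $D_8$ is the dihedral group of order 8; for odd $p$, $E_1$ is the extra special group of order $p^3$ and exponent $p$. *)

theory Defs
  imports "HOL-Algebra.Algebra" Complex_Main
begin

text \<open>Schur multiplier via Schur's original description
  M(G) = H^2(G, C^*) with trivial action: normalised-by-restriction
  2-cocycles modulo coboundaries.  We only need its order.\<close>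

definition schur_cocycles :: "('a, 'b) monoid_scheme \<Rightarrow> ('a \<Rightarrow> 'a \<Rightarrow> complex) set" where
  "schur_cocycles G = {f.
      (\<forall>x\<in>carrier G. \<forall>y\<in>carrier G. f x y \<noteq> 0) \<and>
      (\<forall>x\<in>carrier G. \<forall>y\<in>carrier G. \<forall>z\<in>carrier G.
          f x y * f (x \<otimes>\<^bsub>G\<^esub> y) z = f y z * f x (y \<otimes>\<^bsub>G\<^esub> z)) \<and>
      (\<forall>x y. x \<notin> carrier G \<or> y \<notin> carrier G \<longrightarrow> f x y = 1)}"

definition schur_cohomologous :: "('a, 'b) monoid_scheme \<Rightarrow> (('a \<Rightarrow> 'a \<Rightarrow> complex) \<times> ('a \<Rightarrow> 'a \<Rightarrow> complex)) set" where
  "schur_cohomologous G = {(f, g). f \<in> schur_cocycles G \<and> g \<in> schur_cocycles G \<and>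
      (\<exists>h :: 'a \<Rightarrow> complex. (\<forall>x\<in>carrier G. h x \<noteq> 0) \<and>
         (\<forall>x\<in>carrier G. \<forall>y\<in>carrier G. g x y = f x y * h x * h y / h (x \<otimes>\<^bsub>G\<^esub> y)))}"

definition schur_multiplier_order :: "('a, 'b) monoid_scheme \<Rightarrow> nat" where
  "schur_multiplier_order G = card (schur_cocycles G // schur_cohomologous G)"

definition elem_abelian :: "nat \<Rightarrow> nat \<Rightarrow> (nat \<Rightarrow> int) monoid" where
  "elem_abelian p m = product_group {..<m} (\<lambda>_. integer_mod_group p)"

text \<open>E_1: the Heisenberg group mod p (extra special of order p^3, exponent p for odd p).\<close>
definition heisenberg_mod :: "nat \<Rightarrow> (int \<times> int \<times> int) monoid" where
  "heisenberg_mod p = \<lparr>carrier = {0..<int p} \<times> {0..<int p} \<times> {0..<int p},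
     monoid.mult = (\<lambda>(a, b, c) (a', b', c').
        ((a + a') mod int p, (b + b') mod int p, (c + c' + a * b') mod int p)),
     one = (0, 0, 0)\<rparr>"

text \<open>D_8: dihedral group of order 8, as Z_4 semidirect Z_2.\<close>
definition dihedral8 :: "(int \<times> int) monoid" where
  "dihedral8 = \<lparr>carrier = {0..<4} \<times> {0..<2},
     monoid.mult = (\<lambda>(r, s) (r', s').
        ((r + (if s = 0 then r' else - r')) mod 4, (s + s') mod 2)),
     one = (0, 0)\<rparr>"

end

(* Fix a central element k of prime order p and put Q = G/<k>.  For a cocycle f and commuting x, y the
   factor f(x,y)/f(y,x) depends only on the class of f and is multiplicative in each argument; taking
   y = k gives a character of G, and f is inflated from Q exactly if this character is trivial.
   Hence |M(G)| is at most |M(Q)| times the number of characters that occur, and p times better if k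
   lies in G', because transgression then embeds a group of order p into M(Q).  A character that
   occurs vanishes on G', on C(x) \<inter> C(y) if k = [x,y], and on w if k is a power of w.  Induction
   gives log_p |M(G)| <= (n-1)(n-2)/2 + 1 for nonabelian G, and one less if |G'| > p, so n <= 7.
   For n = 7 and n = 6 nearly every estimate must be sharp: |G'| = p, |G : Z(G)| = p^2, and few
   elements have nontrivial p-th power, which leaves only products of a group of order p^3 with an
   elementary abelian group.  E_1 x Z_p^3 has order p^6 but is excluded by exhibiting p^11 cocycle
   classes. *)
theory Submission
  imports Defs "HOL-Number_Theory.Cong"
begin

text \<open>The numbers: n(n-1)/2 exceeds (n-1)(n-2)/2 by n-1, so the nonabelian bound leaves n-1-5
  <= 1. At n = 7 this bound is attained (16 = 15 + 1), and every estimate behind it is an equality.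
  At n = 6 the exponent 10 lies one below the bound 11 for |G'| = p, but equals the bound for |G'| >
  p; the second possibility is therefore refuted only by following equality through two successive
  central quotients. The first possibility keeps a spare factor p. It allows p = 2 with elements of
  order 4, and it lets E_1 x Z_p^3 pass all upper estimates although its multiplier has order p^11,
  so that only a lower bound can exclude this group.

  Cocycles are told apart by commuting pairs alone: the commutation factor of such a pair is the
  commutator of lifts in the central extension, so it is blind to coboundaries and bimultiplicative.
  The same device serves the upper bounds (as characters) and the lower bound (as coordinates).
  Finiteness travels with the upper bounds because an infinite set has \<open>card\<close>
  0.\<close>

abbreviation schur_classes :: "('a, 'b) monoid_scheme \<Rightarrow> ('a \<Rightarrow> 'a \<Rightarrow> complex) set set" where
  "schur_classes G \<equiv> schur_cocycles G // schur_cohomologous G"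

section \<open>Cocycles modulo coboundaries and commutation factors\<close>

lemma cocycle_nonzero:
  "f \<in> schur_cocycles G \<Longrightarrow> x \<in> carrier G \<Longrightarrow> y \<in> carrier G \<Longrightarrow> f x y \<noteq> 0"
  by (simp add: schur_cocycles_def)

lemma cocycle_eq:
  "f \<in> schur_cocycles G \<Longrightarrow> x \<in> carrier G \<Longrightarrow> y \<in> carrier G \<Longrightarrow> z \<in> carrier G \<Longrightarrow>
   f x y * f (x \<otimes>\<^bsub>G\<^esub> y) z = f y z * f x (y \<otimes>\<^bsub>G\<^esub> z)"
  by (simp add: schur_cocycles_def)

lemma cocycle_outside:
  "f \<in> schur_cocycles G \<Longrightarrow> x \<notin> carrier G \<or> y \<notin> carrier G \<Longrightarrow> f x y = 1"
  by (auto simp add: schur_cocycles_def)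

lemma cocycle_div:
  "f \<in> schur_cocycles G \<Longrightarrow> g \<in> schur_cocycles G \<Longrightarrow> (\<lambda>x y. f x y / g x y) \<in> schur_cocycles G"
  by (simp add: schur_cocycles_def)

lemma cocycleI:
  assumes "\<And>x y. x \<in> carrier G \<Longrightarrow> y \<in> carrier G \<Longrightarrow> f x y \<noteq> 0"
    and "\<And>x y z. x \<in> carrier G \<Longrightarrow> y \<in> carrier G \<Longrightarrow> z \<in> carrier G \<Longrightarrow>
      f x y * f (x \<otimes>\<^bsub>G\<^esub> y) z = f y z * f x (y \<otimes>\<^bsub>G\<^esub> z)"
    and "\<And>x y. x \<notin> carrier G \<or> y \<notin> carrier G \<Longrightarrow> f x y = 1"
  shows "f \<in> schur_cocycles G"
  using assms unfolding schur_cocycles_def by blast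

lemma cocycle_mult:
  assumes f: "f \<in> schur_cocycles G" and g: "g \<in> schur_cocycles G"
  shows "(\<lambda>x y. f x y * g x y) \<in> schur_cocycles G"
proof (rule cocycleI, goal_cases)
  case (2 x y z)
  then have "(f x y * f (x \<otimes>\<^bsub>G\<^esub> y) z) * (g x y * g (x \<otimes>\<^bsub>G\<^esub> y) z) =
    (f y z * f x (y \<otimes>\<^bsub>G\<^esub> z)) * (g y z * g x (y \<otimes>\<^bsub>G\<^esub> z))"
    using cocycle_eq[OF f] cocycle_eq[OF g] by simp
  then show ?case by (simp add: mult_ac)
qed (use cocycle_nonzero[OF f] cocycle_nonzero[OF g] cocycle_outside[OF f] cocycle_outside[OF g] in auto)

lemma cohomologousI:
  assumes "f \<in> schur_cocycles G" "g \<in> schur_cocycles G" "\<And>x. x \<in> carrier G \<Longrightarrow> h x \<noteq> 0"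
    "\<And>x y. x \<in> carrier G \<Longrightarrow> y \<in> carrier G \<Longrightarrow> g x y = f x y * h x * h y / h (x \<otimes>\<^bsub>G\<^esub> y)"
  shows "(f, g) \<in> schur_cohomologous G"
  using assms unfolding schur_cohomologous_def by blast

lemma cohomologousE:
  assumes "(f, g) \<in> schur_cohomologous G"
  obtains h where "f \<in> schur_cocycles G" "g \<in> schur_cocycles G" "\<And>x. x \<in> carrier G \<Longrightarrow> h x \<noteq> 0"
    "\<And>x y. x \<in> carrier G \<Longrightarrow> y \<in> carrier G \<Longrightarrow> g x y = f x y * h x * h y / h (x \<otimes>\<^bsub>G\<^esub> y)"
  using assms unfolding schur_cohomologous_def by blast

lemma cohomologous_mult:
  assumes "monoid G" "(f, g) \<in> schur_cohomologous G" "(f', g') \<in> schur_cohomologous G"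
  shows "(\<lambda>x y. f x y * f' x y, \<lambda>x y. g x y * g' x y) \<in> schur_cohomologous G"
proof -
  interpret monoid G by fact
  obtain h where h: "f \<in> schur_cocycles G" "g \<in> schur_cocycles G" "\<And>x. x \<in> carrier G \<Longrightarrow> h x \<noteq> 0"
    "\<And>x y. x \<in> carrier G \<Longrightarrow> y \<in> carrier G \<Longrightarrow> g x y = f x y * h x * h y / h (x \<otimes>\<^bsub>G\<^esub> y)"
    using assms(2) by (rule cohomologousE) blast
  obtain h' where h': "f' \<in> schur_cocycles G" "g' \<in> schur_cocycles G" "\<And>x. x \<in> carrier G \<Longrightarrow> h' x \<noteq> 0"
    "\<And>x y. x \<in> carrier G \<Longrightarrow> y \<in> carrier G \<Longrightarrow> g' x y = f' x y * h' x * h' y / h' (x \<otimes>\<^bsub>G\<^esub> y)"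
    using assms(3) by (rule cohomologousE) blast
  show ?thesis
    by (rule cohomologousI[where h = "\<lambda>x. h x * h' x"]) (use h h' in \<open>auto intro: cocycle_mult\<close>)
qed

lemma cohomologous_div:
  assumes "monoid G" "(f, g) \<in> schur_cohomologous G" "(f', g') \<in> schur_cohomologous G"
  shows "(\<lambda>x y. f x y / f' x y, \<lambda>x y. g x y / g' x y) \<in> schur_cohomologous G"
proof -
  interpret monoid G by fact
  obtain h where h: "f \<in> schur_cocycles G" "g \<in> schur_cocycles G" "\<And>x. x \<in> carrier G \<Longrightarrow> h x \<noteq> 0"
    "\<And>x y. x \<in> carrier G \<Longrightarrow> y \<in> carrier G \<Longrightarrow> g x y = f x y * h x * h y / h (x \<otimes>\<^bsub>G\<^esub> y)"
    using assms(2) by (rule cohomologousE) blast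
  obtain h' where h': "f' \<in> schur_cocycles G" "g' \<in> schur_cocycles G" "\<And>x. x \<in> carrier G \<Longrightarrow> h' x \<noteq> 0"
    "\<And>x y. x \<in> carrier G \<Longrightarrow> y \<in> carrier G \<Longrightarrow> g' x y = f' x y * h' x * h' y / h' (x \<otimes>\<^bsub>G\<^esub> y)"
    using assms(3) by (rule cohomologousE) blast
  show ?thesis
    by (rule cohomologousI[where h = "\<lambda>x. h x / h' x"]) (use h h' in \<open>auto intro: cocycle_div\<close>)
qed

lemma equiv_cohomologous:
  assumes "monoid G"
  shows "equiv (schur_cocycles G) (schur_cohomologous G)"
proof (rule equivI)
  interpret monoid G by fact
  show "schur_cohomologous G \<subseteq> schur_cocycles G \<times> schur_cocycles G"
    by (auto simp: schur_cohomologous_def)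
  show "refl_on (schur_cocycles G) (schur_cohomologous G)"
    by (auto intro!: refl_onI cohomologousI[where h = "\<lambda>_. 1"])
  show "sym (schur_cohomologous G)"
  proof (rule symI)
    fix f g assume "(f, g) \<in> schur_cohomologous G"
    then obtain h where h: "f \<in> schur_cocycles G" "g \<in> schur_cocycles G" "\<And>x. x \<in> carrier G \<Longrightarrow> h x \<noteq> 0"
      "\<And>x y. x \<in> carrier G \<Longrightarrow> y \<in> carrier G \<Longrightarrow> g x y = f x y * h x * h y / h (x \<otimes>\<^bsub>G\<^esub> y)"
      by (rule cohomologousE) blast
    show "(g, f) \<in> schur_cohomologous G"
      by (rule cohomologousI[where h = "\<lambda>x. 1 / h x"]) (use h in auto)
  qed
  show "trans (schur_cohomologous G)"
  proof (rule transI)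
    fix f g e assume "(f, g) \<in> schur_cohomologous G" "(g, e) \<in> schur_cohomologous G"
    then obtain h h' where h: "f \<in> schur_cocycles G" "g \<in> schur_cocycles G" "\<And>x. x \<in> carrier G \<Longrightarrow> h x \<noteq> 0"
      "\<And>x y. x \<in> carrier G \<Longrightarrow> y \<in> carrier G \<Longrightarrow> g x y = f x y * h x * h y / h (x \<otimes>\<^bsub>G\<^esub> y)"
      and h': "e \<in> schur_cocycles G" "\<And>x. x \<in> carrier G \<Longrightarrow> h' x \<noteq> 0"
      "\<And>x y. x \<in> carrier G \<Longrightarrow> y \<in> carrier G \<Longrightarrow> e x y = g x y * h' x * h' y / h' (x \<otimes>\<^bsub>G\<^esub> y)"
      by (elim cohomologousE) blast
    show "(f, e) \<in> schur_cohomologous G"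
      by (rule cohomologousI[where h = "\<lambda>x. h x * h' x"]) (use h h' in auto)
  qed
qed

text \<open>For commuting x and y this is the commutator of lifts of x and y to the central
  extension defined by f. For other pairs it has no invariant meaning, hence the commutation
  hypotheses below.\<close>

definition commutation :: "('a \<Rightarrow> 'a \<Rightarrow> complex) \<Rightarrow> 'a \<Rightarrow> 'a \<Rightarrow> complex" where
  "commutation f x y = f x y / f y x"

context group
begin

lemma commutation_nonzero:
  "f \<in> schur_cocycles G \<Longrightarrow> x \<in> carrier G \<Longrightarrow> y \<in> carrier G \<Longrightarrow> commutation f x y \<noteq> 0"
  by (simp add: commutation_def cocycle_nonzero)

lemma commutation_swap:
  "commutation f y x = 1 / commutation f x y"
  by (simp add: commutation_def)

text \<open>The cocycle identity for the triples (x,y,z), (y,z,x) and (y,x,z) expresses all values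
  through each other, and \<open>f y z\<close> cancels. Only x has to commute with y and z; this is
  what makes a central x a source of characters of a nonabelian group.\<close>

lemma commutation_mult_right:
  assumes f: "f \<in> schur_cocycles G" and x: "x \<in> carrier G" and y: "y \<in> carrier G" and z: "z \<in> carrier G"
    and xy: "x \<otimes> y = y \<otimes> x" and xz: "x \<otimes> z = z \<otimes> x"
  shows "commutation f x (y \<otimes> z) = commutation f x y * commutation f x z"
proof -
  note nz = cocycle_nonzero[OF f]
  have 1: "f x y * f (x \<otimes> y) z = f y z * f x (y \<otimes> z)" by (rule cocycle_eq[OF f x y z])
  have 2: "f y z * f (y \<otimes> z) x = f z x * f y (x \<otimes> z)" using cocycle_eq[OF f y z x] xz by simp
  have 3: "f y x * f (x \<otimes> y) z = f x z * f y (x \<otimes> z)" using cocycle_eq[OF f y x z] xy by simp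
  have "f x (y \<otimes> z) = f x y * f (x \<otimes> y) z / f y z"
    and "f (y \<otimes> z) x = f z x * f y (x \<otimes> z) / f y z"
    and "f (x \<otimes> y) z = f x z * f y (x \<otimes> z) / f y x"
    using 1 2 3 nz x y z by (simp_all add: nonzero_eq_divide_eq mult.commute)
  then show ?thesis
    using nz x y z by (simp add: commutation_def)
qed

lemma commutation_mult_left:
  assumes "f \<in> schur_cocycles G" "x \<in> carrier G" "y \<in> carrier G" "z \<in> carrier G"
    and "x \<otimes> y = y \<otimes> x" and "x \<otimes> z = z \<otimes> x"
  shows "commutation f (y \<otimes> z) x = commutation f y x * commutation f z x"
  using commutation_mult_right[OF assms] by (simp add: commutation_swap[of f _ x])

lemma commutation_one:
  assumes f: "f \<in> schur_cocycles G" and x: "x \<in> carrier G"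
  shows "commutation f x \<one> = 1"
  using commutation_mult_right[OF f x one_closed one_closed] commutation_nonzero[OF f x one_closed] x by simp

lemma commutation_inv:
  assumes f: "f \<in> schur_cocycles G" and x: "x \<in> carrier G" "y \<in> carrier G" "x \<otimes> y = y \<otimes> x"
  shows "commutation f x (inv y) = 1 / commutation f x y"
proof -
  have c: "x \<otimes> inv y = inv y \<otimes> x" using x by (metis inv_closed inv_solve_left inv_solve_right m_assoc m_closed)
  show ?thesis
    using commutation_mult_right[OF f x(1) x(2) inv_closed[OF x(2)] x(3) c] commutation_one[OF f x(1)]
      commutation_nonzero[OF f x(1,2)] x by (simp add: field_simps)
qed

lemma commutation_pow:
  assumes f: "f \<in> schur_cocycles G" and x: "x \<in> carrier G" "y \<in> carrier G" "x \<otimes> y = y \<otimes> x"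
  shows "commutation f x (y [^] (i::nat)) = commutation f x y ^ i"
proof (induction i)
  case 0 show ?case using commutation_one[OF f] x by simp
next
  case (Suc i)
  have "x \<otimes> y [^] i = y [^] i \<otimes> x" using pow_mult_distrib x
    by (metis group_commutes_pow)
  with Suc show ?case using commutation_mult_right[OF f x(1) _ x(2) _ x(3), of "y [^] i"] x by simp
qed

text \<open>On the centralizer of w the map \<open>commutation f w\<close> is a homomorphism into an
  abelian group, so it kills commutators of elements of that centralizer.\<close>

lemma commutation_commutator:
  assumes f: "f \<in> schur_cocycles G" and x: "x \<in> carrier G" "y \<in> carrier G" "w \<in> carrier G"
    and c: "w \<otimes> x = x \<otimes> w" "w \<otimes> y = y \<otimes> w"
  shows "commutation f w (x \<otimes> y \<otimes> inv x \<otimes> inv y) = 1"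
proof -
  have ci: "w \<otimes> inv a = inv a \<otimes> w" if "a \<in> carrier G" "w \<otimes> a = a \<otimes> w" for a
    using that x by (metis inv_closed inv_solve_left inv_solve_right m_assoc m_closed)
  have cm: "w \<otimes> (a \<otimes> b) = (a \<otimes> b) \<otimes> w" if "a \<in> carrier G" "w \<otimes> a = a \<otimes> w" "b \<in> carrier G" "w \<otimes> b = b \<otimes> w" for a b
    using that x by (metis m_assoc)
  show ?thesis
    using x c by (simp add: commutation_mult_right[OF f] ci cm commutation_inv[OF f] commutation_nonzero[OF f])
qed

end

text \<open>The coboundary factor \<open>h x * h y / h (x \<otimes> y)\<close> is symmetric as soon
  as x and y commute.\<close>

lemma commutation_cohomologous:
  assumes "monoid G" "(f, g) \<in> schur_cohomologous G" "x \<in> carrier G" "y \<in> carrier G" "x \<otimes>\<^bsub>G\<^esub> y = y \<otimes>\<^bsub>G\<^esub> x"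
  shows "commutation f x y = commutation g x y"
  using assms(2)
proof (rule cohomologousE)
  fix h assume *: "\<And>x. x \<in> carrier G \<Longrightarrow> h x \<noteq> 0" "g \<in> schur_cocycles G"
    "\<And>x y. x \<in> carrier G \<Longrightarrow> y \<in> carrier G \<Longrightarrow> g x y = f x y * h x * h y / h (x \<otimes>\<^bsub>G\<^esub> y)"
  have "h x \<noteq> 0" "h y \<noteq> 0" "h (y \<otimes>\<^bsub>G\<^esub> x) \<noteq> 0"
    using * assms monoid.m_closed[OF assms(1)] by auto
  then show ?thesis
    using * assms(3-) by (simp add: commutation_def)
qed

section \<open>Central quotients of prime order\<close>

text \<open>The cocycle after rescaling the lifts by h. The value 1 off the carrier is the
  convention of \<open>schur_cocycles\<close>, without which one class would contain several copies
  of a cocycle.\<close>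

definition twist :: "('a, 'b) monoid_scheme \<Rightarrow> ('a \<Rightarrow> complex) \<Rightarrow> ('a \<Rightarrow> 'a \<Rightarrow> complex) \<Rightarrow> 'a \<Rightarrow> 'a \<Rightarrow> complex" where
  "twist G h f = (\<lambda>x y. if x \<in> carrier G \<and> y \<in> carrier G then f x y * h x * h y / h (x \<otimes>\<^bsub>G\<^esub> y) else 1)"

lemma (in monoid) twist_cohomologous:
  assumes f: "f \<in> schur_cocycles G" and h: "\<And>x. x \<in> carrier G \<Longrightarrow> h x \<noteq> 0"
  shows "(f, twist G h f) \<in> schur_cohomologous G"
proof (rule cohomologousI[OF f _ h])
  show "twist G h f \<in> schur_cocycles G"
  proof (rule cocycleI, goal_cases)
    case (2 x y z)
    then show ?case using cocycle_eq[OF f 2] h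
      by (simp add: twist_def m_assoc)
  qed (use h cocycle_nonzero[OF f] in \<open>auto simp: twist_def\<close>)
qed (simp_all add: twist_def)

text \<open>\<open>r\<close> is only a set-theoretic choice of representatives of the cosets of the
  subgroup generated by k. Fixing \<open>r \<one> = \<one>\<close> lets the quotient inherit the
  unit of G.\<close>

locale central_transversal = group G for G :: "('a, 'b) monoid_scheme" (structure) +
  fixes k :: 'a and p :: nat and r :: "'a \<Rightarrow> 'a"
  assumes p: "Factorial_Ring.prime p"
    and k: "k \<in> carrier G" "k \<noteq> \<one>" "k [^] p = \<one>"
    and central: "g \<in> carrier G \<Longrightarrow> g \<otimes> k = k \<otimes> g"
    and r_closed: "g \<in> carrier G \<Longrightarrow> r g \<in> carrier G"
    and r_one: "r \<one> = \<one>"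
    and r_mult_k: "g \<in> carrier G \<Longrightarrow> r (g \<otimes> k) = r g"
    and r_decomp: "g \<in> carrier G \<Longrightarrow> \<exists>i::nat. g = r g \<otimes> k [^] i"
begin

lemma p_pos: "0 < p"
  using p by (simp add: prime_gt_0_nat)

lemma ord_k: "ord k = p"
  using ord_dvd_group_order k p by (metis ord_eq_1 pow_eq_id prime_nat_iff)

lemma k_pow_mod: "k [^] (i mod p) = k [^] (i::nat)"
proof -
  have "k [^] i = k [^] (p * (i div p) + i mod p)" by (simp only: mult_div_mod_eq)
  also have "\<dots> = (k [^] p) [^] (i div p) \<otimes> k [^] (i mod p)"
    by (simp only: nat_pow_pow[OF k(1)] nat_pow_mult[OF k(1)])
  finally have "k [^] i = \<one> [^] (i div p) \<otimes> k [^] (i mod p)" by (simp only: k)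
  then show ?thesis by (simp only: nat_pow_one l_one[OF nat_pow_closed[OF k(1)]])
qed

lemma k_pow_eq_iff: "k [^] (i::nat) = k [^] (j::nat) \<longleftrightarrow> i mod p = j mod p"
proof
  assume "k [^] i = k [^] j"
  then have "k [^] int i = k [^] int j" by (simp add: int_pow_int)
  then have "int p dvd int j - int i" using int_pow_eq[OF k(1)] ord_k by simp
  then show "i mod p = j mod p"
    by (metis mod_eq_dvd_iff of_nat_eq_iff zmod_int)
next
  assume "i mod p = j mod p" then show "k [^] i = k [^] j" by (metis k_pow_mod)
qed

lemma pow_central: "g \<in> carrier G \<Longrightarrow> g \<otimes> k [^] (i::nat) = k [^] i \<otimes> g"
  by (metis central group_commutes_pow k(1))

lemma r_mult_pow: "g \<in> carrier G \<Longrightarrow> r (g \<otimes> k [^] (i::nat)) = r g"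
proof (induction i)
  case (Suc i)
  then have "g \<otimes> k [^] Suc i = g \<otimes> k [^] i \<otimes> k" using k by (simp add: m_assoc)
  with Suc show ?case using r_mult_k[of "g \<otimes> k [^] i"] k by simp
qed (use k in simp)

lemma r_pow: "r (k [^] (i::nat)) = \<one>"
  using r_mult_pow[of \<one> i] r_one k by simp

lemma r_r: "g \<in> carrier G \<Longrightarrow> r (r g) = r g"
  using r_decomp[of g] r_mult_pow[of "r g"] r_closed by metis

text \<open>An arbitrary choice that is determined only modulo p, so additivity is stated modulo
  p.\<close>

definition k_exp :: "'a \<Rightarrow> nat" where
  "k_exp g = (SOME i. g = r g \<otimes> k [^] i)"

lemma k_exp: "g \<in> carrier G \<Longrightarrow> r g \<otimes> k [^] k_exp g = g"
  unfolding k_exp_def using someI_ex[OF r_decomp] by metis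

lemma k_exp_mult_pow:
  assumes g: "g \<in> carrier G"
  shows "k_exp (g \<otimes> k [^] (i::nat)) mod p = (k_exp g + i) mod p"
proof -
  have "r g \<otimes> k [^] (k_exp g + i) = r g \<otimes> k [^] k_exp g \<otimes> k [^] i"
    using g k r_closed by (simp add: nat_pow_mult m_assoc)
  also have "\<dots> = r g \<otimes> k [^] k_exp (g \<otimes> k [^] i)"
    using k_exp[of "g \<otimes> k [^] i"] r_mult_pow[OF g] k_exp[OF g] g k by simp
  finally show ?thesis
    using g k r_closed by (simp add: k_pow_eq_iff)
qed

lemma k_exp_pow: "k_exp (k [^] (i::nat)) mod p = i mod p"
proof -
  have "k [^] i = k [^] k_exp (k [^] i)"
    using k_exp[of "k [^] i"] r_pow k by simp
  then show ?thesis by (metis k_pow_eq_iff)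
qed

lemma mult_decomp:
  assumes x: "x \<in> carrier G" and y: "y \<in> carrier G"
  shows "x \<otimes> y = r x \<otimes> r y \<otimes> k [^] k_exp x \<otimes> k [^] k_exp y"
proof -
  have "x \<otimes> y = (r x \<otimes> k [^] k_exp x) \<otimes> (r y \<otimes> k [^] k_exp y)" by (simp only: k_exp x y)
  also have "\<dots> = r x \<otimes> (k [^] k_exp x \<otimes> r y) \<otimes> k [^] k_exp y"
    using x y r_closed k by (simp add: m_assoc)
  also have "\<dots> = r x \<otimes> r y \<otimes> k [^] k_exp x \<otimes> k [^] k_exp y"
    using x y r_closed k by (simp only: pow_central[OF r_closed[OF y], symmetric]) (simp add: m_assoc)
  finally show ?thesis .
qed

lemma r_mult: "x \<in> carrier G \<Longrightarrow> y \<in> carrier G \<Longrightarrow> r (r x \<otimes> r y) = r (x \<otimes> y)"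
  using mult_decomp r_mult_pow r_closed k by (metis m_closed nat_pow_closed)

text \<open>The quotient by \<open>k\<close> is carried by the transversal, so that it keeps the type of \<open>G\<close> and
  induction on the order is possible.\<close>

definition Q :: "('a, 'b) monoid_scheme" where
  "Q = G\<lparr>carrier := r ` carrier G, mult := \<lambda>x y. r (x \<otimes> y)\<rparr>"

lemma Q_simps: "carrier Q = r ` carrier G" "x \<otimes>\<^bsub>Q\<^esub> y = r (x \<otimes> y)" "\<one>\<^bsub>Q\<^esub> = \<one>"
  by (simp_all add: Q_def)

lemma Q_carrier: "x \<in> carrier Q \<longleftrightarrow> x \<in> carrier G \<and> r x = x"
  unfolding Q_simps(1) image_iff using r_r r_closed by metis

lemma group_Q: "group Q"
proof (rule groupI)
  fix x y z assume "x \<in> carrier Q" "y \<in> carrier Q" "z \<in> carrier Q"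
  then show "x \<otimes>\<^bsub>Q\<^esub> y \<otimes>\<^bsub>Q\<^esub> z = x \<otimes>\<^bsub>Q\<^esub> (y \<otimes>\<^bsub>Q\<^esub> z)"
    using r_mult[of "x \<otimes> y" z] r_mult[of x "y \<otimes> z"] by (simp add: Q_carrier Q_simps(2) m_assoc)
next
  fix x assume x: "x \<in> carrier Q"
  have "r (r (inv x) \<otimes> x) = \<one>"
    using r_mult[of "inv x" x] x r_one by (simp add: Q_carrier)
  then show "\<exists>y\<in>carrier Q. y \<otimes>\<^bsub>Q\<^esub> x = \<one>\<^bsub>Q\<^esub>"
    using x by (intro bexI[of _ "r (inv x)"]) (auto simp: Q_carrier r_r r_closed Q_simps(2,3))
qed (auto simp: Q_carrier Q_simps(2,3) r_one r_r r_closed)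

lemma r_hom: "r \<in> hom G Q"
  by (rule homI) (auto simp: Q_carrier Q_simps(2) r_r r_closed r_mult)

lemma r_eq_one: "g \<in> carrier G \<Longrightarrow> r g = \<one> \<longleftrightarrow> (\<exists>i::nat. g = k [^] i)"
  using k_exp[of g] r_pow k by (metis l_one nat_pow_closed)

lemma inj_Q_pow: "inj_on (\<lambda>(q, i). q \<otimes> k [^] i) (carrier Q \<times> {..<p})"
proof (rule inj_onI)
  fix a b assume "a \<in> carrier Q \<times> {..<p}" "b \<in> carrier Q \<times> {..<p}"
    "(case a of (q, i) \<Rightarrow> q \<otimes> k [^] i) = (case b of (q, i) \<Rightarrow> q \<otimes> k [^] i)"
  then obtain q i q' i' where *: "q \<in> carrier Q" "q' \<in> carrier Q" "i < p" "i' < p"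
    "q \<otimes> k [^] i = q' \<otimes> k [^] i'" "a = (q, i)" "b = (q', i')"
    by auto
  then have "q = q'" using r_mult_pow[of q i] r_mult_pow[of q' i'] by (simp add: Q_carrier)
  with * show "a = b" using k by (simp add: Q_carrier k_pow_eq_iff)
qed

lemma card_Q: "finite (carrier G) \<Longrightarrow> order Q * p = order G"
proof -
  assume fin: "finite (carrier G)"
  have "bij_betw (\<lambda>(q, i). q \<otimes> k [^] i) (carrier Q \<times> {..<p}) (carrier G)"
    unfolding bij_betw_def
  proof
    show "inj_on (\<lambda>(q, i). q \<otimes> k [^] i) (carrier Q \<times> {..<p})" by (rule inj_Q_pow)
    have "g \<in> (\<lambda>(q, i). q \<otimes> k [^] i) ` (carrier Q \<times> {..<p})" if "g \<in> carrier G" for g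
      using that k_exp[OF that] k_pow_mod[of "k_exp g"] p_pos
      by (intro image_eqI[of _ _ "(r g, k_exp g mod p)"]) (auto simp: Q_carrier r_closed r_r)
    then show "(\<lambda>(q, i). q \<otimes> k [^] i) ` (carrier Q \<times> {..<p}) = carrier G"
      using k by (auto simp: Q_carrier)
  qed
  then show ?thesis
    by (simp add: order_def bij_betw_same_card[symmetric] card_cartesian_product)
qed

definition inflate :: "('a \<Rightarrow> 'a \<Rightarrow> complex) \<Rightarrow> 'a \<Rightarrow> 'a \<Rightarrow> complex" where
  "inflate b = (\<lambda>x y. if x \<in> carrier G \<and> y \<in> carrier G then b (r x) (r y) else 1)"

definition deflate :: "('a \<Rightarrow> 'a \<Rightarrow> complex) \<Rightarrow> 'a \<Rightarrow> 'a \<Rightarrow> complex" where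
  "deflate f = (\<lambda>x y. if x \<in> carrier Q \<and> y \<in> carrier Q then f x y else 1)"

lemma inflate_cocycle:
  assumes b: "b \<in> schur_cocycles Q" shows "inflate b \<in> schur_cocycles G"
proof (rule cocycleI, goal_cases)
  case (2 x y z)
  then show ?case
    using cocycle_eq[OF b, of "r x" "r y" "r z"]
    by (simp add: inflate_def Q_carrier Q_simps(2) r_closed r_r r_mult)
qed (use cocycle_nonzero[OF b] in \<open>auto simp: inflate_def Q_carrier r_closed r_r\<close>)

lemma inflate_cohomologous:
  assumes "(a, b) \<in> schur_cohomologous Q" shows "(inflate a, inflate b) \<in> schur_cohomologous G"
  using assms
proof (rule cohomologousE)
  fix h assume *: "a \<in> schur_cocycles Q" "b \<in> schur_cocycles Q" "\<And>x. x \<in> carrier Q \<Longrightarrow> h x \<noteq> 0"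
    "\<And>x y. x \<in> carrier Q \<Longrightarrow> y \<in> carrier Q \<Longrightarrow> b x y = a x y * h x * h y / h (x \<otimes>\<^bsub>Q\<^esub> y)"
  then show ?thesis
    by (intro cohomologousI[where h = "h \<circ> r"])
      (simp_all add: inflate_cocycle, simp_all add: Q_carrier Q_simps(2) inflate_def r_closed r_r r_mult)
qed

lemma deflate_cocycle:
  assumes f: "f \<in> schur_cocycles G"
    and inv: "\<And>x y. x \<in> carrier G \<Longrightarrow> y \<in> carrier G \<Longrightarrow> f (r x) (r y) = f x y"
  shows "deflate f \<in> schur_cocycles Q" and "inflate (deflate f) = f"
proof -
  show "deflate f \<in> schur_cocycles Q"
  proof (rule cocycleI, goal_cases)
    case (2 x y z)
    then have "f (r (x \<otimes> y)) z = f (x \<otimes> y) z" "f x (r (y \<otimes> z)) = f x (y \<otimes> z)"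
      using inv[of "x \<otimes> y" z] inv[of x "y \<otimes> z"] by (auto simp: Q_carrier)
    then show ?case
      using 2 cocycle_eq[OF f, of x y z] by (simp add: deflate_def Q_carrier Q_simps(2) r_closed r_r)
  qed (use cocycle_nonzero[OF f] in \<open>auto simp: deflate_def Q_carrier\<close>)
  show "inflate (deflate f) = f"
    using inv cocycle_outside[OF f] by (auto simp: fun_eq_iff inflate_def deflate_def Q_carrier r_closed r_r)
qed

text \<open>The lift of \<open>k\<close> to the extension can be rescaled to have order \<open>p\<close>; complex roots exist.\<close>

lemma cocycle_trivial_on_cyclic:
  assumes f: "f \<in> schur_cocycles G"
  obtains f' where "(f, f') \<in> schur_cohomologous G" "\<And>i j. f' (k [^] (i::nat)) (k [^] (j::nat)) = 1"
proof -
  note nz = cocycle_nonzero[OF f]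
  have kp: "k [^] i \<in> carrier G" for i :: nat using k by simp
  \<comment> \<open>With lifts u of group elements, \<open>H i\<close> is the scalar relating the
    i-th power of the lift of k to the lift of \<open>k [^] i\<close>. The division by
    \<open>f \<one> \<one>\<close> accounts for the lift of the identity not being the
    identity.\<close>
  define H where "H i = (\<Prod>j<i. f (k [^] j) k) / f \<one> \<one>" for i :: nat
  have H_nz: "H i \<noteq> 0" for i using nz kp k by (simp add: H_def)
  have f_one: "f x \<one> = f \<one> \<one>" if "x \<in> carrier G" for x
    using cocycle_eq[OF f that one_closed one_closed] that nz by simp
  have H_Suc: "H (Suc i) = H i * f (k [^] i) k" for i by (simp add: H_def)
  have H_add: "H (i + j) = H i * H j * f (k [^] i) (k [^] j)" for i j
  proof (induction j)
    case 0 show ?case using f_one[OF kp] nz by (simp add: H_def)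
  next
    case (Suc j)
    have "f (k [^] i) (k [^] j) * f (k [^] (i + j)) k = f (k [^] j) k * f (k [^] i) (k [^] Suc j)"
      using cocycle_eq[OF f kp[of i] kp[of j] k(1)] k by (simp add: nat_pow_mult)
    with Suc show ?case by (simp add: H_Suc mult_ac)
  qed
  \<comment> \<open>The p-th root is chosen so that a times the lift of k has p-th power exactly the
    identity of the extension; its powers then depend only on the exponent modulo p.\<close>
  define a where "a = rcis (root p (cmod (H 0 / H p))) (Arg (H 0 / H p) / p)"
  have a: "a ^ p = H 0 / H p"
    using p_pos by (simp add: a_def DeMoivre2 rcis_cmod_Arg del: norm_divide)
  have a_nz: "a \<noteq> 0" using a H_nz p_pos by (metis divide_eq_0_iff power_0_left less_not_refl)
  define v where "v i = a ^ i * H i" for i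
  have v_nz: "v i \<noteq> 0" for i using a_nz H_nz by (simp add: v_def)
  have v_add: "v (i + j) = v i * v j * f (k [^] i) (k [^] j)" for i j
    by (simp add: v_def H_add power_add mult_ac)
  have v_p: "v (i + p) = v i" for i
  proof -
    have "v (i + p) = v i * v p * f \<one> \<one>"
      using v_add[of i p] f_one[OF kp] k by simp
    also have "v p = 1 / f \<one> \<one>" using a H_nz by (simp add: v_def) (simp add: H_def)
    finally show ?thesis using nz by simp
  qed
  have v_mod: "v i = v j" if "i mod p = j mod p" for i j
  proof -
    have "v (i + p * m) = v i" for i m
    proof (induction m)
      case (Suc m) then show ?case using v_p[of "i + p * m"] by (simp add: add_ac)
    qed simp
    then have "v i = v (i mod p)" for i by (metis mod_mult_div_eq)
    then show ?thesis using that by metis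
  qed
  define h where "h g = (if r g = \<one> then v (k_exp g) else 1)" for g
  have h_pow: "h (k [^] i) = v i" for i :: nat
    using v_mod[OF k_exp_pow] r_pow by (simp add: h_def)
  have "(f, twist G h f) \<in> schur_cohomologous G"
    by (rule twist_cohomologous[OF f]) (simp add: h_def v_nz)
  moreover have "twist G h f (k [^] i) (k [^] j) = 1" for i j :: nat
    using k v_add[of i j] v_nz[of "i + j"] by (simp add: twist_def h_pow nat_pow_mult mult_ac)
  ultimately show ?thesis by (rule that)
qed

text \<open>After normalising the lifts along the transversal, the cocycle is constant on cosets.\<close>

lemma cocycle_is_inflated:
  assumes f: "f \<in> schur_cocycles G" and c: "\<And>g. g \<in> carrier G \<Longrightarrow> commutation f g k = 1"
  obtains b where "b \<in> schur_cocycles Q" "(f, inflate b) \<in> schur_cohomologous G"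
proof -
  have kp: "k [^] i \<in> carrier G" for i :: nat using k by simp
  obtain f1 where f1: "(f, f1) \<in> schur_cohomologous G" "\<And>i j. f1 (k [^] (i::nat)) (k [^] (j::nat)) = 1"
    using cocycle_trivial_on_cyclic[OF f] by blast
  have f1c: "f1 \<in> schur_cocycles G" using f1(1) by (rule cohomologousE)
  \<comment> \<open>The lift of g is replaced by the product of the lifts of \<open>r g\<close> and
    of \<open>k [^] k_exp g\<close>. Right multiplication by powers of k is then respected by
    construction.\<close>
  define h where "h g = f1 (r g) (k [^] k_exp g)" for g
  define f2 where "f2 = twist G h f1"
  have h_nz: "h g \<noteq> 0" if "g \<in> carrier G" for g
    using that cocycle_nonzero[OF f1c] r_closed kp by (simp add: h_def)
  have f12: "(f1, f2) \<in> schur_cohomologous G"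
    unfolding f2_def by (rule twist_cohomologous[OF f1c h_nz])
  then have f2c: "f2 \<in> schur_cocycles G" by (rule cohomologousE)
  have f02: "(f, f2) \<in> schur_cohomologous G"
    using f1(1) f12 equiv_cohomologous[OF monoid_axioms] by (meson equivE transD)
  have right: "f2 g (k [^] i) = 1" if g: "g \<in> carrier G" for g and i :: nat
  proof -
    have 1: "k [^] k_exp (g \<otimes> k [^] i) = k [^] k_exp g \<otimes> k [^] i"
      using k_exp_mult_pow[OF g, of i] k by (simp add: nat_pow_mult k_pow_eq_iff)
    have "f1 (r g) (k [^] k_exp g) * f1 g (k [^] i) = f1 (r g) (k [^] k_exp g \<otimes> k [^] i)"
      using cocycle_eq[OF f1c r_closed[OF g] kp[of "k_exp g"] kp[of i]] k_exp[OF g] f1(2) by simp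
    then have 2: "h g * f1 g (k [^] i) = h (g \<otimes> k [^] i)"
      using g by (simp add: h_def 1 r_mult_pow)
    have 3: "h (k [^] i) = 1"
      using f1(2)[of 0] by (simp add: h_def r_pow)
    have "h (g \<otimes> k [^] i) \<noteq> 0" using h_nz g kp by simp
    then show ?thesis
      using g kp 2 3 by (simp add: f2_def twist_def mult_ac)
  qed
  \<comment> \<open>Triviality of the character is what turns right invariance into left
    invariance.\<close>
  have c2: "f2 (k [^] i) g = f2 g (k [^] i)" if g: "g \<in> carrier G" for g and i :: nat
  proof -
    have "commutation f2 g (k [^] i) = commutation f g k ^ i"
      using commutation_cohomologous[OF monoid_axioms f02 g kp pow_central[OF g]]
        commutation_pow[OF f g k(1) central[OF g]] by simp
    then show ?thesis
      using c[OF g] cocycle_nonzero[OF f2c g kp] cocycle_nonzero[OF f2c kp g] by (simp add: commutation_def)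
  qed
  have mr: "f2 x (y \<otimes> k [^] i) = f2 x y" if "x \<in> carrier G" "y \<in> carrier G" for x y and i :: nat
    using cocycle_eq[OF f2c that kp[of i]] right that by simp
  have ml: "f2 (x \<otimes> k [^] i) y = f2 x y" if "x \<in> carrier G" "y \<in> carrier G" for x y and i :: nat
    using cocycle_eq[OF f2c that(1) kp[of i] that(2)] right c2 that mr
    by (simp add: pow_central[OF that(2), of i, symmetric])
  have inv: "f2 (r x) (r y) = f2 x y" if "x \<in> carrier G" "y \<in> carrier G" for x y
    using mr[of "r x" "r y" "k_exp y"] ml[of "r x" y "k_exp x"] k_exp that r_closed by metis
  show ?thesis
    using that[OF deflate_cocycle(1)[OF f2c inv]] deflate_cocycle(2)[OF f2c inv] f02 by simp
qed

end

section \<open>Roots of unity and transgression\<close>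

definition unit_root :: "nat \<Rightarrow> int \<Rightarrow> complex" where
  "unit_root p i = cis (2 * pi * real_of_int i / real p)"

lemma unit_root_add: "unit_root p (i + j) = unit_root p i * unit_root p j"
  by (simp add: unit_root_def cis_mult add_divide_distrib distrib_left)

lemma unit_root_nonzero: "unit_root p i \<noteq> 0"
  by (simp add: unit_root_def)

lemma unit_root_power: "unit_root p i ^ j = unit_root p (i * int j)"
  by (simp add: unit_root_def DeMoivre mult_ac)

lemma unit_root_eq_iff:
  assumes "0 < p" shows "unit_root p i = unit_root p j \<longleftrightarrow> [i = j] (mod int p)"
proof -
  have one: "unit_root p k = 1 \<longleftrightarrow> int p dvd k" for k
  proof
    assume "unit_root p k = 1"
    then have "cos (2 * pi * real_of_int k / real p) = 1" by (simp add: unit_root_def complex_eq_iff)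
    then obtain m :: int where "2 * pi * real_of_int k / real p = m * 2 * pi"
      using cos_one_2pi_int by auto
    then have "real_of_int k = real_of_int (m * int p)" using assms by (simp add: field_simps)
    then have "k = m * int p" by (simp only: of_int_eq_iff)
    then show "int p dvd k" by simp
  next
    assume "int p dvd k"
    then obtain m where "k = int p * m" by (rule dvdE)
    then have "unit_root p k = cis (2 * pi * real_of_int m)" using assms by (simp add: unit_root_def mult_ac)
    then show "unit_root p k = 1" by (simp add: cis_multiple_2pi)
  qed
  have "unit_root p i = unit_root p (i - j) * unit_root p j" by (simp add: unit_root_add[symmetric])
  then have "unit_root p i = unit_root p j \<longleftrightarrow> unit_root p (i - j) = 1"
    using unit_root_nonzero[of p j] by auto
  then show ?thesis by (simp add: one cong_iff_dvd_diff)
qed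

text \<open>For central k these are the characters of G that k induces. Restriction to the carrier
  makes characters that agree on G equal as functions, so that \<open>card\<close> counts them
  correctly.\<close>

definition schur_pairings :: "('a, 'b) monoid_scheme \<Rightarrow> 'a \<Rightarrow> ('a \<Rightarrow> complex) set" where
  "schur_pairings G k = (\<lambda>f. \<lambda>g\<in>carrier G. commutation f g k) ` schur_cocycles G"

lemma (in group) hom_to_units_trivial_on_derived:
  fixes c :: "'a \<Rightarrow> complex"
  assumes nz: "\<And>x. x \<in> carrier G \<Longrightarrow> c x \<noteq> 0"
    and mult: "\<And>x y. x \<in> carrier G \<Longrightarrow> y \<in> carrier G \<Longrightarrow> c (x \<otimes> y) = c x * c y"
    and g: "g \<in> derived G (carrier G)"
  shows "c g = 1"
proof -
  have one: "c \<one> = 1" using mult[of \<one> \<one>] nz[of \<one>] by simp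
  have inv: "c (inv x) = 1 / c x" if "x \<in> carrier G" for x
    using mult[of "inv x" x] nz[of x] that one by (simp add: field_simps)
  have "subgroup {x \<in> carrier G. c x = 1} G"
    by (rule subgroupI) (auto simp: one inv mult)
  moreover have "derived_set G (carrier G) \<subseteq> {x \<in> carrier G. c x = 1}"
    using nz by (auto simp: mult inv)
  ultimately have "derived G (carrier G) \<subseteq> {x \<in> carrier G. c x = 1}"
    unfolding derived_def by (intro generate_subgroup_incl)
  with g show ?thesis by auto
qed

context central_transversal
begin

text \<open>A set-theoretic extension to G of a faithful character of the subgroup generated by k.
  Its failure to be multiplicative is constant on cosets and is the transgressed cocycle.\<close>

definition L :: "'a \<Rightarrow> complex" where
  "L g = unit_root p (int (k_exp g))"

lemma L_nz: "L g \<noteq> 0" by (simp add: L_def unit_root_nonzero)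

lemma L_mult_pow: "g \<in> carrier G \<Longrightarrow> L (g \<otimes> k [^] (i::nat)) = L g * unit_root p (int i)"
  unfolding L_def unit_root_add[symmetric] unit_root_eq_iff[OF p_pos] cong_def
  using k_exp_mult_pow[of g i] by (metis of_nat_add of_nat_mod)

lemma L_r: "g \<in> carrier G \<Longrightarrow> L (r g) = 1"
  using L_mult_pow[OF r_closed[of g], of "k_exp g"] k_exp[of g] L_nz[of g] by (simp add: L_def)

lemma L_one: "L \<one> = 1" using L_r[of \<one>] r_one by simp

lemma L_mult_r:
  assumes x: "x \<in> carrier G" and y: "y \<in> carrier G"
  shows "L (r x \<otimes> r y) * L x * L y = L (x \<otimes> y)"
proof -
  have "L (x \<otimes> y) = L (r x \<otimes> r y \<otimes> k [^] k_exp x \<otimes> k [^] k_exp y)" by (simp only: mult_decomp x y)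
  also have "\<dots> = L (r x \<otimes> r y) * L x * L y"
    using x y k r_closed L_mult_pow by (simp add: L_def)
  finally show ?thesis by simp
qed

text \<open>The image in M(Q) of the j-th character of the subgroup generated by k under the
  transgression of the five-term exact sequence. Inflated to G it becomes a coboundary, by the
  explicit function \<open>L\<close>.\<close>

definition transgression :: "nat \<Rightarrow> 'a \<Rightarrow> 'a \<Rightarrow> complex" where
  "transgression j = deflate (twist G (\<lambda>g. 1 / L g ^ j) (\<lambda>_ _. 1))"

lemma transgression:
  shows "transgression j \<in> schur_cocycles Q"
    and "(\<lambda>_ _. 1, inflate (transgression j)) \<in> schur_cohomologous G"
    and "x \<in> carrier G \<Longrightarrow> y \<in> carrier G \<Longrightarrow> transgression j (r x) (r y) = (L (x \<otimes> y) / (L x * L y)) ^ j"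
proof -
  let ?t = "twist G (\<lambda>g. 1 / L g ^ j) (\<lambda>_ _. 1)"
  have coh: "(\<lambda>_ _. 1, ?t) \<in> schur_cohomologous G"
    by (rule twist_cohomologous) (auto simp: L_nz schur_cocycles_def)
  then have c: "?t \<in> schur_cocycles G" by (rule cohomologousE)
  have eq: "?t x y = (L (x \<otimes> y) / (L x * L y)) ^ j" if "x \<in> carrier G" "y \<in> carrier G" for x y
    using that by (simp add: twist_def power_divide power_mult_distrib)
  have inv: "?t (r x) (r y) = ?t x y" if "x \<in> carrier G" "y \<in> carrier G" for x y
    using that r_closed L_nz by (simp add: eq L_r L_mult_r[symmetric])
  show "transgression j \<in> schur_cocycles Q"
    unfolding transgression_def by (rule deflate_cocycle(1)[OF c inv])
  show "(\<lambda>_ _. 1, inflate (transgression j)) \<in> schur_cohomologous G"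
    unfolding transgression_def using deflate_cocycle(2)[OF c inv] coh by simp
  show "transgression j (r x) (r y) = (L (x \<otimes> y) / (L x * L y)) ^ j"
    if "x \<in> carrier G" "y \<in> carrier G"
    using inv[OF that] eq[OF that] that by (simp add: transgression_def deflate_def Q_carrier r_closed r_r)
qed

text \<open>A function h that makes two transgressions cohomologous over Q turns
  \<open>L g ^ j / L g ^ i * h (r g)\<close> into a homomorphism from G to the nonzero complex
  numbers. It must be 1 at k because k lies in G', while its value there is the root of unity with
  exponent j - i.\<close>

lemma transgression_inj:
  assumes kd: "k \<in> derived G (carrier G)" and "i < p" "j < p"
    and coh: "(transgression i, transgression j) \<in> schur_cohomologous Q"
  shows "i = j"
  using coh
proof (rule cohomologousE)
  fix h assume h: "\<And>x. x \<in> carrier Q \<Longrightarrow> h x \<noteq> 0"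
    "\<And>x y. x \<in> carrier Q \<Longrightarrow> y \<in> carrier Q \<Longrightarrow>
      transgression j x y = transgression i x y * h x * h y / h (x \<otimes>\<^bsub>Q\<^esub> y)"
  define M where "M g = L g ^ j / L g ^ i * h (r g)" for g
  have rQ: "r g \<in> carrier Q" if "g \<in> carrier G" for g using that by (simp add: Q_carrier r_closed r_r)
  have hr: "h (r g) \<noteq> 0" if "g \<in> carrier G" for g using h(1) rQ that by simp
  have nz: "M g \<noteq> 0" if "g \<in> carrier G" for g using that by (simp add: M_def hr L_nz)
  have mult: "M (x \<otimes> y) = M x * M y" if "x \<in> carrier G" "y \<in> carrier G" for x y
  proof -
    have "(L (x \<otimes> y) / (L x * L y)) ^ j = (L (x \<otimes> y) / (L x * L y)) ^ i * h (r x) * h (r y) / h (r (x \<otimes> y))"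
      using h(2)[OF rQ[OF that(1)] rQ[OF that(2)]] that by (simp add: transgression(3) Q_simps(2) r_mult)
    then have "(L (x \<otimes> y) / (L x * L y)) ^ j * h (r (x \<otimes> y)) = (L (x \<otimes> y) / (L x * L y)) ^ i * h (r x) * h (r y)"
      using hr[of "x \<otimes> y"] that by simp
    then show ?thesis
      using L_nz by (simp add: M_def power_divide power_mult_distrib divide_eq_eq eq_divide_eq)
  qed
  have one: "M \<one> = 1" using mult[of \<one> \<one>] nz[of \<one>] by simp
  have "M k = 1" by (rule hom_to_units_trivial_on_derived[OF nz mult kd])
  moreover have "L k = unit_root p 1" using L_mult_pow[of \<one> 1] L_one k by simp
  ultimately have "unit_root p (int j) = unit_root p (int i)"
    using one r_pow[of 1] k r_one L_nz by (simp add: M_def L_one unit_root_power unit_root_nonzero)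
  then show ?thesis using assms(2,3) by (simp add: unit_root_eq_iff[OF p_pos] cong_def)
qed

text \<open>A counting form of exactness at M(G). A class is recorded by its character and by a
  class of Q that inflates to the quotient of f by a fixed cocycle with the same character.
  Multiplying the latter by m inequivalent transgressions gives m different records of one class,
  which is the gain. The values m = 1 and m = p yield the two bounds that follow.\<close>

lemma card_classes_bound_aux:
  assumes finX: "finite (schur_pairings G k)" and finQ: "finite (schur_classes Q)" and m: "0 < m"
    and T: "\<And>i j. i < m \<Longrightarrow> j < m \<Longrightarrow> (transgression i, transgression j) \<in> schur_cohomologous Q \<Longrightarrow> i = j"
  shows "finite (schur_classes G) \<and> card (schur_classes G) * m \<le> card (schur_classes Q) * card (schur_pairings G k)"
proof -
  let ?R = "schur_cohomologous G" and ?S = "schur_cohomologous Q"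
  note eG = equiv_cohomologous[OF monoid_axioms] and eQ = equiv_cohomologous[OF group.is_monoid[OF group_Q]]
  have symG: "(a, b) \<in> ?R \<Longrightarrow> (b, a) \<in> ?R"
    and transG: "(a, b) \<in> ?R \<Longrightarrow> (b, d) \<in> ?R \<Longrightarrow> (a, d) \<in> ?R" for a b d
    using eG by (meson equivE symD transD)+
  define c where "c f = (\<lambda>g\<in>carrier G. commutation f g k)" for f
  define base where "base \<chi> = (SOME f. f \<in> schur_cocycles G \<and> c f = \<chi>)" for \<chi>
  have base: "base (c f) \<in> schur_cocycles G" "c (base (c f)) = c f" if "f \<in> schur_cocycles G" for f
    using someI_ex[of "\<lambda>e. e \<in> schur_cocycles G \<and> c e = c f"] that unfolding base_def by blast+
  have "\<exists>b. b \<in> schur_cocycles Q \<and> (\<lambda>x y. f x y / base (c f) x y, inflate b) \<in> ?R"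
    if f: "f \<in> schur_cocycles G" for f
  proof -
    have "commutation (\<lambda>x y. f x y / base (c f) x y) g k = 1" if g: "g \<in> carrier G" for g
    proof -
      have "commutation f g k = commutation (base (c f)) g k"
        using fun_cong[OF base(2)[OF f], of g] g by (simp add: c_def)
      moreover have "commutation (\<lambda>x y. f x y / base (c f) x y) g k = commutation f g k / commutation (base (c f)) g k"
        by (simp add: commutation_def)
      ultimately show ?thesis
        using commutation_nonzero[OF base(1)[OF f] g k(1)] by simp
    qed
    then show ?thesis
      by (rule cocycle_is_inflated[OF cocycle_div[OF f base(1)[OF f]]]) blast+
  qed
  note ex_B = this
  define B where "B f = (SOME b. b \<in> schur_cocycles Q \<and>
    (\<lambda>x y. f x y / base (c f) x y, inflate b) \<in> ?R)" for f
  have B: "B f \<in> schur_cocycles Q" "(\<lambda>x y. f x y / base (c f) x y, inflate (B f)) \<in> ?R"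
    if "f \<in> schur_cocycles G" for f
    using someI_ex[OF ex_B[OF that]] unfolding B_def by blast+
  define rep where "rep C = (SOME f. f \<in> C)" for C :: "('a \<Rightarrow> 'a \<Rightarrow> complex) set"
  have rep: "rep C \<in> C" "rep C \<in> schur_cocycles G" if C: "C \<in> schur_classes G" for C
  proof -
    from C obtain f where "f \<in> schur_cocycles G" "C = ?R `` {f}" by (rule quotientE)
    then have "f \<in> C" using equiv_class_self[OF eG] by blast
    then show "rep C \<in> C" unfolding rep_def by (rule someI[of "\<lambda>f. f \<in> C"])
    then show "rep C \<in> schur_cocycles G" using C eG by (metis Union_quotient UnionI)
  qed
  define \<Phi> where "\<Phi> = (\<lambda>(C, j). (c (rep C), ?S `` {\<lambda>x y. B (rep C) x y * transgression j x y}))"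
  have inj: "inj_on \<Phi> (schur_classes G \<times> {..<m})"
  proof (rule inj_onI)
    fix a b assume "a \<in> schur_classes G \<times> {..<m}" "b \<in> schur_classes G \<times> {..<m}" "\<Phi> a = \<Phi> b"
    then obtain C j C' j' where ab: "a = (C, j)" "b = (C', j')"
      and C: "C \<in> schur_classes G" "C' \<in> schur_classes G" and j: "j < m" "j' < m"
      and c_eq: "c (rep C) = c (rep C')"
      and cl: "?S `` {\<lambda>x y. B (rep C) x y * transgression j x y} =
               ?S `` {\<lambda>x y. B (rep C') x y * transgression j' x y}"
      by (auto simp: \<Phi>_def)
    define f f' b1 b2 where "f = rep C" and "f' = rep C'" and "b1 = B f" and "b2 = B f'"
    have f: "f \<in> schur_cocycles G" "f' \<in> schur_cocycles G" and b: "b1 \<in> schur_cocycles Q" "b2 \<in> schur_cocycles Q"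
      using rep C B by (simp_all add: f_def f'_def b1_def b2_def)
    have coh: "(\<lambda>x y. b1 x y * transgression j x y, \<lambda>x y. b2 x y * transgression j' x y) \<in> ?S"
      using cl eQ cocycle_mult[OF b(2) transgression(1)] by (simp add: f_def f'_def b1_def b2_def eq_equiv_class)
    have "(inflate (\<lambda>x y. b1 x y * transgression j x y), inflate (\<lambda>x y. b2 x y * transgression j' x y)) \<in> ?R"
      by (rule inflate_cohomologous[OF coh])
    moreover have "inflate (\<lambda>x y. b x y * transgression j x y) = (\<lambda>x y. inflate b x y * inflate (transgression j) x y)" for b j
      by (intro ext) (simp add: inflate_def)
    ultimately have 1: "(\<lambda>x y. inflate b1 x y * inflate (transgression j) x y, \<lambda>x y. inflate b2 x y * inflate (transgression j') x y) \<in> ?R"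
      by simp
    have tr: "(\<lambda>_ _. 1, inflate (transgression j)) \<in> ?R" for j by (rule transgression(2))
    have tnz: "inflate (transgression j) x y \<noteq> 0" for j x y
      using cocycle_nonzero[OF transgression(1)] by (auto simp: inflate_def Q_carrier r_closed r_r)
    have tt: "(inflate (transgression j), inflate (transgression j')) \<in> ?R"
      by (rule transG[OF symG[OF tr] tr])
    have 2: "(inflate b1, inflate b2) \<in> ?R"
      using cohomologous_div[OF monoid_axioms 1 tt] tnz by simp
    have "(\<lambda>x y. f x y / base (c f) x y, \<lambda>x y. f' x y / base (c f) x y) \<in> ?R"
    proof (rule transG[OF B(2)[OF f(1)] transG[OF _ symG]])
      show "(inflate (B f), inflate (B f')) \<in> ?R"
        using 2 by (simp add: b1_def b2_def)
      show "(\<lambda>x y. f' x y / base (c f) x y, inflate (B f')) \<in> ?R"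
        using B(2)[OF f(2)] c_eq by (simp add: f_def f'_def)
    qed
    moreover have "(base (c f), base (c f)) \<in> ?R"
      using base(1)[OF f(1)] eG by (meson equivE refl_onD)
    ultimately have "(\<lambda>x y. f x y / base (c f) x y * base (c f) x y, \<lambda>x y. f' x y / base (c f) x y * base (c f) x y) \<in> ?R"
      by (rule cohomologous_mult[OF monoid_axioms])
    moreover have "base (c f) x y \<noteq> 0" for x y
      using cocycle_nonzero[OF base(1)[OF f(1)]] cocycle_outside[OF base(1)[OF f(1)]] by (metis one_neq_zero)
    ultimately have "(f, f') \<in> ?R" by simp
    then have CC: "C = C'"
      using C rep(1)[OF C(1)] rep(1)[OF C(2)] eG unfolding f_def f'_def by (meson quotient_eqI)
    \<comment> \<open>The index j is recovered last: with the common factor divided out, the two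
      transgressions themselves are cohomologous over Q.\<close>
    then have "b1 = b2" by (simp add: b1_def b2_def f_def f'_def)
    have b2nz: "b2 x y \<noteq> 0" for x y
      using cocycle_nonzero[OF b(2)] cocycle_outside[OF b(2)] by (metis one_neq_zero)
    have "(b2, b2) \<in> ?S"
      using b eQ by (meson equivE refl_onD)
    from cohomologous_div[OF group.is_monoid[OF group_Q] coh[unfolded \<open>b1 = b2\<close>] this]
    have "(transgression j, transgression j') \<in> ?S"
      using b2nz by simp
    with T j CC ab show "a = b" by simp
  qed
  have into: "\<Phi> ` (schur_classes G \<times> {..<m}) \<subseteq> schur_pairings G k \<times> schur_classes Q"
    using rep(2) B(1) cocycle_mult[OF _ transgression(1)]
    by (auto simp: \<Phi>_def schur_pairings_def c_def intro!: quotientI)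
  have fin: "finite (schur_pairings G k \<times> schur_classes Q)" using finX finQ by simp
  have "finite (schur_classes G \<times> {..<m})"
    by (rule inj_on_finite[OF inj into fin])
  then have "finite (schur_classes G)" using m by (auto dest: finite_cartesian_productD1)
  moreover have "card (schur_classes G \<times> {..<m}) \<le> card (schur_pairings G k \<times> schur_classes Q)"
    by (rule card_inj_on_le[OF inj into fin])
  ultimately show ?thesis by (simp add: card_cartesian_product mult.commute)
qed

lemma card_classes_bound:
  assumes "finite (schur_pairings G k)" "finite (schur_classes Q)"
  shows "finite (schur_classes G)" "card (schur_classes G) \<le> card (schur_classes Q) * card (schur_pairings G k)"
  using card_classes_bound_aux[OF assms, of 1] by auto

lemma card_classes_bound_derived:
  assumes "finite (schur_pairings G k)" "finite (schur_classes Q)" "k \<in> derived G (carrier G)"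
  shows "card (schur_classes G) * p \<le> card (schur_classes Q) * card (schur_pairings G k)"
  using card_classes_bound_aux[OF assms(1,2) p_pos] transgression_inj[OF assms(3)] by blast

end

section \<open>Counting characters\<close>

lemma (in group) sum_nontrivial_character:
  fixes c :: "'a \<Rightarrow> complex"
  assumes mult: "\<And>x y. x \<in> carrier G \<Longrightarrow> y \<in> carrier G \<Longrightarrow> c (x \<otimes> y) = c x * c y"
    and a: "a \<in> carrier G" "c a \<noteq> 1"
  shows "(\<Sum>g\<in>carrier G. c g) = 0"
proof -
  have "bij_betw (\<lambda>g. a \<otimes> g) (carrier G) (carrier G)"
    by (rule bij_betwI[where g = "\<lambda>g. inv a \<otimes> g"]) (use a in \<open>auto simp: m_assoc[symmetric]\<close>)
  then have "(\<Sum>g\<in>carrier G. c g) = (\<Sum>g\<in>carrier G. c (a \<otimes> g))"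
    by (rule sum.reindex_bij_betw[symmetric])
  also have "\<dots> = c a * (\<Sum>g\<in>carrier G. c g)"
    using mult a by (simp add: sum_distrib_left)
  finally show ?thesis using a by simp
qed

text \<open>A second moment argument. Let F be the sum of the characters in a finite set Y.
  Orthogonality gives |Y| |G| for the sum of |F|^2 over G, while F equals |Y| on B, so B alone
  contributes |B| |Y|^2. Finite Y come first because finiteness of \<open>Ch\<close> is itself a
  conclusion.\<close>

lemma (in group) card_characters_le:
  fixes Ch :: "('a \<Rightarrow> complex) set"
  assumes fin: "finite (carrier G)"
    and ext: "\<And>c. c \<in> Ch \<Longrightarrow> c \<in> extensional (carrier G)"
    and nz: "\<And>c x. c \<in> Ch \<Longrightarrow> x \<in> carrier G \<Longrightarrow> c x \<noteq> 0"
    and mult: "\<And>c x y. c \<in> Ch \<Longrightarrow> x \<in> carrier G \<Longrightarrow> y \<in> carrier G \<Longrightarrow> c (x \<otimes> y) = c x * c y"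
    and B: "B \<subseteq> carrier G" "\<And>c x. c \<in> Ch \<Longrightarrow> x \<in> B \<Longrightarrow> c x = 1" "B \<noteq> {}"
  shows "finite Ch" "card Ch * card B \<le> order G"
proof -
  have bound: "card Y * card B \<le> order G" if Y: "finite Y" "Y \<subseteq> Ch" for Y
  proof -
    define F where "F g = (\<Sum>c\<in>Y. c g)" for g
    have nrm: "cmod (c g) = 1" if "c \<in> Ch" "g \<in> carrier G" for c g
    proof -
      have one: "c \<one> = 1" using mult[OF that(1), of \<one> \<one>] nz[OF that(1), of \<one>] by simp
      have "c (g [^] i) = c g ^ i" for i :: nat
      proof (induction i)
        case (Suc i) then show ?case using mult[OF that(1) nat_pow_closed[OF that(2)] that(2)] by simp
      qed (simp add: one)
      from this[of "order G"] have "c g ^ order G = 1"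
        using pow_order_eq_1[OF that(2)] one by simp
      then have "cmod (c g) ^ order G = 1 ^ order G" by (metis norm_power norm_one power_one)
      then show ?thesis
        using fin by (subst (asm) power_eq_iff_eq_base) (auto simp: order_gt_0_iff_finite)
    qed
    have orth: "(\<Sum>g\<in>carrier G. c g * cnj (d g)) = (if c = d then of_nat (order G) else 0)"
      if cd: "c \<in> Ch" "d \<in> Ch" for c d
    proof (cases "c = d")
      case True
      have "c g * cnj (c g) = 1" if "g \<in> carrier G" for g
        using nrm[OF \<open>c \<in> Ch\<close> that] complex_norm_square[of "c g"] by simp
      then show ?thesis using True by (simp add: order_def)
    next
      case False
      then obtain a where a: "a \<in> carrier G" "c a \<noteq> d a"
        using extensionalityI[OF ext[OF cd(1)] ext[OF cd(2)]] by blast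
      have "c a * cnj (d a) \<noteq> 1"
      proof
        assume "c a * cnj (d a) = 1"
        moreover have n: "d a * cnj (d a) = 1"
          using nrm[OF cd(2) a(1)] complex_norm_square[of "d a"] by simp
        moreover have "cnj (d a) \<noteq> 0" using n by auto
        ultimately have "c a = d a" by (metis mult_right_cancel)
        with a show False by simp
      qed
      from sum_nontrivial_character[of "\<lambda>g. c g * cnj (d g)", OF _ a(1) this] False
      show ?thesis using mult[OF cd(1)] mult[OF cd(2)] by simp
    qed
    have "(\<Sum>g\<in>carrier G. F g * cnj (F g)) = (\<Sum>g\<in>carrier G. \<Sum>c\<in>Y. \<Sum>d\<in>Y. c g * cnj (d g))"
      by (simp add: F_def sum_product)
    also have "\<dots> = (\<Sum>c\<in>Y. \<Sum>d\<in>Y. \<Sum>g\<in>carrier G. c g * cnj (d g))"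
      by (subst sum.swap, rule sum.cong[OF refl], rule sum.swap)
    also have "\<dots> = (\<Sum>c\<in>Y. \<Sum>d\<in>Y. if c = d then of_nat (order G) else 0)"
      using Y by (intro sum.cong refl orth) auto
    also have "\<dots> = of_nat (card Y * order G)" using Y by simp
    finally have "complex_of_real (\<Sum>g\<in>carrier G. (cmod (F g))\<^sup>2) = complex_of_real (real (card Y * order G))"
      by (simp only: of_real_sum complex_norm_square of_real_of_nat_eq)
    then have sum: "(\<Sum>g\<in>carrier G. (cmod (F g))\<^sup>2) = real (card Y * order G)"
      by (simp only: of_real_eq_iff)
    have F_B: "F g = of_nat (card Y)" if "g \<in> B" for g
    proof -
      have "F g = (\<Sum>c\<in>Y. 1)" unfolding F_def by (rule sum.cong) (use B Y that in auto)
      then show ?thesis by simp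
    qed
    have "real (card B * (card Y)\<^sup>2) = (\<Sum>g\<in>B. (cmod (F g))\<^sup>2)"
      by (simp add: F_B)
    also have "\<dots> \<le> real (card Y * order G)"
      unfolding sum[symmetric] by (rule sum_mono2) (use fin B in auto)
    finally have "card B * (card Y)\<^sup>2 \<le> card Y * order G" by (simp only: of_nat_le_iff)
    then have "card Y * (card Y * card B) \<le> card Y * order G" by (simp add: power2_eq_square mult_ac)
    then show ?thesis by (cases "card Y = 0") auto
  qed
  have cB: "card B > 0" using B fin by (meson card_gt_0_iff finite_subset)
  show "finite Ch"
  proof (rule ccontr)
    assume "infinite Ch"
    then obtain Y where "finite Y" "Y \<subseteq> Ch" "card Y = Suc (order G)"
      by (meson infinite_arbitrarily_large)
    with bound[of Y] cB show False
      by (metis Suc_n_not_le_n le_trans mult.right_neutral mult_le_mono2 less_eq_Suc_le One_nat_def)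
  qed
  then show "card Ch * card B \<le> order G" using bound by blast
qed

section \<open>Centre, centralizers and commutators\<close>

definition center :: "('a, 'b) monoid_scheme \<Rightarrow> 'a set" where
  "center G = {z \<in> carrier G. \<forall>g\<in>carrier G. g \<otimes>\<^bsub>G\<^esub> z = z \<otimes>\<^bsub>G\<^esub> g}"

definition centralizer :: "('a, 'b) monoid_scheme \<Rightarrow> 'a \<Rightarrow> 'a set" where
  "centralizer G x = {g \<in> carrier G. g \<otimes>\<^bsub>G\<^esub> x = x \<otimes>\<^bsub>G\<^esub> g}"

abbreviation commutator :: "('a, 'b) monoid_scheme \<Rightarrow> 'a \<Rightarrow> 'a \<Rightarrow> 'a" where
  "commutator G x y \<equiv> x \<otimes>\<^bsub>G\<^esub> y \<otimes>\<^bsub>G\<^esub> inv\<^bsub>G\<^esub> x \<otimes>\<^bsub>G\<^esub> inv\<^bsub>G\<^esub> y"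

abbreviation commutator_subgroup :: "('a, 'b) monoid_scheme \<Rightarrow> 'a set" where
  "commutator_subgroup G \<equiv> derived G (carrier G)"

context group
begin

lemma schur_pairings_bound:
  assumes fin: "finite (carrier G)" and k: "k \<in> center G"
    and B: "B \<subseteq> carrier G" "B \<noteq> {}" "\<And>f b. f \<in> schur_cocycles G \<Longrightarrow> b \<in> B \<Longrightarrow> commutation f b k = 1"
  shows "finite (schur_pairings G k)" "card (schur_pairings G k) * card B \<le> order G"
proof -
  have *: "c \<in> extensional (carrier G)" "x \<in> carrier G \<Longrightarrow> c x \<noteq> 0"
    "x \<in> carrier G \<Longrightarrow> y \<in> carrier G \<Longrightarrow> c (x \<otimes> y) = c x * c y"
    "x \<in> B \<Longrightarrow> c x = 1" if c: "c \<in> schur_pairings G k" for c x y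
  proof -
    obtain f where f: "f \<in> schur_cocycles G" "c = (\<lambda>g\<in>carrier G. commutation f g k)"
      using c by (auto simp: schur_pairings_def)
    show "c \<in> extensional (carrier G)" using f by simp
    show "x \<in> carrier G \<Longrightarrow> c x \<noteq> 0" using f k by (simp add: commutation_nonzero center_def)
    show "x \<in> carrier G \<Longrightarrow> y \<in> carrier G \<Longrightarrow> c (x \<otimes> y) = c x * c y"
      using f k by (simp add: center_def commutation_mult_left)
    show "x \<in> B \<Longrightarrow> c x = 1" using f B by auto
  qed
  show "finite (schur_pairings G k)"
    by (rule card_characters_le(1)[where B = B]) (use fin * B in auto)
  show "card (schur_pairings G k) * card B \<le> order G"
    by (rule card_characters_le(2)) (use fin * B in auto)
qed

lemma center_closed: "z \<in> center G \<Longrightarrow> z \<in> carrier G" by (simp add: center_def)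

lemma centralizer_subgroup:
  assumes x: "x \<in> carrier G" shows "subgroup (centralizer G x) G"
proof (rule subgroupI)
  show "centralizer G x \<noteq> {}" using x by (auto simp: centralizer_def intro!: exI[of _ \<one>])
  fix a assume "a \<in> centralizer G x"
  then have a': "a \<in> carrier G" "a \<otimes> x = x \<otimes> a" by (auto simp: centralizer_def)
  have "x = inv a \<otimes> (x \<otimes> a)" using a' x by (metis inv_solve_left m_closed)
  then have "x \<otimes> inv a = inv a \<otimes> x" using a' x by (metis inv_closed inv_solve_right m_assoc m_closed)
  then show "inv a \<in> centralizer G x" using a' x by (simp add: centralizer_def)
  fix b assume b: "b \<in> centralizer G x"
  have b': "b \<in> carrier G" "b \<otimes> x = x \<otimes> b" using b by (auto simp: centralizer_def)
  have "a \<otimes> b \<otimes> x = a \<otimes> x \<otimes> b" using a'(1) b' x by (simp add: m_assoc)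
  also have "\<dots> = x \<otimes> (a \<otimes> b)" using a' b'(1) x by (simp add: m_assoc[symmetric])
  finally show "a \<otimes> b \<in> centralizer G x" using a' b' by (simp add: centralizer_def)
qed (auto simp: centralizer_def)

lemma center_conv: "center G = (\<Inter>x\<in>carrier G. centralizer G x)"
  by (auto simp: center_def centralizer_def)

lemma nat_pow_in_subgroup: "subgroup H G \<Longrightarrow> a \<in> H \<Longrightarrow> a [^] (i::nat) \<in> H"
  by (induction i) (auto intro: subgroup.m_closed subgroup.one_closed)

lemma center_subgroup: "subgroup (center G) G"
  unfolding center_conv by (rule subgroups_Inter) (auto intro: centralizer_subgroup)

text \<open>Each g is determined by F g and by its quotient with a chosen element of the same fibre.
  F is not assumed multiplicative, since it will be a commutator map with one argument
  fixed.\<close>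

lemma card_le_fibres:
  assumes fin: "finite (carrier G)" and A: "finite A" "F ` carrier G \<subseteq> A" and S: "S \<subseteq> carrier G"
    and F: "\<And>g h. g \<in> carrier G \<Longrightarrow> h \<in> carrier G \<Longrightarrow> F g = F h \<Longrightarrow> inv g \<otimes> h \<in> S"
  shows "order G \<le> card S * card A"
proof -
  define s where "s a = (SOME g. g \<in> carrier G \<and> F g = a)" for a
  have s: "s (F g) \<in> carrier G" "F (s (F g)) = F g" if "g \<in> carrier G" for g
    using someI_ex[of "\<lambda>h. h \<in> carrier G \<and> F h = F g"] that unfolding s_def by blast+
  have "inj_on (\<lambda>g. (inv (s (F g)) \<otimes> g, F g)) (carrier G)"
  proof (rule inj_onI)
    fix g h assume gh: "g \<in> carrier G" "h \<in> carrier G"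
      and "(inv (s (F g)) \<otimes> g, F g) = (inv (s (F h)) \<otimes> h, F h)"
    then have e: "F g = F h" and "inv (s (F g)) \<otimes> g = inv (s (F h)) \<otimes> h" by blast+
    then have "inv (s (F g)) \<otimes> g = inv (s (F g)) \<otimes> h" by (simp only: e)
    then show "g = h" using l_cancel[of "inv (s (F g))" g h] s[of g] gh by blast
  qed
  moreover have "(\<lambda>g. (inv (s (F g)) \<otimes> g, F g)) ` carrier G \<subseteq> S \<times> A"
    using s F A by auto
  moreover have "finite (S \<times> A)" using A S fin finite_subset by blast
  ultimately have "card (carrier G) \<le> card (S \<times> A)" by (rule card_inj_on_le)
  then show ?thesis by (simp add: order_def card_cartesian_product)
qed

lemma commutator_eq_imp_centralizer:
  assumes "g \<in> carrier G" "h \<in> carrier G" "x \<in> carrier G"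
    "commutator G g x = commutator G h x"
  shows "inv g \<otimes> h \<in> centralizer G x"
proof -
  have "g \<otimes> x \<otimes> inv g = h \<otimes> x \<otimes> inv h" using assms by simp
  then have "inv g \<otimes> (g \<otimes> x \<otimes> inv g) \<otimes> h = inv g \<otimes> (h \<otimes> x \<otimes> inv h) \<otimes> h" by simp
  moreover have "inv g \<otimes> (g \<otimes> x \<otimes> inv g) \<otimes> h = x \<otimes> (inv g \<otimes> h)"
    using assms(1-3) by (simp add: m_assoc inv_solve_left')
  moreover have "inv g \<otimes> (h \<otimes> x \<otimes> inv h) \<otimes> h = inv g \<otimes> h \<otimes> x"
    using assms(1-3) by (simp add: m_assoc)
  ultimately have "x \<otimes> (inv g \<otimes> h) = inv g \<otimes> h \<otimes> x" by simp
  then show ?thesis using assms by (simp add: centralizer_def)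
qed

lemma commutator_one_iff:
  "x \<in> carrier G \<Longrightarrow> y \<in> carrier G \<Longrightarrow> commutator G x y = \<one> \<longleftrightarrow> x \<otimes> y = y \<otimes> x"
  using inv_solve_right[of \<one> "x \<otimes> y \<otimes> inv x" y] inv_solve_right[of y "x \<otimes> y" x]
  by (auto simp: eq_commute)

lemma commutator_in_derived:
  "x \<in> carrier G \<Longrightarrow> y \<in> carrier G \<Longrightarrow> commutator G x y \<in> commutator_subgroup G"
  unfolding derived_def by (rule generate.incl) auto

text \<open>The representative is chosen from the coset as a set, so constancy on cosets reduces to
  equality of sets. The coset containing the identity is treated separately to obtain
  \<open>r \<one> = \<one>\<close>.\<close>

lemma ex_central_transversal:
  assumes "Factorial_Ring.prime p" and k: "k \<in> center G" "k \<noteq> \<one>" "k [^] (p::nat) = \<one>"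
  obtains r where "central_transversal G k p r"
proof -
  have kc: "k \<in> carrier G" and kz: "\<And>g. g \<in> carrier G \<Longrightarrow> g \<otimes> k = k \<otimes> g" using k by (auto simp: center_def)
  define S where "S g = {g \<otimes> k [^] i | i::nat. True}" for g
  have p0: "p > 0" using assms prime_gt_0_nat by blast
  have S_self: "g \<in> S g" if "g \<in> carrier G" for g
    unfolding S_def using that by (auto intro!: exI[of _ "0::nat"])
  have unshift: "g = h \<otimes> k [^] (i * (p - 1))" if "g \<in> carrier G" "h = g \<otimes> k [^] i" for g h and i :: nat
  proof -
    have "h \<otimes> k [^] (i * (p - 1)) = g \<otimes> k [^] (i + i * (p - 1))"
      using that kc by (simp add: m_assoc nat_pow_mult)
    also have "i + i * (p - 1) = p * i" using p0 by (cases p) auto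
    also have "k [^] (p * i) = \<one>" using k nat_pow_pow[OF kc, of p i] by simp
    finally show ?thesis using that by simp
  qed
  have S_shift: "S (g \<otimes> k) = S g" if g: "g \<in> carrier G" for g
  proof
    show "S (g \<otimes> k) \<subseteq> S g"
    proof
      fix h assume "h \<in> S (g \<otimes> k)"
      then obtain i :: nat where "h = g \<otimes> k \<otimes> k [^] i" by (auto simp: S_def)
      then have "h = g \<otimes> k [^] (Suc i)" using g kc nat_pow_Suc2[OF kc, of i] by (simp add: m_assoc)
      then show "h \<in> S g" unfolding S_def by blast
    qed
    show "S g \<subseteq> S (g \<otimes> k)"
    proof
      fix h assume "h \<in> S g"
      then obtain i :: nat where h: "h = g \<otimes> k [^] i" by (auto simp: S_def)
      have "g = g \<otimes> k \<otimes> k [^] (p - 1)" using unshift[of g "g \<otimes> k" 1] g kc by simp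
      then have "h = g \<otimes> k \<otimes> k [^] (p - 1) \<otimes> k [^] i" using h by simp
      also have "\<dots> = g \<otimes> k \<otimes> k [^] (p - 1 + i)"
        using g kc by (simp add: m_assoc nat_pow_mult)
      finally show "h \<in> S (g \<otimes> k)" by (auto simp: S_def)
    qed
  qed
  define r where "r g = (if \<one> \<in> S g then \<one> else SOME h. h \<in> S g)" for g
  have r: "r g \<in> S g" if "g \<in> carrier G" for g
    using someI[of "\<lambda>h. h \<in> S g", OF S_self[OF that]] by (simp add: r_def)
  show ?thesis
  proof (rule that, unfold_locales)
    fix g assume g: "g \<in> carrier G"
    obtain i :: nat where i: "r g = g \<otimes> k [^] i" using r[OF g] by (auto simp: S_def)
    show "r g \<in> carrier G" using i g kc by simp
    show "\<exists>i::nat. g = r g \<otimes> k [^] i" using unshift[OF g i] by blast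
    show "r (g \<otimes> k) = r g" using S_shift[OF g] by (simp add: r_def)
    show "g \<otimes> k = k \<otimes> g" by (rule kz[OF g])
  next
    show "r \<one> = \<one>" using S_self[of \<one>] by (simp add: r_def)
  qed (use assms kc in auto)
qed

end

lemma (in central_transversal) r_eq_iff:
  "x \<in> carrier G \<Longrightarrow> y \<in> carrier G \<Longrightarrow> r x = r y \<longleftrightarrow> (\<exists>i::nat. x = y \<otimes> k [^] i)"
proof
  assume xy: "x \<in> carrier G" "y \<in> carrier G" and "r x = r y"
  have "r (inv y \<otimes> x) = \<one>"
    using r_mult[of "inv y" x] r_mult[of "inv y" y] xy \<open>r x = r y\<close> r_one by simp
  then obtain i :: nat where "inv y \<otimes> x = k [^] i" using r_eq_one[of "inv y \<otimes> x"] xy by auto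
  then show "\<exists>i::nat. x = y \<otimes> k [^] i" using xy k by (metis inv_closed inv_inv inv_solve_left nat_pow_closed)
qed (auto simp: r_mult_pow)

lemma (in central_transversal) Q_commute_iff:
  assumes xy: "x \<in> carrier G" "y \<in> carrier G"
  shows "r x \<otimes>\<^bsub>Q\<^esub> r y = r y \<otimes>\<^bsub>Q\<^esub> r x \<longleftrightarrow> (\<exists>i::nat. commutator G x y = k [^] i)"
proof -
  have "r x \<otimes>\<^bsub>Q\<^esub> r y = r y \<otimes>\<^bsub>Q\<^esub> r x \<longleftrightarrow> (\<exists>i::nat. x \<otimes> y = (y \<otimes> x) \<otimes> k [^] i)"
    using xy by (simp add: Q_simps(2) r_mult r_eq_iff)
  also have "\<dots> \<longleftrightarrow> (\<exists>i::nat. x \<otimes> y = k [^] i \<otimes> (y \<otimes> x))"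
    using xy pow_central[of "y \<otimes> x"] by simp
  also have "\<dots> \<longleftrightarrow> (\<exists>i::nat. commutator G x y = k [^] i)"
  proof -
    have "x \<otimes> y = c \<otimes> (y \<otimes> x) \<longleftrightarrow> commutator G x y = c" if "c \<in> carrier G" for c
    proof
      assume "x \<otimes> y = c \<otimes> (y \<otimes> x)"
      then show "commutator G x y = c" using xy that by (simp add: m_assoc)
    next
      assume "commutator G x y = c"
      then have "c \<otimes> (y \<otimes> x) = commutator G x y \<otimes> (y \<otimes> x)" by simp
      also have "\<dots> = x \<otimes> y \<otimes> (inv x \<otimes> (inv y \<otimes> (y \<otimes> x)))" using xy by (simp add: m_assoc)
      also have "inv y \<otimes> (y \<otimes> x) = x" using xy by (simp add: m_assoc[symmetric])
      finally show "x \<otimes> y = c \<otimes> (y \<otimes> x)" using xy by simp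
    qed
    then show ?thesis using k by simp
  qed
  finally show ?thesis .
qed

section \<open>Upper bounds for p-groups\<close>

locale p_group = group G for G :: "('a, 'b) monoid_scheme" (structure) +
  fixes p n :: nat
  assumes prime: "Factorial_Ring.prime p" and order: "order G = p ^ n"
begin

lemma p_gt_1: "1 < p"
  by (rule prime_gt_1_nat[OF prime])

lemma p_pos: "0 < p"
  by (rule prime_gt_0_nat[OF prime])

lemma fin: "finite (carrier G)"
  using order p_pos order_gt_0_iff_finite by simp

lemma card_subgroup:
  assumes "subgroup H G" obtains j where "j \<le> n" "card H = p ^ j"
proof -
  have "card H dvd p ^ n" using lagrange[OF assms] order by (metis dvd_triv_right)
  then show ?thesis using that divides_primepow_nat[OF prime] by blast
qed

lemma card_psubset:
  assumes "subgroup H G" "subgroup H' G" "H \<subset> H'"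
  shows "p * card H \<le> card H'"
proof -
  obtain i j where ij: "card H = p ^ i" "card H' = p ^ j" by (metis card_subgroup assms)
  have "card H < card H'"
    using assms fin by (intro psubset_card_mono) (auto intro: finite_subset[OF subgroup.subset])
  then have "Suc i \<le> j" using ij p_gt_1 by (simp add: Suc_leI)
  then have "p ^ Suc i \<le> p ^ j" using p_pos by (intro power_increasing) auto
  then show ?thesis using ij by simp
qed

lemma ex_order_p:
  assumes z: "z \<in> carrier G" "z \<noteq> \<one>"
  obtains i where "z [^] (p ^ i) \<noteq> \<one>" "(z [^] (p ^ i)) [^] p = \<one>"
proof -
  define e where "e = (LEAST e. z [^] (p ^ e) = \<one>)"
  have "z [^] (p ^ n) = \<one>" using pow_order_eq_1[OF z(1)] order by simp
  then have e: "z [^] (p ^ e) = \<one>" unfolding e_def by (rule LeastI)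
  have "e \<noteq> 0" using e z by (metis nat_pow_eone power_0)
  then obtain i where i: "e = Suc i" by (cases e) auto
  then have "z [^] (p ^ i) \<noteq> \<one>" using not_less_Least[of i "\<lambda>e. z [^] (p ^ e) = \<one>"] by (simp add: e_def)
  moreover have "(z [^] (p ^ i)) [^] p = \<one>"
    using e i nat_pow_pow[OF z(1), of "p ^ i" p] by (simp add: mult.commute)
  ultimately show ?thesis by (rule that)
qed

text \<open>The class equation, weighted by the indicator of N without the identity: normality makes
  the weight constant on conjugacy classes. If N met the centre trivially, every class of positive
  weight would have size divisible by p, so p would divide |N| - 1 as well as |N|. A suitable power
  of the central element found then has order p.\<close>

lemma normal_meets_center:
  assumes N: "N \<lhd> G" "N \<noteq> {\<one>}"
  obtains k where "k \<in> N" "k \<in> center G" "k \<noteq> \<one>" "k [^] p = \<one>"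
proof -
  interpret N: normal N G by fact
  let ?\<phi> = "\<lambda>g. \<lambda>h\<in>carrier G. g \<otimes> h \<otimes> inv g"
  interpret act: group_action G "carrier G" ?\<phi> by (rule action_by_conjugation)
  have "\<exists>z\<in>N. z \<in> center G \<and> z \<noteq> \<one>"
  proof (rule ccontr)
    assume no: "\<not> ?thesis"
    define s :: "'a \<Rightarrow> nat" where "s x = (if x \<in> N \<and> x \<noteq> \<one> then 1 else 0)" for x
    have "p dvd (\<Sum>x\<in>orb. s x)" if "orb \<in> orbits G (carrier G) ?\<phi>" for orb
    proof -
      obtain x where x: "x \<in> carrier G" "orb = orbit G ?\<phi> x" using \<open>orb \<in> _\<close> by (auto simp: orbits_def)
      have orb: "orb = {g \<otimes> x \<otimes> inv g | g. g \<in> carrier G}" using x by (auto simp: orbit_def)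
      show ?thesis
      proof (cases "x \<in> N \<and> x \<noteq> \<one>")
        case True
        have "s y = 1" if y: "y \<in> orb" for y
        proof -
          obtain g where g: "g \<in> carrier G" "y = g \<otimes> x \<otimes> inv g" using y orb by auto
          have "y \<noteq> \<one>"
          proof
            assume "y = \<one>"
            then have "g \<otimes> x = g" using g x inv_solve_right[of \<one> "g \<otimes> x" g] by simp
            then have "x = \<one>" using g x by (simp add: r_cancel_one)
            then show False using True by simp
          qed
          moreover have "y \<in> N" using N.inv_op_closed2[of g x] g True by simp
          ultimately show ?thesis by (simp add: s_def)
        qed
        then have "(\<Sum>x\<in>orb. s x) = card orb" by simp
        moreover have "card orb dvd p ^ n"
          by (rule dvdI[of _ _ "card (stabilizer G ?\<phi> x)"])
            (simp only: x(2) act.orbit_stabilizer_theorem[OF x(1)] order)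
        then obtain i where i: "card orb = p ^ i" using divides_primepow_nat[OF prime] by blast
        have "i \<noteq> 0"
        proof
          assume "i = 0"
          then have "card orb = 1" using i by simp
          moreover have "x \<in> orb" using act.orbit_refl[OF x(1)] x(2) by simp
          ultimately have "orb = {x}" by (metis card_1_singletonE singletonD)
          then have conj: "g \<otimes> x \<otimes> inv g = x" if "g \<in> carrier G" for g using that orb by blast
          have "x \<in> center G"
            unfolding center_def
          proof (intro CollectI conjI ballI)
            fix g assume g: "g \<in> carrier G"
            have "g \<otimes> x = (g \<otimes> x \<otimes> inv g) \<otimes> g" using g x by (simp add: m_assoc)
            then show "g \<otimes> x = x \<otimes> g" using conj[OF g] by simp
          qed (rule x)
          then show False using no True by blast
        qed
        then show ?thesis using i calculation by simp
      next
        case False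
        have "s y = 0" if y: "y \<in> orb" for y
        proof -
          obtain g where g: "g \<in> carrier G" "y = g \<otimes> x \<otimes> inv g" using y orb by auto
          show ?thesis
          proof (cases "x = \<one>")
            case True then show ?thesis using g by (simp add: s_def)
          next
            case x1: False
            then have "x \<notin> N" using False by simp
            have "y \<otimes> g = g \<otimes> x" using g x by (simp add: m_assoc)
            then have "x = inv g \<otimes> y \<otimes> g" using g x inv_solve_left[of x g "g \<otimes> x"] by (simp add: m_assoc)
            then have "y \<notin> N" using N.inv_op_closed1[of g y] g \<open>x \<notin> N\<close> by auto
            then show ?thesis by (simp add: s_def)
          qed
        qed
        then have "(\<Sum>x\<in>orb. s x) = 0" by simp
        then show ?thesis by simp
      qed
    qed
    then have "p dvd (\<Sum>orb\<in>orbits G (carrier G) ?\<phi>. \<Sum>x\<in>orb. s x)" by (rule dvd_sum)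
    then have "p dvd (\<Sum>x\<in>carrier G. s x)" by (simp only: act.disjoint_sum[OF fin, of s])
    also have "(\<Sum>x\<in>carrier G. s x) = card {x \<in> carrier G. x \<in> N \<and> x \<noteq> \<one>}"
      using fin by (simp add: s_def sum.If_cases Int_def)
    also have "{x \<in> carrier G. x \<in> N \<and> x \<noteq> \<one>} = N - {\<one>}" using N.subset by auto
    also have "card (N - {\<one>}) = card N - 1" by (simp add: N.one_closed)
    finally have d: "p dvd card N - 1" .
    obtain j where j: "card N = p ^ j" using card_subgroup[OF N.is_subgroup] by blast
    have "j \<noteq> 0"
    proof
      assume "j = 0"
      then have "card N = 1" using j by simp
      then have "N = {\<one>}" using N.one_closed by (metis card_1_singletonE singletonD)
      then show False using N(2) by simp
    qed
    then have "p dvd card N" using j by simp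
    moreover have "card N > 0" using j p_pos by simp
    ultimately have "p dvd 1" using d by (metis dvd_diffD1 Suc_leI One_nat_def)
    then show False using p_gt_1 by simp
  qed
  then obtain z where z: "z \<in> N" "z \<in> center G" "z \<noteq> \<one>" by blast
  obtain i where i: "z [^] (p ^ i) \<noteq> \<one>" "(z [^] (p ^ i)) [^] p = \<one>"
    using ex_order_p[OF center_closed[OF z(2)] z(3)] by blast
  have "z [^] (m::nat) \<in> N \<and> z [^] m \<in> center G" for m
    using nat_pow_in_subgroup[OF center_subgroup z(2)] nat_pow_in_subgroup[OF N.is_subgroup z(1)] by simp
  then show ?thesis using that i by blast
qed

lemma prime_order_subgroup:
  assumes H: "subgroup H G" "card H = p" and k: "k \<in> H" "k \<noteq> \<one>"
  shows "k [^] p = \<one>" and "h \<in> H \<Longrightarrow> \<exists>i::nat. h = k [^] i"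
proof -
  have kc: "k \<in> carrier G" using H k subgroup.mem_carrier by metis
  have sub: "generate G {k} \<subseteq> H" using generate_subgroup_incl[OF _ H(1), of "{k}"] k by simp
  have gs: "subgroup (generate G {k}) G" by (rule generate_is_subgroup) (use kc in simp)
  obtain j where j: "card (generate G {k}) = p ^ j" using card_subgroup[OF gs] by blast
  have "generate G {k} = H"
  proof (rule ccontr)
    assume "generate G {k} \<noteq> H"
    with sub have "p * card (generate G {k}) \<le> p" using card_psubset[OF gs H(1)] H(2) by auto
    then have "card (generate G {k}) \<le> 1" using p_pos by simp
    then have "j = 0" using j p_gt_1 by (metis One_nat_def less_one not_less power_one_right one_less_power neq0_conv)
    then have "card (generate G {k}) = 1" using j by simp
    moreover have "k \<in> generate G {k}" "\<one> \<in> generate G {k}"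
      using generate.incl[of k "{k}" G] generate.one[of G "{k}"] by auto
    ultimately show False using k by (metis card_1_singletonE singletonD)
  qed
  then show "h \<in> H \<Longrightarrow> \<exists>i::nat. h = k [^] i"
    using generate_pow_on_finite_carrier[OF fin kc] by auto
  have "ord k = p" using generate_pow_card[OF kc] \<open>generate G {k} = H\<close> H(2) by simp
  then show "k [^] p = \<one>" using pow_ord_eq_1[OF kc] by simp
qed

lemma powers_subgroup:
  assumes k: "k \<in> carrier G" "k \<noteq> \<one>" "k [^] p = \<one>"
  shows "subgroup {k [^] i | i::nat. True} G" "card {k [^] i | i::nat. True} = p"
proof -
  have eq: "{k [^] i | i::nat. True} = generate G {k}"
    using generate_pow_on_finite_carrier[OF fin k(1)] by simp
  show "subgroup {k [^] i | i::nat. True} G" unfolding eq by (rule generate_is_subgroup) (use k in simp)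
  have "ord k = p" using k prime by (metis ord_eq_1 pow_eq_id prime_nat_iff)
  then show "card {k [^] i | i::nat. True} = p" unfolding eq using generate_pow_card[OF k(1)] by simp
qed

lemma quotient_p_group:
  assumes "central_transversal G k p r" "n = Suc m"
  shows "p_group (central_transversal.Q G r) p m"
proof -
  interpret T: central_transversal G k p r by fact
  have "order T.Q * p = p ^ m * p" unfolding T.card_Q[OF fin] order assms(2) by simp
  then have "order T.Q = p ^ m" using p_gt_1 by (metis mult_right_cancel not_one_less_zero)
  then show ?thesis using T.group_Q prime by (simp add: p_group_def p_group_axioms_def)
qed

lemma classes_trivial:
  assumes "n = 0" shows "finite (schur_classes G)" "card (schur_classes G) \<le> 1"
proof -
  have "card (carrier G) = 1" using order assms by (simp add: order_def)
  then have c: "carrier G = {\<one>}" using one_closed by (metis card_1_singletonE singletonD)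
  have nz: "f \<one> \<one> \<noteq> 0" if "f \<in> schur_cocycles G" for f
    using cocycle_nonzero[OF that one_closed one_closed] .
  have coh: "(f, g) \<in> schur_cohomologous G" if "f \<in> schur_cocycles G" "g \<in> schur_cocycles G" for f g
    by (rule cohomologousI[where h = "\<lambda>_. g \<one> \<one> / f \<one> \<one>"]) (use that c nz[OF that(1)] nz[OF that(2)] in auto)
  have "C = D" if "C \<in> schur_classes G" "D \<in> schur_classes G" for C D
    using that coh by (auto elim!: quotientE intro!: equiv_class_eq[OF equiv_cohomologous[OF monoid_axioms]])
  then obtain a where a: "schur_classes G \<subseteq> {a}" by blast
  show "finite (schur_classes G)" by (rule finite_subset[OF a]) simp
  show "card (schur_classes G) \<le> 1" using card_mono[OF _ a] by simp
qed

lemma pairings_le: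
  assumes "k \<in> center G" "B \<subseteq> carrier G" "p ^ j \<le> card B" "j + i = n"
    and "\<And>f b. f \<in> schur_cocycles G \<Longrightarrow> b \<in> B \<Longrightarrow> commutation f b k = 1"
  shows "finite (schur_pairings G k)" "card (schur_pairings G k) \<le> p ^ i"
proof -
  have "B \<noteq> {}" using assms(3) p_pos by (metis card.empty not_less zero_less_power)
  note * = schur_pairings_bound[OF fin assms(1,2) this assms(5)]
  show "finite (schur_pairings G k)" using *(1) .
  have "card (schur_pairings G k) * p ^ j \<le> card (schur_pairings G k) * card B" using assms(3) by simp
  also have "\<dots> \<le> p ^ i * p ^ j" using *(2) order assms(4) by (simp add: power_add[symmetric] add.commute)
  finally show "card (schur_pairings G k) \<le> p ^ i" using p_pos by simp
qed

lemma commutation_powers: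
  assumes "f \<in> schur_cocycles G" "k \<in> carrier G" "b \<in> {k [^] i | i::nat. True}"
  shows "commutation f b k = 1"
proof -
  obtain i :: nat where "b = k [^] i" using assms by auto
  moreover have "commutation f k k = 1" using cocycle_nonzero[OF assms(1,2,2)] by (simp add: commutation_def)
  ultimately show ?thesis
    using commutation_pow[OF assms(1,2,2) refl, of i] by (simp add: commutation_swap[of f "k [^] i" k])
qed

end

text \<open>This is Green's bound. Commuting with k is trivial on the powers of k, so the induced
  characters live on a group of order p^m, and each central quotient of order p costs at most a
  factor p^m.\<close>

theorem schur_classes_le:
  assumes "p_group (G :: ('a, 'b) monoid_scheme) p n"
  shows "finite (schur_classes G) \<and> card (schur_classes G) \<le> p ^ (\<Sum>i<n. i)"
  using assms
proof (induction n arbitrary: G)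
  case 0
  then show ?case using p_group.classes_trivial by fastforce
next
  case (Suc m)
  interpret p_group G p "Suc m" by fact
  have "carrier G \<noteq> {\<one>\<^bsub>G\<^esub>}"
  proof
    assume "carrier G = {\<one>\<^bsub>G\<^esub>}"
    then have "p ^ Suc m = 1" using order by (simp add: order_def)
    then show False using p_gt_1 by (metis nat.distinct(1) nat_power_eq_Suc_0_iff One_nat_def less_irrefl)
  qed
  moreover have "carrier G \<lhd> G" by (rule normal_invI[OF subgroup_self]) auto
  ultimately obtain k where k: "k \<in> center G" "k \<noteq> \<one>\<^bsub>G\<^esub>" "k [^]\<^bsub>G\<^esub> p = \<one>\<^bsub>G\<^esub>"
    using normal_meets_center by blast
  note kc = center_closed[OF k(1)]
  obtain r where ct: "central_transversal G k p r" using ex_central_transversal[OF prime k] .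
  interpret T: central_transversal G k p r by fact
  have Q: "finite (schur_classes T.Q)" "card (schur_classes T.Q) \<le> p ^ (\<Sum>i<m. i)"
    using Suc.IH[OF quotient_p_group[OF ct refl]] by auto
  have "{k [^]\<^bsub>G\<^esub> i | i::nat. True} \<subseteq> carrier G" using kc by auto
  moreover have "p ^ 1 \<le> card {k [^]\<^bsub>G\<^esub> i | i::nat. True}" using powers_subgroup(2)[OF kc k(2,3)] by simp
  ultimately have P: "finite (schur_pairings G k)" "card (schur_pairings G k) \<le> p ^ m"
    using pairings_le[OF k(1) _ _ _ commutation_powers[OF _ kc], of "{k [^]\<^bsub>G\<^esub> i | i::nat. True}" 1 m] by simp_all
  have "card (schur_classes G) \<le> card (schur_classes T.Q) * card (schur_pairings G k)"
    by (rule T.card_classes_bound(2)[OF P(1) Q(1)])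
  also have "\<dots> \<le> p ^ (\<Sum>i<m. i) * p ^ m" by (rule mult_le_mono[OF Q(2) P(2)])
  finally show ?case using T.card_classes_bound(1)[OF P(1) Q(1)] by (simp add: power_add)
qed

section \<open>Sharper bounds for abelian groups of larger exponent and for nonabelian
  groups\<close>

context p_group
begin

text \<open>If k = w^p has order p, its characters vanish on the elements with x^p = 1, because the
  exponent p can be moved from w to x, and on all p-th powers, because k^p = 1. Kernel and image of
  the p-th power map have orders with product at least |G|, so the square of the number of
  characters is at most |G|. The bound c is left under a square because the exponent n may be
  odd.\<close>

lemma card_classes_abelian_not_exponent_p:
  assumes comm: "\<And>x y. x \<in> carrier G \<Longrightarrow> y \<in> carrier G \<Longrightarrow> x \<otimes> y = y \<otimes> x"
    and n: "n = Suc m" and y: "y \<in> carrier G" "y [^] p \<noteq> \<one>"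
  shows "\<exists>c. card (schur_classes G) \<le> p ^ (\<Sum>i<m. i) * c \<and> c\<^sup>2 \<le> p ^ n"
proof -
  \<comment> \<open>Taking p-power powers of y^p ends at an element of order p that is still a p-th
    power, namely of w.\<close>
  obtain i where i: "(y [^] p) [^] (p ^ i) \<noteq> \<one>" "((y [^] p) [^] (p ^ i)) [^] p = \<one>"
    using ex_order_p[of "y [^] p"] y by auto
  define w where "w = y [^] (p ^ i)"
  define k where "k = w [^] p"
  have w: "w \<in> carrier G" using y by (simp add: w_def)
  have "k = (y [^] p) [^] (p ^ i)"
    using y by (simp add: k_def w_def nat_pow_pow mult.commute)
  then have k: "k \<in> center G" "k \<noteq> \<one>" "k [^] p = \<one>" using i comm y by (auto simp: center_def)
  note kc = center_closed[OF k(1)]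
  obtain r where ct: "central_transversal G k p r" using ex_central_transversal[OF prime k] .
  interpret T: central_transversal G k p r by fact
  have Q: "finite (schur_classes T.Q)" "card (schur_classes T.Q) \<le> p ^ (\<Sum>i<m. i)"
    using schur_classes_le[OF quotient_p_group[OF ct n]] by auto
  define S where "S = {x \<in> carrier G. x [^] p = \<one>}"
  define P where "P = (\<lambda>x. x [^] p) ` carrier G"
  have sw: "commutation f a b = 1 / commutation f b a" for f a b by (rule commutation_swap)
  have xk: "commutation f x k = commutation f x w ^ p" if "f \<in> schur_cocycles G" "x \<in> carrier G" for f x
    unfolding k_def by (rule commutation_pow) (use that w comm in auto)
  have pow_left: "commutation f (x [^] (j::nat)) z = commutation f x z ^ j"
    if "f \<in> schur_cocycles G" "x \<in> carrier G" "z \<in> carrier G" for f x z j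
    using commutation_pow[OF that(1,3,2) comm[OF that(3,2)], of j] by (simp add: sw[of f _ z] power_divide)
  have S1: "commutation f x k = 1" if "f \<in> schur_cocycles G" "x \<in> S" for f x
  proof -
    have x: "x \<in> carrier G" "x [^] p = \<one>" using that by (auto simp: S_def)
    have "commutation f x k = commutation f (x [^] p) w"
      using xk[OF that(1) x(1)] pow_left[OF that(1) x(1) w, of p] by simp
    moreover have "commutation f \<one> w = 1" using commutation_one[OF that(1) w] sw[of f \<one> w] by simp
    ultimately show ?thesis using x by simp
  qed
  have P1: "commutation f x k = 1" if f: "f \<in> schur_cocycles G" and x: "x \<in> P" for f x
  proof -
    obtain z where z: "z \<in> carrier G" "x = z [^] p" using x by (auto simp: P_def)
    have "commutation f x k = commutation f z (k [^] p)"
      using pow_left[OF f z(1) kc, of p] commutation_pow[OF f z(1) kc comm[OF z(1) kc], of p] z by simp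
    then show ?thesis using k commutation_one[OF f z(1)] by simp
  qed
  have ne: "S \<subseteq> carrier G" "S \<noteq> {}" "P \<subseteq> carrier G" "P \<noteq> {}"
    by (auto simp: S_def P_def intro!: exI[of _ \<one>])
  have X1: "finite (schur_pairings G k)" "card (schur_pairings G k) * card S \<le> order G"
    using schur_pairings_bound[OF fin k(1) ne(1,2)] S1 by blast+
  have X2: "card (schur_pairings G k) * card P \<le> order G"
    using schur_pairings_bound[OF fin k(1) ne(3,4)] P1 by blast
  have "order G \<le> card S * card P"
  proof (rule card_le_fibres[OF fin, where F = "\<lambda>x. x [^] p"])
    show "finite P" using fin by (simp add: P_def)
    show "(\<lambda>x. x [^] p) ` carrier G \<subseteq> P" by (simp add: P_def)
    show "S \<subseteq> carrier G" by (rule ne)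
    fix g h assume gh: "g \<in> carrier G" "h \<in> carrier G" "g [^] p = h [^] p"
    then have "(inv g \<otimes> h) [^] p = (inv g) [^] p \<otimes> h [^] p"
      using comm by (intro pow_mult_distrib) auto
    also have "\<dots> = \<one>" using gh by (simp add: nat_pow_inv)
    finally show "inv g \<otimes> h \<in> S" using gh by (simp add: S_def)
  qed
  then have "(card (schur_pairings G k))\<^sup>2 * order G \<le> (card (schur_pairings G k))\<^sup>2 * (card S * card P)"
    by simp
  also have "\<dots> = (card (schur_pairings G k) * card S) * (card (schur_pairings G k) * card P)"
    by (simp add: power2_eq_square mult_ac)
  also have "\<dots> \<le> order G * order G" by (rule mult_le_mono[OF X1(2) X2])
  finally have "(card (schur_pairings G k))\<^sup>2 \<le> p ^ n"
    using order p_pos by simp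
  moreover have "card (schur_classes G) \<le> p ^ (\<Sum>i<m. i) * card (schur_pairings G k)"
    using T.card_classes_bound(2)[OF X1(1) Q(1)] Q(2) by (meson le_trans mult_le_mono1)
  ultimately show ?thesis by blast
qed

lemma derived_subgroup: "subgroup (commutator_subgroup G) G"
  by (rule derived_is_subgroup) simp

lemma derived_nontrivial:
  "x \<in> carrier G \<Longrightarrow> y \<in> carrier G \<Longrightarrow> x \<otimes> y \<noteq> y \<otimes> x \<Longrightarrow> commutator_subgroup G \<noteq> {\<one>}"
  using commutator_in_derived[of x y] commutator_one_iff[of x y] by auto

lemma derived_le:
  assumes "subgroup H G" "\<And>x y. x \<in> carrier G \<Longrightarrow> y \<in> carrier G \<Longrightarrow> commutator G x y \<in> H"
  shows "commutator_subgroup G \<subseteq> H"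
  unfolding derived_def by (rule generate_subgroup_incl[OF _ assms(1)]) (use assms(2) in auto)

lemma pairing_trivial_on_derived:
  assumes "k \<in> center G" "f \<in> schur_cocycles G" "b \<in> commutator_subgroup G"
  shows "commutation f b k = 1"
proof (rule hom_to_units_trivial_on_derived[of "\<lambda>b. commutation f b k", OF _ _ assms(3)])
  show "x \<in> carrier G \<Longrightarrow> commutation f x k \<noteq> 0" for x
    using assms by (simp add: commutation_nonzero center_closed)
  show "x \<in> carrier G \<Longrightarrow> y \<in> carrier G \<Longrightarrow> commutation f (x \<otimes> y) k = commutation f x k * commutation f y k" for x y
    using assms by (intro commutation_mult_left) (auto simp: center_def)
qed

lemma pairing_trivial_on_centralizers:
  assumes x: "x \<in> carrier G" "y \<in> carrier G" and f: "f \<in> schur_cocycles G"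
    and b: "b \<in> centralizer G x" "b \<in> centralizer G y"
  shows "commutation f b (commutator G x y) = 1"
  by (rule commutation_commutator[OF f x]) (use b in \<open>auto simp: centralizer_def\<close>)

lemma centralizer_card:
  assumes x: "x \<in> carrier G" and A: "A \<subseteq> carrier G"
    "\<And>g. g \<in> carrier G \<Longrightarrow> commutator G g x \<in> A"
  shows "order G \<le> card (centralizer G x) * card A"
proof (rule card_le_fibres[OF fin, where F = "\<lambda>g. commutator G g x"])
  show "finite A" by (rule finite_subset[OF A(1) fin])
  show "(\<lambda>g. commutator G g x) ` carrier G \<subseteq> A" using A by auto
  show "centralizer G x \<subseteq> carrier G" by (auto simp: centralizer_def)
qed (rule commutator_eq_imp_centralizer[OF _ _ x])

text \<open>The two commutators with x and y determine g up to the joint centralizer. Separate sets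
  A and B allow one of the commutators to range over a smaller subgroup than the other.\<close>

lemma centralizers_card:
  assumes x: "x \<in> carrier G" "y \<in> carrier G" and A: "A \<subseteq> carrier G" "B \<subseteq> carrier G"
    "\<And>g. g \<in> carrier G \<Longrightarrow> commutator G g x \<in> A"
    "\<And>g. g \<in> carrier G \<Longrightarrow> commutator G g y \<in> B"
  shows "order G \<le> card (centralizer G x \<inter> centralizer G y) * (card A * card B)"
proof -
  have "order G \<le> card (centralizer G x \<inter> centralizer G y) * card (A \<times> B)"
  proof (rule card_le_fibres[OF fin, where F = "\<lambda>g. (commutator G g x, commutator G g y)"])
    show "finite (A \<times> B)"
      by (intro finite_cartesian_product finite_subset[OF A(1) fin] finite_subset[OF A(2) fin])
    show "(\<lambda>g. (commutator G g x, commutator G g y)) ` carrier G \<subseteq> A \<times> B"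
      using A by auto
    show "centralizer G x \<inter> centralizer G y \<subseteq> carrier G" by (auto simp: centralizer_def)
    show "inv g \<otimes> h \<in> centralizer G x \<inter> centralizer G y"
      if "g \<in> carrier G" "h \<in> carrier G"
        "(commutator G g x, commutator G g y) = (commutator G h x, commutator G h y)"
      for g h
      using commutator_eq_imp_centralizer[OF that(1,2) x(1)] commutator_eq_imp_centralizer[OF that(1,2) x(2)] that(3)
      by blast
  qed
  then show ?thesis by (simp add: card_cartesian_product)
qed

text \<open>A normal subgroup of order p meets the centre nontrivially, hence lies in it, and any
  nontrivial element generates it.\<close>

lemma derived_order_p:
  assumes D: "card (commutator_subgroup G) = p" and k: "k \<in> commutator_subgroup G" "k \<noteq> \<one>"
  shows "k \<in> center G" "k [^] p = \<one>" "h \<in> commutator_subgroup G \<Longrightarrow> \<exists>i::nat. h = k [^] i"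
    "h \<in> commutator_subgroup G \<Longrightarrow> h \<in> center G"
proof -
  note po = prime_order_subgroup[OF derived_subgroup D]
  have "commutator_subgroup G \<noteq> {\<one>}" using k by auto
  then obtain z where z: "z \<in> commutator_subgroup G" "z \<in> center G" "z \<noteq> \<one>"
    using normal_meets_center[OF derived_self_is_normal] by blast
  have zp: "z [^] (m::nat) \<in> center G" for m
    by (rule nat_pow_in_subgroup[OF center_subgroup]) fact
  show c: "h \<in> commutator_subgroup G \<Longrightarrow> h \<in> center G" for h using po(2)[OF z(1,3)] zp by metis
  show "k \<in> center G" by (rule c[OF k(1)])
  show "k [^] p = \<one>" "h \<in> commutator_subgroup G \<Longrightarrow> \<exists>i::nat. h = k [^] i" using po[OF k] by auto
qed

text \<open>The characters vanish on the joint centralizer of x and y. Its index is at most p^2, as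
  commutators with x and with y take at most p values each. The bound does not grow with n.\<close>

lemma card_pairings_derived_order_p:
  assumes D: "card (commutator_subgroup G) = p" and xy: "x \<in> carrier G" "y \<in> carrier G" "x \<otimes> y \<noteq> y \<otimes> x"
  shows "finite (schur_pairings G (commutator G x y))"
    "card (schur_pairings G (commutator G x y)) \<le> p\<^sup>2"
proof -
  let ?k = "commutator G x y" and ?B = "centralizer G x \<inter> centralizer G y"
  let ?D = "commutator_subgroup G"
  have k: "?k \<in> ?D" "?k \<noteq> \<one>" using commutator_in_derived commutator_one_iff xy by auto
  have kz: "?k \<in> center G" by (rule derived_order_p(1)[OF D k])
  have B: "?B \<subseteq> carrier G" "?B \<noteq> {}" using xy by (auto simp: centralizer_def intro!: exI[of _ \<one>])
  note * = schur_pairings_bound[OF fin kz B pairing_trivial_on_centralizers[OF xy(1,2)]]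
  show "finite (schur_pairings G ?k)" by (rule *) auto
  have "order G \<le> card ?B * (card ?D * card ?D)"
    by (rule centralizers_card) (use xy commutator_in_derived subgroup.subset[OF derived_subgroup] in auto)
  then have le: "order G \<le> p\<^sup>2 * card ?B" using D by (simp add: power2_eq_square mult.commute)
  have "card (schur_pairings G ?k) * card ?B \<le> order G" by (rule *) auto
  from this le have "card (schur_pairings G ?k) * card ?B \<le> p\<^sup>2 * card ?B" by (rule le_trans)
  moreover have "card ?B > 0" using B fin by (meson card_gt_0_iff finite_subset)
  ultimately show "card (schur_pairings G ?k) \<le> p\<^sup>2" by simp
qed

end

text \<open>If |G'| = p, only the abelian bound is available for the quotient, but p^2 characters
  divided by the gain p leave a single extra factor p. If |G'| > p, the quotient by a central k in
  G' is still nonabelian and induction applies; the characters vanish on at least p^2 elements, and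
  together with the gain p this absorbs the extra factor of the induction hypothesis.\<close>

theorem nonabelian_schur_classes_le:
  assumes "p_group (G :: ('a, 'b) monoid_scheme) p (Suc m)"
    and "x \<in> carrier G" "y \<in> carrier G" "x \<otimes>\<^bsub>G\<^esub> y \<noteq> y \<otimes>\<^bsub>G\<^esub> x"
  shows "finite (schur_classes G) \<and> card (schur_classes G) \<le> p ^ ((\<Sum>i<m. i) + 1) \<and>
    (card (commutator_subgroup G) \<noteq> p \<longrightarrow> card (schur_classes G) \<le> p ^ (\<Sum>i<m. i))"
  using assms
proof (induction m arbitrary: G x y)
  case 0
  interpret p_group G p "Suc 0" by fact
  have "order G = p" using order by simp
  have "x \<noteq> \<one>\<^bsub>G\<^esub>" using 0 by auto
  then obtain i :: nat where "y = x [^]\<^bsub>G\<^esub> i"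
    using prime_order_subgroup(2)[OF subgroup_self _ 0(2), of y] 0 \<open>order G = p\<close> by (auto simp: order_def)
  then have False using 0 by (metis group_commutes_pow)
  then show ?case ..
next
  case (Suc m)
  interpret p_group G p "Suc (Suc m)" by fact
  let ?D = "commutator_subgroup G"
  note nt = derived_nontrivial[OF Suc.prems(2-4)]
  show ?case
  proof (cases "card ?D = p")
    case True
    let ?k = "commutator G x y"
    have k: "?k \<in> ?D" "?k \<noteq> \<one>\<^bsub>G\<^esub>" using commutator_in_derived commutator_one_iff Suc.prems by auto
    have k': "?k \<in> center G" "?k [^]\<^bsub>G\<^esub> p = \<one>\<^bsub>G\<^esub>" using derived_order_p[OF True k] by auto
    obtain r where ct: "central_transversal G ?k p r" using ex_central_transversal[OF prime k'(1) k(2) k'(2)] .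
    interpret T: central_transversal G ?k p r by fact
    have Q: "finite (schur_classes T.Q)" "card (schur_classes T.Q) \<le> p ^ (\<Sum>i<Suc m. i)"
      using schur_classes_le[OF quotient_p_group[OF ct refl]] by auto
    note P = card_pairings_derived_order_p[OF True Suc.prems(2-4)]
    have "card (schur_classes G) * p \<le> card (schur_classes T.Q) * card (schur_pairings G ?k)"
      by (rule T.card_classes_bound_derived[OF P(1) Q(1) k(1)])
    also have "\<dots> \<le> p ^ (\<Sum>i<Suc m. i) * p\<^sup>2" by (rule mult_le_mono[OF Q(2) P(2)])
    also have "\<dots> = p ^ ((\<Sum>i<Suc m. i) + 1) * p" by (simp add: power2_eq_square)
    finally have "card (schur_classes G) \<le> p ^ ((\<Sum>i<Suc m. i) + 1)" using p_pos by simp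
    then show ?thesis using T.card_classes_bound(1)[OF P(1) Q(1)] True by simp
  next
    case False
    obtain k where k: "k \<in> ?D" "k \<in> center G" "k \<noteq> \<one>\<^bsub>G\<^esub>" "k [^]\<^bsub>G\<^esub> p = \<one>\<^bsub>G\<^esub>"
      using normal_meets_center[OF derived_self_is_normal nt] .
    note kc = center_closed[OF k(2)]
    obtain r where ct: "central_transversal G k p r" using ex_central_transversal[OF prime k(2-4)] .
    interpret T: central_transversal G k p r by fact
    let ?K = "{k [^]\<^bsub>G\<^esub> i | i::nat. True}"
    have KD: "?K \<subseteq> ?D"
    proof -
      have "k [^]\<^bsub>G\<^esub> (i::nat) \<in> ?D" for i
    by (rule nat_pow_in_subgroup[OF derived_subgroup]) fact
      then show ?thesis by auto
    qed
    note K = powers_subgroup[OF kc k(3,4)]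
    have "?K \<noteq> ?D" using K(2) False by metis
    then have D_card: "p * p \<le> card ?D" using card_psubset[OF K(1) derived_subgroup] KD K(2) by auto
    \<comment> \<open>G' is larger than the subgroup generated by k, so some commutator survives in
      the quotient.\<close>
    obtain a b where ab: "a \<in> carrier G" "b \<in> carrier G" "commutator G a b \<notin> ?K"
      using derived_le[OF K(1)] KD \<open>?K \<noteq> ?D\<close> by blast
    have Qab: "r a \<in> carrier T.Q" "r b \<in> carrier T.Q" "r a \<otimes>\<^bsub>T.Q\<^esub> r b \<noteq> r b \<otimes>\<^bsub>T.Q\<^esub> r a"
      using ab T.Q_commute_iff[OF ab(1,2)] by (auto simp: T.Q_simps(1))
    have Q: "finite (schur_classes T.Q)" "card (schur_classes T.Q) \<le> p ^ ((\<Sum>i<m. i) + 1)"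
      using Suc.IH[OF quotient_p_group[OF ct refl] Qab] by auto
    have P: "finite (schur_pairings G k)" "card (schur_pairings G k) \<le> p ^ m"
      using pairings_le[OF k(2) subgroup.subset[OF derived_subgroup], of 2 m] D_card
        pairing_trivial_on_derived[OF k(2)] by (auto simp: power2_eq_square)
    have "card (schur_classes G) * p \<le> card (schur_classes T.Q) * card (schur_pairings G k)"
      by (rule T.card_classes_bound_derived[OF P(1) Q(1) k(1)])
    also have "\<dots> \<le> p ^ ((\<Sum>i<m. i) + 1) * p ^ m" by (rule mult_le_mono[OF Q(2) P(2)])
    also have "\<dots> = p ^ (\<Sum>i<Suc m. i) * p" by (simp add: power_add)
    finally have le: "card (schur_classes G) \<le> p ^ (\<Sum>i<Suc m. i)" using p_pos by simp
    also have "\<dots> \<le> p ^ ((\<Sum>i<Suc m. i) + 1)" using p_pos by (intro power_increasing) auto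
    finally show ?thesis using le T.card_classes_bound(1)[OF P(1) Q(1)] by simp
  qed
qed

section \<open>Groups of order p^7 and p^6\<close>

lemma (in group) pow_pow_central:
  assumes x: "x \<in> carrier G" "y \<in> carrier G" and z: "z \<in> center G" and c: "x \<otimes> y = y \<otimes> x \<otimes> z"
  shows "x [^] (i::nat) \<otimes> y [^] (j::nat) = y [^] j \<otimes> x [^] i \<otimes> z [^] (i * j)"
proof -
  have zc: "z \<in> carrier G" and zz: "\<And>g. g \<in> carrier G \<Longrightarrow> z \<otimes> g = g \<otimes> z" using z by (auto simp: center_def)
  have zp: "z [^] (m::nat) \<otimes> g = g \<otimes> z [^] m" if "g \<in> carrier G" for m g
    using group_commutes_pow[OF zz[OF that] zc that] .
  have 1: "x [^] (i::nat) \<otimes> y = y \<otimes> x [^] i \<otimes> z [^] i" for i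
  proof (induction i)
    case (Suc i)
    have "x [^] Suc i \<otimes> y = x [^] i \<otimes> (x \<otimes> y)" using x by (simp add: m_assoc)
    also have "\<dots> = (x [^] i \<otimes> y) \<otimes> x \<otimes> z" using c x zc by (simp add: m_assoc)
    also have "\<dots> = y \<otimes> x [^] i \<otimes> (z [^] i \<otimes> x) \<otimes> z" unfolding Suc using x zc by (simp add: m_assoc)
    also have "\<dots> = y \<otimes> x [^] Suc i \<otimes> z [^] Suc i" unfolding zp[OF x(1)] using x zc by (simp add: m_assoc)
    finally show ?case .
  qed (use x in simp)
  show ?thesis
  proof (induction j)
    case (Suc j)
    have "x [^] i \<otimes> y [^] Suc j = (x [^] i \<otimes> y [^] j) \<otimes> y" using x by (simp add: m_assoc)
    also have "\<dots> = y [^] j \<otimes> x [^] i \<otimes> (z [^] (i * j) \<otimes> y)" unfolding Suc using x zc by (simp add: m_assoc)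
    also have "\<dots> = y [^] j \<otimes> (x [^] i \<otimes> y) \<otimes> z [^] (i * j)" unfolding zp[OF x(2)] using x zc by (simp add: m_assoc)
    also have "\<dots> = y [^] Suc j \<otimes> x [^] i \<otimes> (z [^] i \<otimes> z [^] (i * j))" unfolding 1 using x zc by (simp add: m_assoc)
    also have "z [^] i \<otimes> z [^] (i * j) = z [^] (i * Suc j)" using zc by (simp add: nat_pow_mult)
    finally show ?case .
  qed (use x in simp)
qed

text \<open>The exponent of z is the binomial coefficient i over 2. For i = p it is divisible by p
  exactly when p is odd; here odd primes and p = 2 part ways.\<close>

lemma (in group) pow_mult_central:
  assumes x: "x \<in> carrier G" "y \<in> carrier G" and z: "z \<in> center G" and c: "y \<otimes> x = x \<otimes> y \<otimes> z"
  shows "(x \<otimes> y) [^] (i::nat) = x [^] i \<otimes> y [^] i \<otimes> z [^] (\<Sum>j<i. j)"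
proof (induction i)
  case (Suc i)
  have zc: "z \<in> carrier G" and zz: "\<And>g. g \<in> carrier G \<Longrightarrow> z \<otimes> g = g \<otimes> z" using z by (auto simp: center_def)
  have zp: "z [^] (m::nat) \<otimes> g = g \<otimes> z [^] m" if "g \<in> carrier G" for m g
    using group_commutes_pow[OF zz[OF that] zc that] .
  have yx: "y [^] i \<otimes> x = x \<otimes> y [^] i \<otimes> z [^] i"
    using pow_pow_central[OF x(2,1) z c, of i 1] x by simp
  have "(x \<otimes> y) [^] Suc i = x [^] i \<otimes> y [^] i \<otimes> (z [^] (\<Sum>j<i. j) \<otimes> (x \<otimes> y))"
    using Suc x zc by (simp add: m_assoc)
  also have "\<dots> = x [^] i \<otimes> (y [^] i \<otimes> x) \<otimes> y \<otimes> z [^] (\<Sum>j<i. j)"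
    unfolding zp[OF m_closed[OF x]] using x zc by (simp add: m_assoc)
  also have "\<dots> = x [^] Suc i \<otimes> y [^] i \<otimes> (z [^] i \<otimes> y) \<otimes> z [^] (\<Sum>j<i. j)"
    unfolding yx using x zc by (simp add: m_assoc)
  also have "\<dots> = x [^] Suc i \<otimes> y [^] Suc i \<otimes> (z [^] i \<otimes> z [^] (\<Sum>j<i. j))"
    unfolding zp[OF x(2)] using x zc by (simp add: m_assoc)
  also have "z [^] i \<otimes> z [^] (\<Sum>j<i. j) = z [^] (\<Sum>j<Suc i. j)" using zc by (simp add: nat_pow_mult add.commute)
  finally show ?case .
qed (use x in simp)

lemma (in group) commutator_swap_mult:
  assumes x: "x \<in> carrier G" "y \<in> carrier G" and z: "commutator G x y \<in> center G"
  shows "x \<otimes> y = y \<otimes> x \<otimes> (commutator G x y)"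
proof -
  have "y \<otimes> x \<otimes> (commutator G x y) = (commutator G x y) \<otimes> (y \<otimes> x)"
    using z x by (simp add: center_def)
  also have "\<dots> = x \<otimes> y \<otimes> (inv x \<otimes> (inv y \<otimes> (y \<otimes> x)))" using x by (simp add: m_assoc)
  also have "inv y \<otimes> (y \<otimes> x) = x" using x by (simp add: m_assoc[symmetric])
  finally show ?thesis using x by simp
qed

text \<open>The annihilator of \<open>schur_pairings G k\<close>. Many characters force it to be
  small, and this is how equality in a count is turned into structure of G.\<close>

definition pairing_kernel :: "('a, 'b) monoid_scheme \<Rightarrow> 'a \<Rightarrow> 'a set" where
  "pairing_kernel G k = {g \<in> carrier G. \<forall>f\<in>schur_cocycles G. commutation f g k = 1}"

context p_group
begin

lemma pairing_kernel_subgroup: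
  assumes k: "k \<in> center G" shows "subgroup (pairing_kernel G k) G"
proof -
  have kc: "k \<in> carrier G" and kz: "\<And>g. g \<in> carrier G \<Longrightarrow> k \<otimes> g = g \<otimes> k" using k by (auto simp: center_def)
  have one: "commutation f \<one> k = 1" if "f \<in> schur_cocycles G" for f
    using commutation_one[OF that kc] commutation_swap[of f \<one> k] by simp
  have inv: "commutation f (inv a) k = 1 / commutation f a k" if "f \<in> schur_cocycles G" "a \<in> carrier G" for f a
    using commutation_inv[OF that(1) kc that(2) kz[OF that(2)]] commutation_swap[of f "inv a" k]
      commutation_swap[of f a k] by simp
  have mult: "commutation f (a \<otimes> b) k = commutation f a k * commutation f b k"
    if "f \<in> schur_cocycles G" "a \<in> carrier G" "b \<in> carrier G" for f a b
    using commutation_mult_left[OF that(1) kc that(2,3)] kz that by simp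
  show ?thesis
    by (rule subgroupI) (auto simp: pairing_kernel_def one inv mult)
qed

lemma card_pairings_kernel:
  assumes "k \<in> center G"
  shows "card (schur_pairings G k) * card (pairing_kernel G k) \<le> order G"
proof (rule schur_pairings_bound(2)[OF fin assms])
  show "pairing_kernel G k \<noteq> {}" using subgroup.one_closed[OF pairing_kernel_subgroup[OF assms]] by auto
qed (auto simp: pairing_kernel_def)

lemma ex_noncommuting:
  assumes "commutator_subgroup G \<noteq> {\<one>}"
  obtains x y where "x \<in> carrier G" "y \<in> carrier G" "x \<otimes> y \<noteq> y \<otimes> x"
proof -
  have "\<exists>x\<in>carrier G. \<exists>y\<in>carrier G. x \<otimes> y \<noteq> y \<otimes> x"
  proof (rule ccontr)
    assume "\<not> ?thesis"
    then have "commutator G x y \<in> {\<one>}" if "x \<in> carrier G" "y \<in> carrier G" for x y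
      using commutator_one_iff[OF that] that by blast
    then have "commutator_subgroup G \<subseteq> {\<one>}"
      by (rule derived_le[OF triv_subgroup])
    then show False using assms subgroup.one_closed[OF derived_subgroup] by auto
  qed
  then show ?thesis using that by blast
qed

lemma center_psubset_centralizer:
  assumes "x \<in> carrier G" "x \<notin> center G"
  shows "center G \<subset> centralizer G x" "centralizer G x \<subset> carrier G"
proof -
  show "center G \<subset> centralizer G x" using assms by (auto simp: center_def centralizer_def)
  obtain g where "g \<in> carrier G" "g \<otimes> x \<noteq> x \<otimes> g" using assms by (auto simp: center_def)
  then show "centralizer G x \<subset> carrier G" by (auto simp: centralizer_def)
qed

lemma center_card_le:
  assumes x: "x \<in> carrier G" "x \<notin> center G"
  shows "p\<^sup>2 * card (center G) \<le> order G"
proof -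
  note ps = center_psubset_centralizer[OF x]
  have "p * card (center G) \<le> card (centralizer G x)"
    by (rule card_psubset[OF center_subgroup centralizer_subgroup[OF x(1)] ps(1)])
  then have "p * (p * card (center G)) \<le> p * card (centralizer G x)" by simp
  also have "\<dots> \<le> order G" unfolding order_def
    by (rule card_psubset[OF centralizer_subgroup[OF x(1)] subgroup_self ps(2)])
  finally show ?thesis by (simp add: power2_eq_square mult.assoc)
qed

text \<open>When |G'| = p, the element k is a power of [x,y] for every noncommuting pair, so an
  element centralizing any such pair is annihilated, whichever pair produced k.\<close>

lemma pairing_trivial_on_noncommuting:
  assumes D: "card (commutator_subgroup G) = p" and k: "k \<in> commutator_subgroup G"
    and x: "x \<in> carrier G" "y \<in> carrier G" "x \<otimes> y \<noteq> y \<otimes> x"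
    and b: "b \<in> carrier G" "b \<otimes> x = x \<otimes> b" "b \<otimes> y = y \<otimes> b" and f: "f \<in> schur_cocycles G"
  shows "commutation f b k = 1"
proof -
  let ?k = "commutator G x y"
  have k0: "?k \<in> commutator_subgroup G" "?k \<noteq> \<one>" using commutator_in_derived commutator_one_iff x by auto
  obtain i :: nat where i: "k = ?k [^] i" using derived_order_p(3)[OF D k0 k] by blast
  have "?k \<in> center G" by (rule derived_order_p(1)[OF D k0])
  then have "commutation f b k = commutation f b ?k ^ i"
    unfolding i using b by (intro commutation_pow[OF f]) (auto simp: center_def)
  moreover have "commutation f b ?k = 1" by (rule commutation_commutator[OF f x(1,2) b])
  ultimately show ?thesis by simp
qed

text \<open>If a character does not vanish at w, no noncommuting pair centralizes w, so C(w) is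
  abelian, and its index is at most p. For u outside C(w), an element s of C(w) and C(u) commutes
  with C(w) and with u, so C(s) properly contains a subgroup of index at most p and is all of G.
  Thus a subgroup of index at most p^2 is central.\<close>

lemma center_card_ge:
  assumes D: "card (commutator_subgroup G) = p" and k: "k \<in> commutator_subgroup G"
    and f: "f \<in> schur_cocycles G" and w: "w \<in> carrier G" "commutation f w k \<noteq> 1"
  shows "order G \<le> p\<^sup>2 * card (center G)"
proof -
  let ?D = "commutator_subgroup G"
  note triv = pairing_trivial_on_noncommuting[OF D k _ _ _ w(1) _ _ f]
  have ab: "a \<otimes> b = b \<otimes> a" if "a \<in> centralizer G w" "b \<in> centralizer G w" for a b
    using triv[of a b] that w by (auto simp: centralizer_def)
  have "?D \<noteq> {\<one>}" using D p_gt_1 by auto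
  then obtain x y where xy: "x \<in> carrier G" "y \<in> carrier G" "x \<otimes> y \<noteq> y \<otimes> x" by (rule ex_noncommuting)
  then obtain u where u: "u \<in> carrier G" "u \<otimes> w \<noteq> w \<otimes> u" using triv[OF xy] w by metis
  let ?S = "centralizer G w \<inter> centralizer G u"
  have DG: "?D \<subseteq> carrier G" by (rule subgroup.subset[OF derived_subgroup])
  have cd: "commutator G g a \<in> ?D" if "g \<in> carrier G" "a \<in> carrier G" for g a
    using commutator_in_derived that by simp
  have "order G \<le> card ?S * (card ?D * card ?D)"
    by (rule centralizers_card[OF w(1) u(1) DG DG cd cd]) (use w u in auto)
  also have "?S \<subseteq> center G"
  proof
    fix s assume s: "s \<in> ?S"
    then have sc: "s \<in> carrier G" by (simp add: centralizer_def)
    have "centralizer G w \<subset> centralizer G s"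
    proof
      show "centralizer G w \<subseteq> centralizer G s" using ab s by (auto simp: centralizer_def)
      have "u \<in> centralizer G s" "u \<notin> centralizer G w" using s u by (auto simp: centralizer_def)
      then show "centralizer G w \<noteq> centralizer G s" by blast
    qed
    then have "p * card (centralizer G w) \<le> card (centralizer G s)"
      by (rule card_psubset[OF centralizer_subgroup[OF w(1)] centralizer_subgroup[OF sc]])
    moreover have "order G \<le> card (centralizer G w) * card ?D"
      by (rule centralizer_card[OF w(1) DG]) (use cd w in auto)
    ultimately have "card (carrier G) \<le> card (centralizer G s)"
      unfolding D by (simp add: mult.commute order_def)
    moreover have "centralizer G s \<subseteq> carrier G" by (auto simp: centralizer_def)
    ultimately have "centralizer G s = carrier G" using fin by (simp add: card_seteq)
    then show "s \<in> center G" using sc by (auto simp: centralizer_def center_def)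
  qed
  then have "card ?S \<le> card (center G)"
    by (intro card_mono finite_subset[OF subgroup.subset[OF center_subgroup] fin])
  then have "card ?S * (card ?D * card ?D) \<le> p\<^sup>2 * card (center G)"
    unfolding D by (simp add: power2_eq_square mult.commute)
  finally show ?thesis .
qed

lemma center_subset_kernel:
  assumes D: "card (commutator_subgroup G) = p" and k: "k \<in> commutator_subgroup G"
  shows "center G \<subseteq> pairing_kernel G k"
proof -
  have "commutator_subgroup G \<noteq> {\<one>}" using D p_gt_1 by auto
  then obtain x y where xy: "x \<in> carrier G" "y \<in> carrier G" "x \<otimes> y \<noteq> y \<otimes> x" by (rule ex_noncommuting)
  then show ?thesis
    using pairing_trivial_on_noncommuting[OF D k xy] by (auto simp: pairing_kernel_def center_def)
qed

text \<open>k is a power of w^p, hence of w, and w pairs trivially with its own powers. Read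
  backwards: if all p-th powers lie in G', elements outside the kernel satisfy w^p = 1.\<close>

lemma pow_in_derived_imp_kernel:
  assumes D: "card (commutator_subgroup G) = p" and k: "k \<in> commutator_subgroup G"
    and w: "w \<in> carrier G" "w [^] p \<in> commutator_subgroup G" "w [^] p \<noteq> \<one>"
  shows "w \<in> pairing_kernel G k"
proof -
  obtain i :: nat where i: "k = (w [^] p) [^] i" using derived_order_p(3)[OF D w(2,3) k] by blast
  then have i: "k = w [^] (p * i)" using nat_pow_pow[OF w(1)] by simp
  have "commutation f w k = 1" if f: "f \<in> schur_cocycles G" for f
    unfolding i commutation_pow[OF f w(1) w(1) refl] using cocycle_nonzero[OF f w(1) w(1)] by (simp add: commutation_def)
  then show ?thesis using w by (simp add: pairing_kernel_def)
qed

text \<open>h counts the classes of G/G', which is abelian. An element with p-th power outside G'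
  gives G/G' an exponent larger than p, so the square-root bound applies to h. Passing h on as a
  bare number keeps transversals out of the arguments that use it.\<close>

lemma derived_order_p_estimate:
  assumes D: "card (commutator_subgroup G) = p" and n: "n = Suc (Suc m)"
    and k: "k \<in> commutator_subgroup G" "k \<noteq> \<one>"
  obtains h where "card (schur_classes G) * p \<le> h * card (schur_pairings G k)" "h \<le> p ^ (\<Sum>i<Suc m. i)"
    "\<And>g. g \<in> carrier G \<Longrightarrow> g [^] p \<notin> commutator_subgroup G \<Longrightarrow> \<exists>c. h \<le> p ^ (\<Sum>i<m. i) * c \<and> c\<^sup>2 \<le> p ^ Suc m"
proof -
  let ?D = "commutator_subgroup G"
  note kD = derived_order_p[OF D k]
  obtain r where ct: "central_transversal G k p r" using ex_central_transversal[OF prime kD(1) k(2) kD(2)] .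
  interpret T: central_transversal G k p r by fact
  have Qp: "p_group T.Q p (Suc m)" by (rule quotient_p_group[OF ct n])
  interpret Q: p_group T.Q p "Suc m" by (rule Qp)
  have Q: "finite (schur_classes T.Q)" "card (schur_classes T.Q) \<le> p ^ (\<Sum>i<Suc m. i)"
    using schur_classes_le[OF Qp] by auto
  have P: "finite (schur_pairings G k)"
    by (rule schur_pairings_bound(1)[OF fin kD(1), of "pairing_kernel G k"])
      (use subgroup.one_closed[OF pairing_kernel_subgroup[OF kD(1)]] in \<open>auto simp: pairing_kernel_def\<close>)
  show ?thesis
  proof (rule that)
    show "card (schur_classes G) * p \<le> card (schur_classes T.Q) * card (schur_pairings G k)"
      by (rule T.card_classes_bound_derived[OF P Q(1) k(1)])
    show "card (schur_classes T.Q) \<le> p ^ (\<Sum>i<Suc m. i)" by (rule Q)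
    fix g assume g: "g \<in> carrier G" "g [^] p \<notin> ?D"
    have comm: "a \<otimes>\<^bsub>T.Q\<^esub> b = b \<otimes>\<^bsub>T.Q\<^esub> a" if "a \<in> carrier T.Q" "b \<in> carrier T.Q" for a b
    proof -
      have ab: "a \<in> carrier G" "b \<in> carrier G" "T.Q = T.Q" "r a = a" "r b = b" using that by (auto simp: T.Q_carrier)
      have "\<exists>i::nat. commutator G a b = k [^] i"
        by (rule kD(3)[OF commutator_in_derived[OF ab(1,2)]])
      then show ?thesis using T.Q_commute_iff[OF ab(1,2)] ab by simp
    qed
    have pw: "r g [^]\<^bsub>T.Q\<^esub> (j::nat) = r (g [^] j)" for j
      by (induction j) (use g in \<open>auto simp: T.Q_simps T.r_one T.r_mult\<close>)
    have "r (g [^] p) \<noteq> \<one>"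
    proof
      assume "r (g [^] p) = \<one>"
      then obtain i :: nat where i: "g [^] p = k [^] i" using T.r_eq_one g by auto
      have "k [^] (i::nat) \<in> ?D" for i
    by (rule nat_pow_in_subgroup[OF derived_subgroup]) fact
      then show False using i g by simp
    qed
    then have "r g [^]\<^bsub>T.Q\<^esub> p \<noteq> \<one>\<^bsub>T.Q\<^esub>" by (simp add: pw T.Q_simps)
    moreover have "r g \<in> carrier T.Q" using g by (simp add: T.Q_simps)
    ultimately show "\<exists>c. card (schur_classes T.Q) \<le> p ^ (\<Sum>i<m. i) * c \<and> c\<^sup>2 \<le> p ^ Suc m"
      using Q.card_classes_abelian_not_exponent_p[OF comm refl] by blast
  qed
qed

lemma kernel_ne_carrier_imp_center_card:
  assumes D: "card (commutator_subgroup G) = p" and k: "k \<in> commutator_subgroup G"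
    and n: "n = Suc (Suc m)" and ne: "pairing_kernel G k \<noteq> carrier G"
  shows "card (center G) = p ^ m"
proof -
  obtain f w where fw: "f \<in> schur_cocycles G" "w \<in> carrier G" "commutation f w k \<noteq> 1"
    using ne by (auto simp: pairing_kernel_def)
  have "order G \<le> p\<^sup>2 * card (center G)" by (rule center_card_ge[OF D k fw])
  moreover have "w \<notin> center G" using center_subset_kernel[OF D k] fw by (auto simp: pairing_kernel_def)
  then have "p\<^sup>2 * card (center G) \<le> order G" using center_card_le[OF fw(2)] by simp
  ultimately have "p\<^sup>2 * card (center G) = order G" by simp
  also have "\<dots> = p\<^sup>2 * p ^ m" using order n by (simp add: power2_eq_square mult_ac)
  finally show ?thesis using p_pos by simp
qed

text \<open>16 + 1 = 15 + 2, so G/G' has the largest possible multiplier and there are exactly p^2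
  characters. The kernel then has index at least p^2 and contains the centre, which has index p^2;
  they coincide, and all elements outside the centre have trivial p-th power.\<close>

lemma order_p_power_7:
  assumes n: "n = 7" and c: "card (schur_classes G) = p ^ 16"
    and nc: "x \<in> carrier G" "y \<in> carrier G" "x \<otimes> y \<noteq> y \<otimes> x"
  shows "card (commutator_subgroup G) = p" "card (center G) = p ^ 5" "\<And>g. g \<in> carrier G \<Longrightarrow> g [^] p = \<one>" "odd p"
proof -
  let ?D = "commutator_subgroup G" and ?k = "commutator G x y"
  let ?x = "card (schur_pairings G ?k)" and ?B = "pairing_kernel G ?k"
  have pg: "p_group G p (Suc 6)" using p_group_axioms n by simp
  show D: "card ?D = p"
  proof (rule ccontr)
    assume "card ?D \<noteq> p"
    then have "p ^ 16 \<le> p ^ (\<Sum>i<6. i)" using nonabelian_schur_classes_le[OF pg nc] c by auto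
    then have "16 \<le> (\<Sum>i<6. i::nat)" using p_gt_1 by simp
    then show False by (simp add: eval_nat_numeral)
  qed
  have k: "?k \<in> ?D" "?k \<noteq> \<one>" using commutator_in_derived commutator_one_iff nc by auto
  note kD = derived_order_p[OF D k]
  have t: "(\<Sum>i<Suc 5. i) = (15::nat)" "(\<Sum>i<5. i) = (10::nat)" by (simp_all add: eval_nat_numeral)
  have "n = Suc (Suc 5)" using n by simp
  from derived_order_p_estimate[OF D this k] obtain h where
    h: "p ^ 17 \<le> h * ?x" "h \<le> p ^ 15"
      "\<And>g. g \<in> carrier G \<Longrightarrow> g [^] p \<notin> ?D \<Longrightarrow> \<exists>c. h \<le> p ^ 10 * c \<and> c\<^sup>2 \<le> p ^ 6"
    unfolding c t by (simp add: eval_nat_numeral mult_ac) blast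
  have X: "?x \<le> p\<^sup>2" by (rule card_pairings_derived_order_p[OF D nc])
  \<comment> \<open>An exponent larger than p in G/G' would lower h to p^13, and 13 + 2 <
    17.\<close>
  have powD: "g [^] p \<in> ?D" if g: "g \<in> carrier G" for g
  proof (rule ccontr)
    assume "g [^] p \<notin> ?D"
    then obtain c where c: "h \<le> p ^ 10 * c" "c\<^sup>2 \<le> p ^ 6" using h(3)[OF g] by blast
    have "c\<^sup>2 \<le> (p ^ 3)\<^sup>2" using c by (simp add: power_mult[symmetric])
    then have "c \<le> p ^ 3" by (rule power2_le_imp_le) simp
    then have "h \<le> p ^ 10 * p ^ 3" using c(1) by (meson le_trans mult_le_mono2)
    then have "p ^ 17 \<le> (p ^ 10 * p ^ 3) * p\<^sup>2" using h(1) X by (meson le_trans mult_le_mono)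
    then have "p ^ 17 \<le> p ^ 15" by (simp add: power_add[symmetric])
    then show False using p_gt_1 by simp
  qed
  have "p ^ 15 * p\<^sup>2 \<le> p ^ 15 * ?x"
    using le_trans[OF h(1) mult_le_mono1[OF h(2)]] by (simp add: power_add[symmetric])
  then have X2: "p\<^sup>2 \<le> ?x"
    by (rule nat_mult_le_cancel1[THEN iffD1, rotated]) (simp add: p_pos)
  have K: "p\<^sup>2 * card ?B \<le> order G"
    using mult_le_mono1[OF X2] card_pairings_kernel[OF kD(1)] by (rule le_trans)
  have ne: "?B \<noteq> carrier G"
  proof
    assume "?B = carrier G"
    then have "p\<^sup>2 * order G \<le> 1 * order G" using K by (simp add: order_def)
    then have "p\<^sup>2 \<le> 1" using order p_pos by simp
    then show False using p_gt_1 by (metis one_less_power not_less zero_less_numeral)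
  qed
  have "n = Suc (Suc 5)" using n by simp
  from kernel_ne_carrier_imp_center_card[OF D k(1) this ne] show Z: "card (center G) = p ^ 5" .
  have eq: "?B = center G"
  proof (rule ccontr)
    assume "?B \<noteq> center G"
    then have "p * card (center G) \<le> card ?B"
      using center_subset_kernel[OF D k(1)]
      by (intro card_psubset[OF center_subgroup pairing_kernel_subgroup[OF kD(1)]]) auto
    then have "p\<^sup>2 * (p * card (center G)) \<le> order G" using K by (meson le_trans mult_le_mono2)
    then have "p ^ 8 \<le> p ^ 7" using Z order n by (simp add: power_add[symmetric] eval_nat_numeral mult_ac)
    then show False using p_gt_1 by simp
  qed
  have nonc: "g [^] p = \<one>" if "g \<in> carrier G" "g \<notin> center G" for g
    using pow_in_derived_imp_kernel[OF D k(1) that(1) powD[OF that(1)]] that(2) eq by auto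
  have xn: "x \<notin> center G" using nc by (metis (mono_tags, lifting) center_def mem_Collect_eq)
  show exponent: "g [^] p = \<one>" if g: "g \<in> carrier G" for g
  proof (cases "g \<in> center G")
    case True
    \<comment> \<open>A central g is the quotient of the noncentral commuting elements x g and x,
      both of which have trivial p-th power.\<close>
    have "x \<otimes> g \<notin> center G"
    proof
      assume "x \<otimes> g \<in> center G"
      then have "x \<otimes> g \<otimes> inv g \<in> center G"
        using True center_subgroup by (meson subgroup.m_closed subgroup.m_inv_closed)
      then show False using xn nc g by (simp add: m_assoc)
    qed
    then have "(x \<otimes> g) [^] p = \<one>" using nonc nc g by simp
    moreover have "(x \<otimes> g) [^] p = x [^] p \<otimes> g [^] p"
      using True nc g by (intro pow_mult_distrib) (auto simp: center_def)
    ultimately show ?thesis using nonc[OF nc(1) xn] g by simp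
  qed (rule nonc[OF g])
  show "odd p"
  proof
    assume "even p"
    then have "p = 2" using primes_dvd_imp_eq[OF two_is_prime_nat prime] by simp
    then have sq: "g \<otimes> g = \<one>" if "g \<in> carrier G" for g using exponent[OF that] that by (simp add: numeral_2_eq_2)
    have "inv g = g" if "g \<in> carrier G" for g using inv_equality[OF sq[OF that] that that] .
    then have "x \<otimes> y = y \<otimes> x" using nc inv_mult_group[of x y] by simp
    then show False using nc by simp
  qed
qed

end

section \<open>Order p^6\<close>

context p_group
begin

text \<open>Otherwise the bound for |G'| > p is attained. For every admissible k this makes G' the
  kernel, of order p^2, and gives the quotient a centre of order p^3. Elements central in the
  quotient turn out to be central in G, so |Z(G)| >= p^4. But Z(G) lies in the joint centralizer of
  any pair, and for a pair whose commutator is central of order p this joint centralizer is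
  contained in the kernel of order p^2.\<close>

lemma order_p_power_6_derived:
  assumes n: "n = 6" and c: "card (schur_classes G) = p ^ 10"
    and nc: "x \<in> carrier G" "y \<in> carrier G" "x \<otimes> y \<noteq> y \<otimes> x"
  shows "card (commutator_subgroup G) = p"
proof (rule ccontr)
  assume nD: "card (commutator_subgroup G) \<noteq> p"
  let ?D = "commutator_subgroup G"
  have DG: "?D \<subseteq> carrier G" by (rule subgroup.subset[OF derived_subgroup])
  note nt = derived_nontrivial[OF nc]
  obtain j where j: "card ?D = p ^ j" using card_subgroup[OF derived_subgroup] by blast
  have "j \<noteq> 1" using j nD by auto
  moreover have "j \<noteq> 0"
  proof
    assume "j = 0"
    then have "card ?D = 1" using j by simp
    then show False using nt subgroup.one_closed[OF derived_subgroup] by (metis card_1_singletonE singletonD)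
  qed
  ultimately have j2: "2 \<le> j" by simp
  have n6: "n = Suc 5" using n by simp
  have t: "(\<Sum>i<5. i) = (10::nat)" "(\<Sum>i<4. i) = (6::nat)" by (simp_all add: eval_nat_numeral)
  text \<open>Equality must hold in every step of the estimate.\<close>
  have tight: "card ?D = p\<^sup>2 \<and> pairing_kernel G k = ?D \<and>
      (\<exists>r. central_transversal G k p r \<and> p_group (central_transversal.Q G r) p 5 \<and>
        card (commutator_subgroup (central_transversal.Q G r)) = p \<and>
        card (center (central_transversal.Q G r)) = p ^ 3)"
    if k: "k \<in> ?D" "k \<in> center G" "k \<noteq> \<one>" "k [^] p = \<one>" for k
  proof -
    note kc = center_closed[OF k(2)]
    obtain r where ct: "central_transversal G k p r" using ex_central_transversal[OF prime k(2-4)] .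
    interpret T: central_transversal G k p r by fact
    have Qp: "p_group T.Q p 5" by (rule quotient_p_group[OF ct n6])
    interpret Q: p_group T.Q p 5 by (rule Qp)
    let ?K = "{k [^] i | i::nat. True}"
    note K = powers_subgroup[OF kc k(3,4)]
    have "k [^] (i::nat) \<in> ?D" for i
    by (rule nat_pow_in_subgroup[OF derived_subgroup]) fact
    then have KD: "?K \<subseteq> ?D" by auto
    have "?K \<noteq> ?D" using K(2) nD by metis
    then obtain a b where ab: "a \<in> carrier G" "b \<in> carrier G" "commutator G a b \<notin> ?K"
      using derived_le[OF K(1)] KD by blast
    have Qab: "r a \<in> carrier T.Q" "r b \<in> carrier T.Q" "r a \<otimes>\<^bsub>T.Q\<^esub> r b \<noteq> r b \<otimes>\<^bsub>T.Q\<^esub> r a"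
      using ab T.Q_commute_iff[OF ab(1,2)] by (auto simp: T.Q_simps(1))
    have Qp': "p_group T.Q p (Suc 4)" using Qp by simp
    have Q: "finite (schur_classes T.Q)" "card (schur_classes T.Q) \<le> p ^ 7"
      "card (commutator_subgroup T.Q) \<noteq> p \<Longrightarrow> card (schur_classes T.Q) \<le> p ^ 6"
      using nonabelian_schur_classes_le[OF Qp' Qab] unfolding t by auto
    have "p ^ 2 \<le> card ?D" unfolding j using j2 p_pos by (intro power_increasing) auto
    then have P: "finite (schur_pairings G k)" "card (schur_pairings G k) \<le> p ^ 4"
      using pairings_le[OF k(2) DG, of 2 4] pairing_trivial_on_derived[OF k(2)] n by auto
    \<comment> \<open>Since 11 = 7 + 4, neither factor may fall short of its upper bound.\<close>
    have le: "p ^ 11 \<le> card (schur_classes T.Q) * card (schur_pairings G k)"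
      using T.card_classes_bound_derived[OF P(1) Q(1) k(1)] unfolding c by (simp add: eval_nat_numeral mult_ac)
    have "p ^ 7 * p ^ 4 \<le> p ^ 7 * card (schur_pairings G k)"
      using le_trans[OF le mult_le_mono1[OF Q(2)]] by (simp add: power_add[symmetric])
    then have X: "p ^ 4 \<le> card (schur_pairings G k)"
      by (rule nat_mult_le_cancel1[THEN iffD1, rotated]) (simp add: p_pos)
    have "p ^ 4 * p ^ 7 \<le> p ^ 4 * card (schur_classes T.Q)"
      using le_trans[OF le mult_le_mono2[OF P(2)]] by (simp add: power_add[symmetric] mult.commute)
    then have Q7: "p ^ 7 \<le> card (schur_classes T.Q)"
      by (rule nat_mult_le_cancel1[THEN iffD1, rotated]) (simp add: p_pos)
    have DQ: "card (commutator_subgroup T.Q) = p"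
    proof (rule ccontr)
      assume "\<not> ?thesis"
      then have "p ^ 7 \<le> p ^ 6" using Q(3) Q7 by simp
      then show False using p_gt_1 by simp
    qed
    have "p ^ 4 * card (pairing_kernel G k) \<le> order G"
      using mult_le_mono1[OF X] card_pairings_kernel[OF k(2)] by (rule le_trans)
    also have "order G = p ^ 4 * p\<^sup>2" using order n by (simp add: power_add[symmetric])
    finally have kk: "card (pairing_kernel G k) \<le> p\<^sup>2"
      by (rule nat_mult_le_cancel1[THEN iffD1, rotated]) (simp add: p_pos)
    have Dk: "?D \<subseteq> pairing_kernel G k" using DG pairing_trivial_on_derived[OF k(2)] by (auto simp: pairing_kernel_def)
    have fk: "finite (pairing_kernel G k)" using fin by (simp add: pairing_kernel_def)
    have eq: "pairing_kernel G k = ?D"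
      using kk \<open>p ^ 2 \<le> card ?D\<close> by (intro card_seteq[symmetric, OF fk Dk]) simp
    then have D2: "card ?D = p\<^sup>2" using kk \<open>p ^ 2 \<le> card ?D\<close> by simp
    \<comment> \<open>The same reasoning one quotient further down: 7 + 1 = 6 + 2 forces p^2
      characters for Q too, so the kernel in Q is proper and the centre of Q has index p^2.\<close>
    let ?kQ = "r a \<otimes>\<^bsub>T.Q\<^esub> r b \<otimes>\<^bsub>T.Q\<^esub> inv\<^bsub>T.Q\<^esub> r a \<otimes>\<^bsub>T.Q\<^esub> inv\<^bsub>T.Q\<^esub> r b"
    have kQ: "?kQ \<in> commutator_subgroup T.Q" "?kQ \<noteq> \<one>\<^bsub>T.Q\<^esub>"
      using Q.commutator_in_derived[OF Qab(1,2)] Q.commutator_one_iff[OF Qab(1,2)] Qab(3) by auto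
    have "(5::nat) = Suc (Suc 3)" by simp
    from Q.derived_order_p_estimate[OF DQ this kQ] obtain h where
      h: "card (schur_classes T.Q) * p \<le> h * card (schur_pairings T.Q ?kQ)" "h \<le> p ^ (\<Sum>i<Suc 3. i)"
      by metis
    have h6: "h \<le> p ^ 6" using h(2) t(2) by simp
    have "p ^ 6 * p\<^sup>2 \<le> p ^ 7 * p" by (simp add: eval_nat_numeral)
    also have "\<dots> \<le> card (schur_classes T.Q) * p" using Q7 by simp
    also have "\<dots> \<le> h * card (schur_pairings T.Q ?kQ)" by (rule h)
    also have "\<dots> \<le> p ^ 6 * card (schur_pairings T.Q ?kQ)" using h6 by simp
    finally have X2: "p\<^sup>2 \<le> card (schur_pairings T.Q ?kQ)"
      by (rule nat_mult_le_cancel1[THEN iffD1, rotated]) (simp add: p_pos)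
    have "pairing_kernel T.Q ?kQ \<noteq> carrier T.Q"
    proof
      assume "pairing_kernel T.Q ?kQ = carrier T.Q"
      then have "card (schur_pairings T.Q ?kQ) * order T.Q \<le> 1 * order T.Q"
        using Q.card_pairings_kernel[OF Q.derived_order_p(1)[OF DQ kQ]] by (simp add: order_def)
      then have "card (schur_pairings T.Q ?kQ) \<le> 1" using Q.order p_pos by simp
      then have "p\<^sup>2 \<le> 1" using X2 by simp
      then show False using p_gt_1 by (metis one_less_power not_less zero_less_numeral)
    qed
    then have "card (center T.Q) = p ^ 3"
      by (intro Q.kernel_ne_carrier_imp_center_card[OF DQ kQ(1)]) simp_all
    then show ?thesis using D2 eq ct Qp DQ by blast
  qed
  obtain k where k: "k \<in> ?D" "k \<in> center G" "k \<noteq> \<one>" "k [^] p = \<one>"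
    using normal_meets_center[OF derived_self_is_normal nt] .
  have D2: "card ?D = p\<^sup>2" using tight[OF k] by blast
  \<comment> \<open>[u,v] may itself serve as k, and its kernel is again G'.\<close>
  have small: "card (centralizer G u \<inter> centralizer G v) \<le> p\<^sup>2"
    if u: "u \<in> carrier G" "v \<in> carrier G" "commutator G u v \<in> center G"
      "commutator G u v \<noteq> \<one>" "(commutator G u v) [^] p = \<one>" for u v
  proof -
    have "centralizer G u \<inter> centralizer G v \<subseteq> pairing_kernel G (commutator G u v)"
      using pairing_trivial_on_centralizers[OF u(1,2)] by (auto simp: pairing_kernel_def centralizer_def)
    also have "\<dots> = ?D" using tight[OF commutator_in_derived[OF u(1,2)] u(3-5)] by blast
    finally show ?thesis unfolding D2[symmetric] by (intro card_mono finite_subset[OF DG fin])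
  qed
  obtain r where ct: "central_transversal G k p r" and Qp: "p_group (central_transversal.Q G r) p 5"
    and DQ: "card (commutator_subgroup (central_transversal.Q G r)) = p"
    and ZQ: "card (center (central_transversal.Q G r)) = p ^ 3"
    using tight[OF k] by blast
  interpret T: central_transversal G k p r by fact
  interpret Q: p_group T.Q p 5 by fact
  note kc = center_closed[OF k(2)]
  let ?K = "{k [^] i | i::nat. True}"
  note K = powers_subgroup[OF kc k(3,4)]
  have KZ: "k [^] (i::nat) \<in> center G" for i
    by (rule nat_pow_in_subgroup[OF center_subgroup]) fact
  have KG: "?K \<subseteq> carrier G" using kc by auto
  \<comment> \<open>All commutators with x lie in the group of order p generated by k, so the joint
    centralizer of x and any v has index at most p times p^2. If [x,v] were nontrivial, it would be
    central of order p, and that centralizer would have order at most p^2, giving |G| <=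
    p^5.\<close>
  have lift: "x \<in> center G" if x: "x \<in> carrier G" "r x \<in> center T.Q" for x
  proof (rule ccontr)
    assume xZ: "x \<notin> center G"
    have comm: "commutator G g x \<in> ?K" "commutator G x g \<in> ?K" if g: "g \<in> carrier G" for g
    proof -
      have "r g \<in> carrier T.Q" using g by (simp add: T.Q_simps(1))
      then have "r g \<otimes>\<^bsub>T.Q\<^esub> r x = r x \<otimes>\<^bsub>T.Q\<^esub> r g" using x by (simp add: center_def)
      then show "commutator G g x \<in> ?K" "commutator G x g \<in> ?K"
        using T.Q_commute_iff[OF g x(1)] T.Q_commute_iff[OF x(1) g] by auto
    qed
    obtain v where v: "v \<in> carrier G" "x \<otimes> v \<noteq> v \<otimes> x" using x xZ by (auto simp: center_def)
    let ?c = "commutator G x v"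
    have cK: "?c \<in> ?K" "?c \<noteq> \<one>" using comm[OF v(1)] commutator_one_iff[OF x(1) v(1)] v by auto
    have "order G \<le> card (centralizer G x \<inter> centralizer G v) * (card ?K * card ?D)"
      by (rule centralizers_card[OF x(1) v(1) KG DG comm(1)]) (use v commutator_in_derived in auto)
    also have "\<dots> \<le> p\<^sup>2 * (p * p\<^sup>2)"
      unfolding K(2) D2 using small[OF x(1) v(1)] cK KZ prime_order_subgroup(1)[OF K cK] by (intro mult_le_mono1) auto
    also have "\<dots> = p ^ 5" by (simp add: eval_nat_numeral)
    finally show False using order n p_gt_1 by simp
  qed
  \<comment> \<open>G' maps into the derived subgroup of Q, which has order p and is therefore
    central there; \<open>lift\<close> pulls this back.\<close>
  have DZ: "?D \<subseteq> center G"
  proof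
    fix d assume d: "d \<in> ?D"
    have "subgroup {g \<in> carrier G. r g \<in> commutator_subgroup T.Q} G"
    proof -
      interpret h: group_hom G T.Q r using T.r_hom T.group_Q by unfold_locales
      have "r \<one> \<in> commutator_subgroup T.Q"
        using subgroup.one_closed[OF Q.derived_subgroup] h.hom_one by simp
      then show ?thesis
        by (intro subgroupI)
          (auto intro: exI[of _ \<one>] subgroup.one_closed[OF Q.derived_subgroup] subgroup.m_closed[OF Q.derived_subgroup]
            subgroup.m_inv_closed[OF Q.derived_subgroup])
    qed
    moreover have "r (commutator G a b) \<in> commutator_subgroup T.Q" if "a \<in> carrier G" "b \<in> carrier G" for a b
    proof -
      interpret h: group_hom G T.Q r using T.r_hom T.group_Q by unfold_locales
      show ?thesis using that Q.commutator_in_derived[of "r a" "r b"] by simp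
    qed
    ultimately have "?D \<subseteq> {g \<in> carrier G. r g \<in> commutator_subgroup T.Q}"
      by (intro derived_le) auto
    then have "d \<in> carrier G" "r d \<in> commutator_subgroup T.Q" using d by auto
    moreover have "commutator_subgroup T.Q \<noteq> {\<one>\<^bsub>T.Q\<^esub>}" using DQ p_gt_1 by auto
    then obtain e where "e \<in> commutator_subgroup T.Q" "e \<noteq> \<one>\<^bsub>T.Q\<^esub>"
      using subgroup.one_closed[OF Q.derived_subgroup] by blast
    ultimately show "d \<in> center G" using lift Q.derived_order_p(4)[OF DQ] by blast
  qed
  have Zcard: "p ^ 4 \<le> card (center G)"
  proof -
    have sub: "center T.Q \<times> {..<p} \<subseteq> carrier T.Q \<times> {..<p}" by (auto simp: center_def)
    have "(\<lambda>(q, i). q \<otimes> k [^] i) ` (center T.Q \<times> {..<p}) \<subseteq> center G"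
    proof clarify
      fix q and i :: nat assume q: "q \<in> center T.Q"
      then have "q \<in> carrier G" "r q = q" using Q.center_closed[OF q] by (auto simp: T.Q_carrier)
      then have "q \<in> center G" using lift q by simp
      then show "q \<otimes> k [^] i \<in> center G" by (rule subgroup.m_closed[OF center_subgroup _ KZ])
    qed
    then have "card (center T.Q \<times> {..<p}) \<le> card (center G)"
      by (intro card_inj_on_le[OF inj_on_subset[OF T.inj_Q_pow sub]])
        (auto intro: finite_subset[OF subgroup.subset[OF center_subgroup] fin])
    then show ?thesis using ZQ by (simp add: card_cartesian_product eval_nat_numeral mult_ac)
  qed
  let ?z = "commutator G x y"
  have z: "?z \<in> center G" "?z \<noteq> \<one>" using DZ commutator_in_derived nc commutator_one_iff by auto
  \<comment> \<open>G' might be cyclic of order p^2, so [x,y] need not have order p. As it is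
    central, replacing x by a p-power of x raises the commutator to the same power.\<close>
  obtain i where i: "?z [^] (p ^ i) \<noteq> \<one>" "(?z [^] (p ^ i)) [^] p = \<one>"
    using ex_order_p[OF center_closed[OF z(1)] z(2)] .
  define u where "u = x [^] (p ^ i)"
  have u: "u \<in> carrier G" using nc by (simp add: u_def)
  have zi: "?z [^] (p ^ i) \<in> carrier G" using center_closed[OF z(1)] by simp
  have "u \<otimes> y = y \<otimes> u \<otimes> ?z [^] (p ^ i)"
    using pow_pow_central[OF nc(1,2) z(1) commutator_swap_mult[OF nc(1,2) z(1)], of "p ^ i" 1] nc by (simp add: u_def)
  also have "\<dots> = ?z [^] (p ^ i) \<otimes> (y \<otimes> u)"
    using group_commutes_pow[of ?z "y \<otimes> u" "p ^ i"] z u nc by (simp add: center_def)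
  finally have "commutator G u y = ?z [^] (p ^ i)"
    using zi u nc by (simp add: m_assoc)
  moreover have "?z [^] (m::nat) \<in> center G" for m
    by (rule nat_pow_in_subgroup[OF center_subgroup]) fact
  ultimately have "card (centralizer G u \<inter> centralizer G y) \<le> p\<^sup>2"
    using small[OF u nc(2)] i by simp
  moreover have "center G \<subseteq> centralizer G u \<inter> centralizer G y"
    using u nc by (auto simp: center_def centralizer_def)
  then have "card (center G) \<le> card (centralizer G u \<inter> centralizer G y)"
    by (intro card_mono) (auto simp: centralizer_def intro: finite_subset[OF _ fin])
  ultimately have "p ^ 4 \<le> p\<^sup>2" using Zcard by simp
  then show False using p_gt_1 by simp
qed

text \<open>The spare factor p means that only p characters are guaranteed, so the kernel B is a
  proper subgroup containing the centre but possibly larger than it. All elements outside B have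
  trivial p-th power. As B is a proper subgroup, multiplying an element outside B by one inside
  stays outside; the three conclusions exploit this.\<close>

lemma order_p_power_6:
  assumes n: "n = 6" and c: "card (schur_classes G) = p ^ 10"
    and nc: "x \<in> carrier G" "y \<in> carrier G" "x \<otimes> y \<noteq> y \<otimes> x"
  shows "card (center G) = p ^ 4"
    and "odd p \<Longrightarrow> g \<in> carrier G \<Longrightarrow> g [^] p = \<one>"
    and "even p \<Longrightarrow> p = 2 \<and> (\<forall>z\<in>center G. z \<otimes> z = \<one>) \<and>
      (\<exists>s\<in>carrier G. \<exists>t\<in>carrier G. s \<otimes> t \<noteq> t \<otimes> s \<and> s \<otimes> s = \<one> \<and> t \<otimes> t = \<one>)"
proof -
  let ?D = "commutator_subgroup G" and ?k = "commutator G x y"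
  let ?x = "card (schur_pairings G ?k)" and ?B = "pairing_kernel G ?k"
  have D: "card ?D = p" by (rule order_p_power_6_derived[OF n c nc])
  have k: "?k \<in> ?D" "?k \<noteq> \<one>" using commutator_in_derived commutator_one_iff nc by auto
  note kD = derived_order_p[OF D k]
  have t: "(\<Sum>i<Suc 4. i) = (10::nat)" "(\<Sum>i<4. i) = (6::nat)" by (simp_all add: eval_nat_numeral)
  have n6: "n = Suc (Suc 4)" using n by simp
  from derived_order_p_estimate[OF D n6 k] obtain h where
    h: "p ^ 11 \<le> h * ?x" "h \<le> p ^ 10"
      "\<And>g. g \<in> carrier G \<Longrightarrow> g [^] p \<notin> ?D \<Longrightarrow> \<exists>c. h \<le> p ^ 6 * c \<and> c\<^sup>2 \<le> p ^ 5"
    unfolding c t by (simp add: eval_nat_numeral mult_ac) blast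
  have X: "?x \<le> p\<^sup>2" by (rule card_pairings_derived_order_p[OF D nc])
  have powD: "g [^] p \<in> ?D" if g: "g \<in> carrier G" for g
  proof (rule ccontr)
    assume "g [^] p \<notin> ?D"
    then obtain c where c: "h \<le> p ^ 6 * c" "c\<^sup>2 \<le> p ^ 5" using h(3)[OF g] by blast
    \<comment> \<open>The odd exponent 5 makes the square-root bound strict, c < p^3. A weak
      inequality would give only 9 + 2 = 11 and no contradiction.\<close>
    have "p ^ 5 < p ^ 6" using p_gt_1 by simp
    then have "c\<^sup>2 < (p ^ 3)\<^sup>2" using c by (simp add: power_mult[symmetric])
    then have "c < p ^ 3" by (rule power_less_imp_less_base) simp
    then have "p ^ 6 * c < p ^ 6 * p ^ 3" by (rule mult_strict_left_mono) (simp add: p_pos)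
    with c(1) have "h < p ^ 6 * p ^ 3" by (rule le_less_trans)
    then have "h < p ^ 9" by (simp add: power_add[symmetric])
    then have "h * p\<^sup>2 < p ^ 9 * p\<^sup>2" by (rule mult_strict_right_mono) (simp add: p_pos)
    moreover have "p ^ 11 \<le> h * p\<^sup>2" using le_trans[OF h(1) mult_le_mono2[OF X]] .
    ultimately show False by (simp add: power_add[symmetric])
  qed
  have "p ^ 10 * p \<le> p ^ 10 * ?x"
    using le_trans[OF h(1) mult_le_mono1[OF h(2)]] by (simp add: eval_nat_numeral mult_ac)
  then have X1: "p \<le> ?x"
    by (rule nat_mult_le_cancel1[THEN iffD1, rotated]) (simp add: p_pos)
  note sB = pairing_kernel_subgroup[OF kD(1)]
  have ne: "?B \<noteq> carrier G"
  proof
    assume "?B = carrier G"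
    then have "?x * order G \<le> 1 * order G"
      using card_pairings_kernel[OF kD(1)] by (simp add: order_def)
    then have "?x \<le> 1" using order p_pos by simp
    then show False using X1 p_gt_1 by simp
  qed
  show "card (center G) = p ^ 4" by (rule kernel_ne_carrier_imp_center_card[OF D k(1) n6 ne])
  have ZB: "center G \<subseteq> ?B" by (rule center_subset_kernel[OF D k(1)])
  have inB: "w \<in> ?B" if "w \<in> carrier G" "w [^] p \<noteq> \<one>" for w
    by (rule pow_in_derived_imp_kernel[OF D k(1) that(1) powD[OF that(1)] that(2)])
  have cancel: "w \<in> ?B" if "v \<in> ?B" "w \<in> carrier G" "v \<otimes> w \<in> ?B" for v w
  proof -
    have "v \<in> carrier G" using that by (simp add: pairing_kernel_def)
    then have "w = inv v \<otimes> (v \<otimes> w)" using that by (simp add: m_assoc[symmetric])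
    then show ?thesis using that subgroup.m_closed[OF sB subgroup.m_inv_closed[OF sB that(1)]] by metis
  qed
  show "g [^] p = \<one>" if odd: "odd p" and g: "g \<in> carrier G"
  proof (rule ccontr)
    assume gp: "g [^] p \<noteq> \<one>"
    \<comment> \<open>For odd p the power map is multiplicative on g and w, so w^p = 1 implies (g
      w)^p = g^p, which is nontrivial. Then g and g w both lie in B, hence so does w, and B would be
      all of G.\<close>
    have "w \<in> ?B" if w: "w \<in> carrier G" for w
    proof (cases "w [^] p = \<one>")
      case True
      let ?c = "commutator G w g"
      have cD: "?c \<in> ?D" using commutator_in_derived w g by simp
      then have cZ: "?c \<in> center G" by (rule kD(4))
      have "?c [^] p = \<one>"
      proof (cases "?c = \<one>")
        case False
        then show ?thesis by (rule derived_order_p(2)[OF D cD])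
      qed simp
      moreover have "p dvd (\<Sum>j<p. j)"
      proof -
        obtain m where m: "p = 2 * m + 1" using odd by (auto elim: oddE)
        have "(\<Sum>j<2 * q + 1. j) = (2 * q + 1) * q" for q :: nat
          by (induction q) (simp_all add: algebra_simps)
        from this[of m] have "(\<Sum>j<p. j) = p * m" using m by simp
        then show ?thesis by simp
      qed
      ultimately have "?c [^] (\<Sum>j<p. j) = \<one>"
        using nat_pow_pow[OF center_closed[OF cZ], of p] by (auto elim!: dvdE)
      then have "(g \<otimes> w) [^] p = g [^] p"
        using pow_mult_central[OF g w cZ commutator_swap_mult[OF w g cZ], of p] True g by simp
      then have "g \<otimes> w \<in> ?B" using inB[of "g \<otimes> w"] g w gp by simp
      then show ?thesis by (rule cancel[OF inB[OF g gp] w])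
    qed (rule inB[OF w])
    then show False using ne by (auto simp: pairing_kernel_def)
  qed
  assume "even p"
  then have p2: "p = 2" using primes_dvd_imp_eq[OF two_is_prime_nat prime] by simp
  have inB2: "w \<in> ?B" if "w \<in> carrier G" "w \<otimes> w \<noteq> \<one>" for w
    using inB that by (simp add: p2 numeral_2_eq_2)
  obtain u where u: "u \<in> carrier G" "u \<notin> ?B" using ne by (auto simp: pairing_kernel_def)
  have u2: "u \<otimes> u = \<one>" using inB2 u by blast
  \<comment> \<open>z u stays outside B because z lies in B and u does not, so both u and z u square
    to the identity.\<close>
  have "z \<otimes> z = \<one>" if z: "z \<in> center G" for z
  proof -
    have zc: "z \<in> carrier G" "u \<otimes> z = z \<otimes> u" using z u by (auto simp: center_def)
    have "z \<otimes> u \<notin> ?B" using cancel[of z u] z ZB u by auto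
    then have "(z \<otimes> u) \<otimes> (z \<otimes> u) = \<one>" using inB2 zc u by blast
    moreover have "(z \<otimes> u) \<otimes> (z \<otimes> u) = z \<otimes> (u \<otimes> z) \<otimes> u" using zc(1) u by (simp add: m_assoc)
    moreover have "\<dots> = z \<otimes> z \<otimes> (u \<otimes> u)" unfolding zc(2) using zc(1) u by (simp add: m_assoc)
    ultimately show ?thesis using u2 zc by simp
  qed
  moreover have "\<exists>s\<in>carrier G. \<exists>t\<in>carrier G. s \<otimes> t \<noteq> t \<otimes> s \<and> s \<otimes> s = \<one> \<and> t \<otimes> t = \<one>"
  proof -
    have "u \<notin> center G" using u ZB by auto
    then obtain v where v: "v \<in> carrier G" "u \<otimes> v \<noteq> v \<otimes> u" using u by (auto simp: center_def)
    show ?thesis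
    proof (cases "v \<in> ?B")
      case False
      then show ?thesis using inB2 v u u2 by blast
    next
      case True
      \<comment> \<open>An element v inside B may have order 4; v u is an involution and still fails
        to commute with u.\<close>
      have "v \<otimes> u \<notin> ?B" using cancel[OF True u(1)] u by auto
      then have "(v \<otimes> u) \<otimes> (v \<otimes> u) = \<one>" using inB2 v u by blast
      moreover have "u \<otimes> (v \<otimes> u) \<noteq> (v \<otimes> u) \<otimes> u"
      proof
        assume "u \<otimes> (v \<otimes> u) = (v \<otimes> u) \<otimes> u"
        then have "(u \<otimes> v) \<otimes> u = (v \<otimes> u) \<otimes> u" using u v by (simp add: m_assoc)
        then show False using u v by simp
      qed
      ultimately show ?thesis using u u2 v by blast
    qed
  qed
  ultimately show "p = 2 \<and> (\<forall>z\<in>center G. z \<otimes> z = \<one>) \<and>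
      (\<exists>s\<in>carrier G. \<exists>t\<in>carrier G. s \<otimes> t \<noteq> t \<otimes> s \<and> s \<otimes> s = \<one> \<and> t \<otimes> t = \<one>)"
    using p2 by blast
qed

end

section \<open>Recognising the model groups\<close>

text \<open>Exponents are integer valued so that elements of \<open>elem_abelian\<close> can serve
  as exponent vectors directly.\<close>

primrec (in monoid) central_word :: "(nat \<Rightarrow> 'a) \<Rightarrow> (nat \<Rightarrow> int) \<Rightarrow> nat \<Rightarrow> 'a" where
  "central_word w t 0 = \<one>"
| "central_word w t (Suc i) = central_word w t i \<otimes> w i [^] t i"

context group
begin

lemma center_commute: "z \<in> center G \<Longrightarrow> g \<in> carrier G \<Longrightarrow> z \<otimes> g = g \<otimes> z"
  by (simp add: center_def)

lemma center_m_closed: "a \<in> center G \<Longrightarrow> b \<in> center G \<Longrightarrow> a \<otimes> b \<in> center G"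
  by (rule subgroup.m_closed[OF center_subgroup])

lemma center_int_pow: "a \<in> center G \<Longrightarrow> a [^] (i::int) \<in> center G"
  using center_subgroup by (simp add: subgroup_int_pow_closed)

lemma center_mult_swap:
  assumes "a \<in> center G" "b \<in> center G" "c \<in> center G" "d \<in> center G"
  shows "(a \<otimes> b) \<otimes> (c \<otimes> d) = (a \<otimes> c) \<otimes> (b \<otimes> d)"
proof -
  note c = assms[THEN center_closed]
  have "(a \<otimes> b) \<otimes> (c \<otimes> d) = a \<otimes> (b \<otimes> c) \<otimes> d" using c by (simp add: m_assoc)
  also have "b \<otimes> c = c \<otimes> b" by (rule center_commute[OF assms(2) c(3)])
  finally show ?thesis using c by (simp add: m_assoc)
qed

lemma central_word_zero: "central_word w (\<lambda>_. 0) m = \<one>"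
  by (induction m) auto

lemma central_word_center:
  "(\<And>i. i < m \<Longrightarrow> w i \<in> center G) \<Longrightarrow> central_word w t m \<in> center G"
  by (induction m) (auto intro: center_m_closed center_int_pow simp: subgroup.one_closed[OF center_subgroup])

lemma central_word_add:
  "(\<And>i. i < m \<Longrightarrow> w i \<in> center G) \<Longrightarrow>
    central_word w s m \<otimes> central_word w t m = central_word w (\<lambda>i. s i + t i) m"
proof (induction m)
  case (Suc m)
  have "central_word w s (Suc m) \<otimes> central_word w t (Suc m) =
      (central_word w s m \<otimes> central_word w t m) \<otimes> (w m [^] s m \<otimes> w m [^] t m)"
    using Suc.prems by (simp add: center_mult_swap central_word_center center_int_pow)
  then show ?case using Suc center_closed[of "w m"] by (simp add: int_pow_mult)
qed simp

lemma central_word_cong: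
  assumes "\<And>i. i < m \<Longrightarrow> w i = w' i" "\<And>i. i < m \<Longrightarrow> w i [^] s i = w i [^] t i"
  shows "central_word w s m = central_word w' t m"
  using assms by (induction m) auto

lemma int_pow_mod:
  assumes "x \<in> carrier G" "x [^] (q::nat) = \<one>"
  shows "x [^] (i mod int q) = x [^] i"
proof -
  have "x [^] i = x [^] (int q * (i div int q) + i mod int q)" by (simp only: mult_div_mod_eq)
  also have "\<dots> = (x [^] int q) [^] (i div int q) \<otimes> x [^] (i mod int q)"
    by (simp only: int_pow_pow[OF assms(1)] int_pow_mult[OF assms(1)])
  finally show ?thesis using assms by (simp add: int_pow_int)
qed

lemma subgroup_of_finite_closed:
  assumes fin: "finite (carrier G)" and H: "H \<subseteq> carrier G" "\<one> \<in> H" "\<And>a b. a \<in> H \<Longrightarrow> b \<in> H \<Longrightarrow> a \<otimes> b \<in> H"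
  shows "subgroup H G"
proof (rule subgroupI)
  fix a assume a: "a \<in> H"
  have pw: "a [^] (i::nat) \<in> H" for i by (induction i) (use a H in auto)
  have "order G > 0" using fin by (simp add: order_gt_0_iff_finite)
  then have "a [^] (order G - 1) \<otimes> a = a [^] order G"
    using nat_pow_Suc[of a "order G - 1"] by simp
  then have "inv a = a [^] (order G - 1)" using inv_equality[of "a [^] (order G - 1)" a] pow_order_eq_1 a H by auto
  then show "inv a \<in> H" using pw by simp
qed (use H in auto)

end

text \<open>Maps are built from the model to G, so that calculations take place in G. Closure of H
  suffices to invert them, and the group laws of the models are never verified.\<close>

lemma is_iso_of_bij_hom:
  assumes H: "\<And>a b. a \<in> carrier H \<Longrightarrow> b \<in> carrier H \<Longrightarrow> a \<otimes>\<^bsub>H\<^esub> b \<in> carrier H"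
    and f: "f \<in> hom H G" "bij_betw f (carrier H) (carrier G)"
  shows "G \<cong> H"
proof -
  let ?g = "inv_into (carrier H) f"
  have g: "?g x \<in> carrier H" "f (?g x) = x" if "x \<in> carrier G" for x
    using that f(2) by (auto simp: bij_betw_def inv_into_into f_inv_into_f)
  have "?g \<in> hom G H"
  proof (rule homI)
    fix x y assume xy: "x \<in> carrier G" "y \<in> carrier G"
    have "x \<otimes>\<^bsub>G\<^esub> y = f (?g x \<otimes>\<^bsub>H\<^esub> ?g y)" using g xy f(1) by (simp add: hom_mult)
    then show "?g (x \<otimes>\<^bsub>G\<^esub> y) = ?g x \<otimes>\<^bsub>H\<^esub> ?g y"
      using f(2) g xy H by (simp add: bij_betw_def inv_into_f_f)
  qed (use g in auto)
  moreover have "bij_betw ?g (carrier G) (carrier H)" by (rule bij_betw_inv_into[OF f(2)])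
  ultimately show ?thesis by (auto simp: is_iso_def iso_def)
qed

context p_group
begin

text \<open>Greedy choice starting from z: a new element outside the span multiplies its order by at
  least p, so m further elements reach p^(m+1). Only spanning is asserted; independence will come
  from comparing orders once an isomorphism is built.\<close>

lemma ex_central_basis:
  assumes z: "z \<in> center G" "z \<noteq> \<one>" and card: "card (center G) = p ^ Suc m"
  obtains w where "\<And>i. i < m \<Longrightarrow> w i \<in> center G"
    "\<And>a. a \<in> center G \<Longrightarrow> \<exists>c t. a = z [^] (c::int) \<otimes> central_word w t m"
proof -
  define S where "S w j = {z [^] (c::int) \<otimes> central_word w t j | c t. True}" for w j
  have fz: "finite (center G)" by (rule finite_subset[OF subgroup.subset[OF center_subgroup] fin])
  have sub: "subgroup (S w j) G" "S w j \<subseteq> center G" if w: "\<And>i. i < j \<Longrightarrow> w i \<in> center G" for w j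
  proof -
    show c: "S w j \<subseteq> center G"
      using w z by (auto simp: S_def intro!: center_m_closed center_int_pow central_word_center)
    show "subgroup (S w j) G"
    proof (rule subgroup_of_finite_closed[OF fin])
      show "S w j \<subseteq> carrier G" using c subgroup.subset[OF center_subgroup] by blast
      have "\<one> = z [^] (0::int) \<otimes> central_word w (\<lambda>_. 0) j" by (simp add: central_word_zero)
      then show "\<one> \<in> S w j" unfolding S_def by blast
      fix a b assume "a \<in> S w j" "b \<in> S w j"
      then obtain c t d s where ab: "a = z [^] (c::int) \<otimes> central_word w t j" "b = z [^] (d::int) \<otimes> central_word w s j"
        by (auto simp: S_def)
      have "a \<otimes> b = (z [^] c \<otimes> z [^] d) \<otimes> (central_word w t j \<otimes> central_word w s j)"
        unfolding ab using w z by (intro center_mult_swap center_int_pow central_word_center) auto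
      also have "\<dots> = z [^] (c + d) \<otimes> central_word w (\<lambda>i. t i + s i) j"
        using w center_closed[OF z(1)] by (simp add: int_pow_mult central_word_add)
      finally show "a \<otimes> b \<in> S w j" unfolding S_def by blast
    qed
  qed
  have "\<exists>w. (\<forall>i<j. w i \<in> center G) \<and> p ^ Suc j \<le> card (S w j)" if "j \<le> m" for j
    using that
  proof (induction j)
    case 0
    have zc: "z \<in> S w 0" for w
    proof -
      have "z = z [^] (1::int) \<otimes> central_word w (\<lambda>_. 0) 0" using center_closed[OF z(1)] by simp
      then show ?thesis unfolding S_def by blast
    qed
    have "p * card {\<one>} \<le> card (S (\<lambda>_. \<one>) 0)"
    proof (rule card_psubset[OF triv_subgroup sub(1)])
      show "{\<one>} \<subset> S (\<lambda>_. \<one>) 0" using zc z(2) subgroup.one_closed[OF sub(1)[of 0 "\<lambda>_. \<one>"]] by auto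
    qed simp
    then show ?case by (intro exI[of _ "\<lambda>_. \<one>"]) simp
  next
    case (Suc j)
    then obtain w where w: "\<And>i. i < j \<Longrightarrow> w i \<in> center G" "p ^ Suc j \<le> card (S w j)" by auto
    show ?case
    proof (cases "\<exists>v\<in>center G. v \<notin> S w j")
      case True
      then obtain v where v: "v \<in> center G" "v \<notin> S w j" by blast
      define w' where "w' = w(j := v)"
      have w': "w' i \<in> center G" if "i < Suc j" for i using w(1) v that by (simp add: w'_def)
      have eq: "central_word w' t j = central_word w t j" for t by (rule central_word_cong) (auto simp: w'_def)
      have "S w j \<subset> S w' (Suc j)"
      proof
        show "S w j \<subseteq> S w' (Suc j)"
        proof
          fix a assume "a \<in> S w j"
          then obtain c t where a: "a = z [^] (c::int) \<otimes> central_word w t j" by (auto simp: S_def)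
          have "central_word w t j = central_word w' (t(j := 0)) (Suc j)"
            using central_word_cong[of j w w' t "t(j := 0)"] center_closed[OF central_word_center[of j w t]] w(1)
              central_word_center[of j w' "t(j := 0)"] w' center_closed
            by (simp add: w'_def)
          then have "a = z [^] c \<otimes> central_word w' (t(j := 0)) (Suc j)" by (simp only: a)
          then show "a \<in> S w' (Suc j)" unfolding S_def by blast
        qed
        have "v = z [^] (0::int) \<otimes> central_word w' ((\<lambda>_. 0)(j := 1)) (Suc j)"
        proof -
          have "central_word w' ((\<lambda>_. 0)(j := 1)) i = \<one>" if "i \<le> j" for i using that by (induction i) auto
          then show ?thesis using center_closed[OF v(1)] by (simp add: w'_def)
        qed
        then have "v \<in> S w' (Suc j)" unfolding S_def by blast
        then show "S w j \<noteq> S w' (Suc j)" using v by blast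
      qed
      then have "p * card (S w j) \<le> card (S w' (Suc j))" by (intro card_psubset sub w(1) w')
      then have "p ^ Suc (Suc j) \<le> card (S w' (Suc j))" using w(2) by (metis le_trans mult_le_mono2 power_Suc)
      then show ?thesis using w' by blast
    next
      case False
      \<comment> \<open>The span already is the whole centre, and the identity fills the remaining
        slot.\<close>
      define w' where "w' = w(j := \<one>)"
      have w': "w' i \<in> center G" if "i < Suc j" for i
        using w(1) subgroup.one_closed[OF center_subgroup] that by (simp add: w'_def)
      have "center G \<subseteq> S w' (Suc j)"
      proof
        fix a assume "a \<in> center G"
        then have "a \<in> S w j" using False by blast
        then obtain c t where a: "a = z [^] (c::int) \<otimes> central_word w t j" by (auto simp: S_def)
        have eq: "central_word w t j = central_word w' t j" by (rule central_word_cong) (auto simp: w'_def)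
        have "central_word w' t j \<in> center G" by (rule central_word_center) (use w' in auto)
        then have "central_word w' t (Suc j) = central_word w t j"
          using center_closed eq by (simp add: w'_def)
        then have "a = z [^] c \<otimes> central_word w' t (Suc j)" by (simp only: a)
        then show "a \<in> S w' (Suc j)" unfolding S_def by blast
      qed
      then have "p ^ Suc m \<le> card (S w' (Suc j))"
        unfolding card[symmetric] by (intro card_mono finite_subset[OF sub(2)[OF w'] fz])
      moreover have "p ^ Suc (Suc j) \<le> p ^ Suc m" using Suc.prems p_pos by (intro power_increasing) auto
      ultimately show ?thesis using w' by (meson le_trans)
    qed
  qed
  then obtain w where w: "\<And>i. i < m \<Longrightarrow> w i \<in> center G" "p ^ Suc m \<le> card (S w m)" by blast
  have "S w m = center G" by (rule card_seteq[OF fz sub(2)]) (use w(1) w(2)[folded card] in auto)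
  then show ?thesis using that[of w] w(1) unfolding S_def by blast
qed

text \<open>In the chain Z(G) < H \<inter> C(x) < H both inclusions are proper, as witnessed by x
  and by y, so each multiplies the order by at least p.\<close>

lemma center_and_noncommuting_generate:
  assumes H: "subgroup H G" "center G \<subseteq> H" "order G \<le> p\<^sup>2 * card (center G)"
    and x: "x \<in> H" "y \<in> H" "x \<otimes> y \<noteq> y \<otimes> x"
  shows "H = carrier G"
proof -
  have xc: "x \<in> carrier G" "y \<in> carrier G" using x subgroup.mem_carrier[OF H(1)] by auto
  let ?J = "H \<inter> centralizer G x"
  have J: "subgroup ?J G" by (rule subgroups_Inter_pair[OF H(1) centralizer_subgroup[OF xc(1)]])
  have "x \<notin> center G" using x(3) xc by (metis center_commute)
  then have "center G \<subset> ?J" using H(2) x xc by (auto simp: center_def centralizer_def)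
  then have 1: "p * card (center G) \<le> card ?J" by (rule card_psubset[OF center_subgroup J])
  have "y \<notin> centralizer G x" using x(3) by (auto simp: centralizer_def)
  then have "?J \<subset> H" using x by auto
  then have "p * card ?J \<le> card H" by (rule card_psubset[OF J H(1)])
  then have "p * (p * card (center G)) \<le> card H" using 1 by (meson le_trans mult_le_mono2)
  then have "card (carrier G) \<le> card H" using H(3) by (simp add: order_def power2_eq_square mult.assoc)
  then show ?thesis by (intro card_seteq[OF fin subgroup.subset[OF H(1)]])
qed

text \<open>Equal orders turn surjectivity into injectivity, so it is enough to verify the relations
  of the model in G and to hit the centre and one noncommuting pair.\<close>

lemma is_iso_of_hom_onto_generators:
  assumes H: "finite (carrier H)" "card (carrier H) = order G"
      "\<And>a b. a \<in> carrier H \<Longrightarrow> b \<in> carrier H \<Longrightarrow> a \<otimes>\<^bsub>H\<^esub> b \<in> carrier H"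
    and f: "f \<in> hom H G" and center: "center G \<subseteq> f ` carrier H" "order G \<le> p\<^sup>2 * card (center G)"
    and x: "x \<in> f ` carrier H" "y \<in> f ` carrier H" "x \<otimes> y \<noteq> y \<otimes> x"
  shows "G \<cong> H"
proof -
  have "subgroup (f ` carrier H) G"
  proof (rule subgroup_of_finite_closed[OF fin])
    show "f ` carrier H \<subseteq> carrier G" using f by (auto simp: hom_def)
    show "\<one> \<in> f ` carrier H" using center subgroup.one_closed[OF center_subgroup] by blast
    fix a b assume "a \<in> f ` carrier H" "b \<in> f ` carrier H"
    then obtain a' b' where "a = f a'" "b = f b'" "a' \<in> carrier H" "b' \<in> carrier H" by auto
    then show "a \<otimes> b \<in> f ` carrier H" using H(3)[of a' b'] f by (auto simp: hom_mult[symmetric])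
  qed
  then have im: "f ` carrier H = carrier G"
    by (rule center_and_noncommuting_generate[OF _ center x])
  then have "inj_on f (carrier H)" using H by (intro eq_card_imp_inj_on) (simp_all add: order_def)
  then show ?thesis using im by (intro is_iso_of_bij_hom[OF H(3) f]) (simp_all add: bij_betw_def)
qed

text \<open>Nonnegative exponents are enough, since elements of the models have coordinates in
  \<open>{0..<int p}\<close>.\<close>

lemma int_pow_pow_central:
  assumes x: "x \<in> carrier G" "y \<in> carrier G" and z: "z \<in> center G" and c: "x \<otimes> y = y \<otimes> x \<otimes> z"
    and "0 \<le> i" "0 \<le> j"
  shows "x [^] (i::int) \<otimes> y [^] (j::int) = y [^] j \<otimes> x [^] i \<otimes> z [^] (i * j)"
proof -
  obtain a b :: nat where "i = int a" "j = int b" using assms by (metis nonneg_int_cases)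
  then show ?thesis using pow_pow_central[OF x z c, of a b] by (simp add: int_pow_int flip: of_nat_mult)
qed

end

section \<open>Isomorphisms with the model groups\<close>

lemma elem_abelian_carrier: "0 < p \<Longrightarrow> carrier (elem_abelian p m) = ({..<m} \<rightarrow>\<^sub>E {0..<int p})"
  by (auto simp: elem_abelian_def carrier_integer_mod_group)

lemma elem_abelian_mult: "s \<otimes>\<^bsub>elem_abelian p m\<^esub> t = (\<lambda>i\<in>{..<m}. (s i + t i) mod int p)"
  by (simp add: elem_abelian_def)

lemma elem_abelian_m_closed:
  "0 < p \<Longrightarrow> s \<otimes>\<^bsub>elem_abelian p m\<^esub> t \<in> {..<m} \<rightarrow>\<^sub>E {0..<int p}"
  unfolding elem_abelian_mult by (intro restrict_PiE_iff[THEN iffD2] ballI) simp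

context p_group
begin

lemma central_word_mult:
  assumes "\<And>i. i < m \<Longrightarrow> w i \<in> center G" "\<And>i. i < m \<Longrightarrow> w i [^] p = \<one>"
  shows "central_word w (s \<otimes>\<^bsub>elem_abelian p m\<^esub> t) m = central_word w s m \<otimes> central_word w t m"
proof -
  have "central_word w s m \<otimes> central_word w t m = central_word w (\<lambda>i. s i + t i) m"
    by (rule central_word_add[OF assms(1)])
  also have "\<dots> = central_word w (s \<otimes>\<^bsub>elem_abelian p m\<^esub> t) m"
    unfolding elem_abelian_mult by (rule central_word_cong) (use assms int_pow_mod center_closed in auto)
  finally show ?thesis by simp
qed

lemma central_word_mod:
  assumes "\<And>i. i < m \<Longrightarrow> w i \<in> center G" "\<And>i. i < m \<Longrightarrow> w i [^] p = \<one>"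
  shows "central_word w (\<lambda>i\<in>{..<m}. t i mod int p) m = central_word w t m"
  by (rule central_word_cong) (use assms int_pow_mod center_closed in auto)

text \<open>x, y and z = [x,y] satisfy the relations of the Heisenberg group by the exponent
  hypothesis. Extending z to a generating family of the centre supplies the elementary abelian
  factor.\<close>

theorem exponent_p_imp_heisenberg:
  assumes exponent: "\<And>g. g \<in> carrier G \<Longrightarrow> g [^] p = \<one>" and n: "n = m + 3"
    and Z: "card (center G) = p ^ Suc m"
    and x: "x \<in> carrier G" "y \<in> carrier G" and z: "commutator G x y \<in> center G" "x \<otimes> y \<noteq> y \<otimes> x"
  shows "G \<cong> heisenberg_mod p \<times>\<times> elem_abelian p m"
proof -
  define z where "z = commutator G x y"
  have zZ: "z \<in> center G" "z \<noteq> \<one>" using z commutator_one_iff[OF x] by (simp_all add: z_def)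
  have zc: "z \<in> carrier G" by (rule center_closed[OF zZ(1)])
  have xy: "x \<otimes> y = y \<otimes> x \<otimes> z" unfolding z_def by (rule commutator_swap_mult[OF x z(1)])
  obtain w where w: "\<And>i. i < m \<Longrightarrow> w i \<in> center G"
    and basis: "\<And>a. a \<in> center G \<Longrightarrow> \<exists>c t. a = z [^] (c::int) \<otimes> central_word w t m"
    using ex_central_basis[OF zZ Z] by blast
  have wp: "w i [^] p = \<one>" if "i < m" for i using exponent center_closed[OF w[OF that]] by simp
  let ?H = "heisenberg_mod p \<times>\<times> elem_abelian p m"
  have carr: "carrier ?H = ({0..<int p} \<times> {0..<int p} \<times> {0..<int p}) \<times> ({..<m} \<rightarrow>\<^sub>E {0..<int p})"
    using p_pos by (simp add: DirProd_def heisenberg_mod_def elem_abelian_carrier)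
  have mult: "((a, b, c), s) \<otimes>\<^bsub>?H\<^esub> ((a', b', c'), t) =
      (((a + a') mod int p, (b + b') mod int p, (c + c' + a * b') mod int p), s \<otimes>\<^bsub>elem_abelian p m\<^esub> t)"
    for a b c a' b' c' s t
    by (simp add: DirProd_def heisenberg_mod_def)
  \<comment> \<open>Writing y before x is dictated by the model: moving \<open>x [^] a\<close> past
    \<open>y [^] b'\<close> produces \<open>z [^] (a * b')\<close>, the mixed term of
    \<open>heisenberg_mod\<close>.\<close>
  define f where "f = (\<lambda>((a::int, b::int, c::int), t). y [^] b \<otimes> x [^] a \<otimes> (z [^] c \<otimes> central_word w t m))"
  have wZ: "central_word w t m \<in> center G" for t by (rule central_word_center[OF w])
  have zw: "z [^] (c::int) \<otimes> central_word w t m \<in> center G" for c t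
    by (intro center_m_closed center_int_pow zZ wZ)
  have closed: "a \<otimes>\<^bsub>?H\<^esub> b \<in> carrier ?H" if "a \<in> carrier ?H" "b \<in> carrier ?H" for a b
  proof -
    obtain a1 a2 a3 a4 where "a = ((a1, a2, a3), a4)" by (cases a, cases "fst a") auto
    moreover obtain b1 b2 b3 b4 where "b = ((b1, b2, b3), b4)" by (cases b, cases "fst b") auto
    ultimately show ?thesis unfolding carr using p_pos elem_abelian_m_closed[OF p_pos, of m a4 b4] by (simp add: heisenberg_mod_def)
  qed
  \<comment> \<open>f makes sense for all integer coordinates and reduction does not change its
    value, so membership in the image can be shown with unreduced exponents.\<close>
  have f_mod: "f ((a mod int p, b mod int p, c mod int p), \<lambda>i\<in>{..<m}. t i mod int p) = f ((a, b, c), t)" for a b c t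
    using x zc by (simp add: f_def int_pow_mod exponent central_word_mod[OF w wp])
  have in_image: "f ((a, b, c), t) \<in> f ` carrier ?H" for a b c t
    unfolding f_mod[symmetric, of a b c t] proof (rule imageI)
    show "((a mod int p, b mod int p, c mod int p), \<lambda>i\<in>{..<m}. t i mod int p) \<in> carrier ?H"
      unfolding carr using p_pos by (simp add: restrict_PiE_iff)
  qed
  show ?thesis
  proof (rule is_iso_of_hom_onto_generators[OF _ _ closed])
    show "finite (carrier ?H)" unfolding carr by (intro finite_cartesian_product finite_PiE) auto
    show "card (carrier ?H) = order G"
      unfolding carr order n by (simp add: card_cartesian_product card_PiE power_add eval_nat_numeral mult_ac)
    show "f \<in> hom ?H G"
    proof (rule homI)
      fix u assume "u \<in> carrier ?H"
      then show "f u \<in> carrier G" using x center_closed[OF zw] by (auto simp: f_def carr)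
    next
      fix u v assume u: "u \<in> carrier ?H" and v: "v \<in> carrier ?H"
      obtain a b c s where "u = ((a, b, c), s)" by (cases u, cases "fst u") auto
      moreover obtain a' b' c' t where "v = ((a', b', c'), t)" by (cases v, cases "fst v") auto
      ultimately have uv: "u = ((a, b, c), s)" "v = ((a', b', c'), t)" .
      have nn: "0 \<le> a" "0 \<le> b'" using u v unfolding uv carr by auto
      let ?s = "central_word w s m" and ?t = "central_word w t m"
      let ?cs = "z [^] c \<otimes> ?s" and ?ct = "z [^] c' \<otimes> ?t"
      have pw: "x [^] a \<in> carrier G" "y [^] b \<in> carrier G" "x [^] a' \<in> carrier G" "y [^] b' \<in> carrier G"
        using x by auto
      have cc: "?cs \<in> carrier G" "?ct \<in> carrier G" by (rule center_closed[OF zw])+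
      have zab: "z [^] (a * b') \<in> center G" by (rule center_int_pow[OF zZ(1)])
      note zabc = center_closed[OF zab]
      have "f u \<otimes> f v = y [^] b \<otimes> x [^] a \<otimes> (?cs \<otimes> (y [^] b' \<otimes> x [^] a')) \<otimes> ?ct"
        using pw cc by (simp add: uv f_def m_assoc)
      also have "?cs \<otimes> (y [^] b' \<otimes> x [^] a') = (y [^] b' \<otimes> x [^] a') \<otimes> ?cs"
        by (rule center_commute[OF zw]) (use pw in simp)
      also have "y [^] b \<otimes> x [^] a \<otimes> ((y [^] b' \<otimes> x [^] a') \<otimes> ?cs) \<otimes> ?ct
          = y [^] b \<otimes> (x [^] a \<otimes> y [^] b') \<otimes> x [^] a' \<otimes> (?cs \<otimes> ?ct)"
        using pw cc by (simp add: m_assoc)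
      also have "x [^] a \<otimes> y [^] b' = y [^] b' \<otimes> x [^] a \<otimes> z [^] (a * b')"
        by (rule int_pow_pow_central[OF x zZ(1) xy nn])
      also have "y [^] b \<otimes> (y [^] b' \<otimes> x [^] a \<otimes> z [^] (a * b')) \<otimes> x [^] a' \<otimes> (?cs \<otimes> ?ct)
          = y [^] b \<otimes> y [^] b' \<otimes> x [^] a \<otimes> (z [^] (a * b') \<otimes> x [^] a') \<otimes> (?cs \<otimes> ?ct)"
        using pw cc zabc by (simp add: m_assoc)
      also have "z [^] (a * b') \<otimes> x [^] a' = x [^] a' \<otimes> z [^] (a * b')"
        by (rule center_commute[OF zab pw(3)])
      also have "y [^] b \<otimes> y [^] b' \<otimes> x [^] a \<otimes> (x [^] a' \<otimes> z [^] (a * b')) \<otimes> (?cs \<otimes> ?ct)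
          = (y [^] b \<otimes> y [^] b') \<otimes> (x [^] a \<otimes> x [^] a') \<otimes> (z [^] (a * b') \<otimes> (?cs \<otimes> ?ct))"
        using pw cc zabc by (simp add: m_assoc)
      also have "?cs \<otimes> ?ct = (z [^] c \<otimes> z [^] c') \<otimes> (?s \<otimes> ?t)"
        by (intro center_mult_swap center_int_pow zZ wZ)
      also have "z [^] (a * b') \<otimes> ((z [^] c \<otimes> z [^] c') \<otimes> (?s \<otimes> ?t)) = z [^] (c + c' + a * b') \<otimes> (?s \<otimes> ?t)"
        using zc center_closed[OF wZ] by (simp add: m_assoc[symmetric] int_pow_mult[symmetric] add_ac)
      finally have "f u \<otimes> f v = y [^] (b + b') \<otimes> x [^] (a + a') \<otimes> (z [^] (c + c' + a * b') \<otimes> (?s \<otimes> ?t))"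
        using x by (simp add: int_pow_mult)
      moreover have "central_word w (s \<otimes>\<^bsub>elem_abelian p m\<^esub> t) m = ?s \<otimes> ?t"
        by (rule central_word_mult) (use w wp in auto)
      ultimately show "f (u \<otimes>\<^bsub>?H\<^esub> v) = f u \<otimes> f v"
        unfolding uv mult using x zc by (simp add: f_def int_pow_mod exponent)
    qed
    show "center G \<subseteq> f ` carrier ?H"
    proof
      fix a assume "a \<in> center G"
      then obtain c t where "a = z [^] (c::int) \<otimes> central_word w t m" using basis by blast
      then have "a = f ((0, 0, c), t)" using center_closed[OF zw] by (simp add: f_def)
      then show "a \<in> f ` carrier ?H" using in_image by simp
    qed
    show "order G \<le> p\<^sup>2 * card (center G)" unfolding order Z n by (simp add: eval_nat_numeral power_add)
    have "x = f ((1, 0, 0), \<lambda>_. 0)" "y = f ((0, 1, 0), \<lambda>_. 0)" using x by (simp_all add: f_def central_word_zero)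
    then show "x \<in> f ` carrier ?H" "y \<in> f ` carrier ?H" using in_image by metis+
    show "x \<otimes> y \<noteq> y \<otimes> x" by fact
  qed
qed

text \<open>Two involutions generate a dihedral group with rotation d = s t, inverted by t. Here d^2
  = [s,t] is a nontrivial central involution, so d has order 4.\<close>

theorem involutions_imp_dihedral:
  assumes p2: "p = 2" and n: "n = m + 3" and Z: "card (center G) = p ^ Suc m"
    and inv_Z: "\<And>z. z \<in> center G \<Longrightarrow> z \<otimes> z = \<one>"
    and s: "s \<in> carrier G" "s \<otimes> s = \<one>" and t: "t \<in> carrier G" "t \<otimes> t = \<one>"
    and z: "commutator G s t \<in> center G" "s \<otimes> t \<noteq> t \<otimes> s"
  shows "G \<cong> dihedral8 \<times>\<times> elem_abelian 2 m"
proof -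
  have inv_s: "inv s = s" and inv_t: "inv t = t" using inv_equality s t by auto
  define d where "d = s \<otimes> t"
  define z where "z = d \<otimes> d"
  have d: "d \<in> carrier G" using s t by (simp add: d_def)
  have z_eq: "z = commutator G s t" using s t by (simp add: z_def d_def inv_s inv_t m_assoc)
  have zZ: "z \<in> center G" "z \<noteq> \<one>" using z commutator_one_iff[OF s(1) t(1)] by (simp_all add: z_eq)
  have d4: "d [^] (4::nat) = \<one>"
  proof -
    have "d [^] (4::nat) = z \<otimes> z" using d by (simp add: eval_nat_numeral z_def m_assoc)
    then show ?thesis using inv_Z[OF zZ(1)] by simp
  qed
  have inv_d: "inv d = t \<otimes> s" using s t by (simp add: d_def inv_mult_group inv_s inv_t)
  have td: "t \<otimes> d = inv d \<otimes> t" unfolding inv_d using s t by (simp add: d_def m_assoc)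
  have t_pow: "t \<otimes> d [^] (i::int) = d [^] (- i) \<otimes> t" for i
  proof -
    have "t \<otimes> d \<otimes> inv t = inv d" unfolding td using t d by (simp add: m_assoc)
    have conj: "t \<otimes> d [^] (j::nat) = (inv d) [^] j \<otimes> t" for j
    proof (induction j)
      case (Suc j)
      have "t \<otimes> d [^] Suc j = (t \<otimes> d [^] j) \<otimes> d" using t d by (simp add: m_assoc)
      also have "\<dots> = (inv d) [^] j \<otimes> (t \<otimes> d)" unfolding Suc using t d by (simp add: m_assoc)
      also have "\<dots> = (inv d) [^] Suc j \<otimes> t" unfolding td using t d by (simp add: m_assoc)
      finally show ?case .
    qed (use t in simp)
    \<comment> \<open>Since d has order 4, a negative exponent is traded for a natural number, to
      which \<open>conj\<close> applies.\<close>
    have "d [^] i = d [^] (i mod 4)" using int_pow_mod[OF d d4, of i] by simp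
    moreover obtain j where j: "i mod 4 = int j" by (metis nonneg_int_cases pos_mod_sign zero_less_numeral)
    moreover have "d [^] (- i) = d [^] (- (i mod 4))"
      using int_pow_mod[OF d d4, of "- i"] int_pow_mod[OF d d4, of "- (i mod 4)"] by (simp add: mod_minus_eq)
    ultimately show ?thesis using conj[of j] d by (simp add: int_pow_int int_pow_neg nat_pow_inv)
  qed
  obtain w where w: "\<And>i. i < m \<Longrightarrow> w i \<in> center G"
    and basis: "\<And>a. a \<in> center G \<Longrightarrow> \<exists>c t. a = z [^] (c::int) \<otimes> central_word w t m"
    using ex_central_basis[OF zZ Z] by blast
  have wp: "w i [^] p = \<one>" if "i < m" for i
    using inv_Z[OF w[OF that]] center_closed[OF w[OF that]] by (simp add: p2 numeral_2_eq_2)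
  let ?H = "dihedral8 \<times>\<times> elem_abelian 2 m"
  have carr: "carrier ?H = ({0..<4} \<times> {0..<2}) \<times> ({..<m} \<rightarrow>\<^sub>E {0..<2})"
    by (simp add: DirProd_def dihedral8_def elem_abelian_carrier)
  have mult: "((a, b), u) \<otimes>\<^bsub>?H\<^esub> ((a', b'), v) =
      (((a + (if b = 0 then a' else - a')) mod 4, (b + b') mod 2), u \<otimes>\<^bsub>elem_abelian 2 m\<^esub> v)"
    for a b a' b' u v
    by (simp add: DirProd_def dihedral8_def)
  define f where "f = (\<lambda>((a::int, b::int), u). d [^] a \<otimes> t [^] b \<otimes> central_word w u m)"
  have t2: "t [^] (2::nat) = \<one>" using t by (simp add: numeral_2_eq_2)
  have wZ: "central_word w u m \<in> center G" for u by (rule central_word_center[OF w])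
  note wc = center_closed[OF wZ]
  have closed: "a \<otimes>\<^bsub>?H\<^esub> b \<in> carrier ?H" if "a \<in> carrier ?H" "b \<in> carrier ?H" for a b
  proof -
    obtain a1 a2 a3 where "a = ((a1, a2), a3)" by (cases a, cases "fst a") auto
    moreover obtain b1 b2 b3 where "b = ((b1, b2), b3)" by (cases b, cases "fst b") auto
    ultimately show ?thesis unfolding carr using elem_abelian_m_closed[of 2 m a3 b3] by (simp add: dihedral8_def)
  qed
  have f_mod: "f ((a mod 4, b mod 2), \<lambda>i\<in>{..<m}. u i mod 2) = f ((a, b), u)" for a b u
  proof -
    have "central_word w (\<lambda>i\<in>{..<m}. u i mod 2) m = central_word w u m"
      using central_word_mod[OF w wp] p2 by simp
    then show ?thesis
      using int_pow_mod[OF d d4, of a] int_pow_mod[OF t(1) t2, of b] by (simp add: f_def)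
  qed
  have in_image: "f ((a, b), u) \<in> f ` carrier ?H" for a b u
    unfolding f_mod[symmetric, of a b u] proof (rule imageI)
    show "((a mod 4, b mod 2), \<lambda>i\<in>{..<m}. u i mod 2) \<in> carrier ?H"
      unfolding carr by (simp add: restrict_PiE_iff)
  qed
  show ?thesis
  proof (rule is_iso_of_hom_onto_generators[OF _ _ closed])
    show "finite (carrier ?H)" unfolding carr by (intro finite_cartesian_product finite_PiE) auto
    show "card (carrier ?H) = order G"
      unfolding carr order n p2 by (simp add: card_cartesian_product card_PiE power_add eval_nat_numeral mult_ac)
    show "f \<in> hom ?H G"
    proof (rule homI)
      fix u assume "u \<in> carrier ?H"
      then show "f u \<in> carrier G" using d t wc by (auto simp: f_def carr)
    next
      fix u v assume u: "u \<in> carrier ?H" and v: "v \<in> carrier ?H"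
      obtain a b g where "u = ((a, b), g)" by (cases u, cases "fst u") auto
      moreover obtain a' b' h where "v = ((a', b'), h)" by (cases v, cases "fst v") auto
      ultimately have uv: "u = ((a, b), g)" "v = ((a', b'), h)" .
      have "b \<in> {0..<2}" using u unfolding uv carr by blast
      then have b: "b = 0 \<or> b = 1" by auto
      let ?g = "central_word w g m" and ?h = "central_word w h m"
      let ?a = "if b = 0 then a' else - a'"
      have pw: "d [^] i \<in> carrier G" "t [^] i \<in> carrier G" for i :: int using d t by auto
      have "f u \<otimes> f v = d [^] a \<otimes> t [^] b \<otimes> (?g \<otimes> (d [^] a' \<otimes> t [^] b')) \<otimes> ?h"
        using pw wc by (simp add: uv f_def m_assoc)
      also have "?g \<otimes> (d [^] a' \<otimes> t [^] b') = (d [^] a' \<otimes> t [^] b') \<otimes> ?g"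
        by (rule center_commute[OF wZ]) (use pw in simp)
      also have "d [^] a \<otimes> t [^] b \<otimes> ((d [^] a' \<otimes> t [^] b') \<otimes> ?g) \<otimes> ?h
          = d [^] a \<otimes> (t [^] b \<otimes> d [^] a') \<otimes> t [^] b' \<otimes> (?g \<otimes> ?h)"
        using pw wc by (simp add: m_assoc)
      also have "t [^] b \<otimes> d [^] a' = d [^] ?a \<otimes> t [^] b"
        using b t_pow[of a'] pw t by auto
      also have "d [^] a \<otimes> (d [^] ?a \<otimes> t [^] b) \<otimes> t [^] b' \<otimes> (?g \<otimes> ?h)
          = (d [^] a \<otimes> d [^] ?a) \<otimes> (t [^] b \<otimes> t [^] b') \<otimes> (?g \<otimes> ?h)"
        using pw wc by (simp add: m_assoc)
      finally have "f u \<otimes> f v = d [^] (a + ?a) \<otimes> t [^] (b + b') \<otimes> (?g \<otimes> ?h)"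
        using d t by (simp add: int_pow_mult)
      moreover have "f (u \<otimes>\<^bsub>?H\<^esub> v) = d [^] ((a + ?a) mod 4) \<otimes> t [^] ((b + b') mod 2) \<otimes> (?g \<otimes> ?h)"
      proof -
        have "central_word w (g \<otimes>\<^bsub>elem_abelian p m\<^esub> h) m = ?g \<otimes> ?h"
          by (rule central_word_mult) (use w wp in auto)
        then show ?thesis unfolding uv mult by (simp add: f_def p2)
      qed
      moreover have "d [^] ((a + ?a) mod 4) = d [^] (a + ?a)" "t [^] ((b + b') mod 2) = t [^] (b + b')"
        using int_pow_mod[OF d d4, of "a + ?a"] int_pow_mod[OF t(1) t2, of "b + b'"] by simp_all
      ultimately show "f (u \<otimes>\<^bsub>?H\<^esub> v) = f u \<otimes> f v" by simp
    qed
    show "center G \<subseteq> f ` carrier ?H"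
    proof
      fix a assume "a \<in> center G"
      then obtain c u where a: "a = z [^] (c::int) \<otimes> central_word w u m" using basis by blast
      \<comment> \<open>The first central generator is not a separate coordinate: it sits in the
        dihedral factor as the rotation d^2.\<close>
      have "z = d [^] (2::int)" using d int_pow_int[of G d 2] by (simp add: z_def numeral_2_eq_2)
      then have "z [^] c = d [^] (2 * c)" using d by (simp add: int_pow_pow)
      then have "a = f ((2 * c, 0), u)" using a d wc by (simp add: f_def)
      then show "a \<in> f ` carrier ?H" using in_image by simp
    qed
    show "order G \<le> p\<^sup>2 * card (center G)" unfolding order Z n by (simp add: eval_nat_numeral power_add)
    have "d = f ((1, 0), \<lambda>_. 0)" "t = f ((0, 1), \<lambda>_. 0)" using d t by (simp_all add: f_def central_word_zero)
    then show "d \<in> f ` carrier ?H" "t \<in> f ` carrier ?H" using in_image by metis+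
    show "d \<otimes> t \<noteq> t \<otimes> d"
    proof
      assume "d \<otimes> t = t \<otimes> d"
      then have "d \<otimes> t = inv d \<otimes> t" using td by simp
      then have "d = inv d" using d t by simp
      then have "d \<otimes> d = \<one>" using d by (metis r_inv)
      then show False using zZ by (simp add: z_def)
    qed
  qed
qed

end

section \<open>A lower bound\<close>

text \<open>Commuting pairs dual to a family of \<open>\<int>/p\<close>-valued cocycles show that the family is independent
  in the Schur multiplier, since the commutation factor of a commuting pair depends only on the class.\<close>

lemma (in group) card_schur_classes_ge:
  fixes F :: "'i \<Rightarrow> 'a \<Rightarrow> 'a \<Rightarrow> int"
  assumes p: "0 < p" and I: "finite I" and fin: "finite (schur_classes G)"
    and cocycle: "\<And>i x y z. i \<in> I \<Longrightarrow> x \<in> carrier G \<Longrightarrow> y \<in> carrier G \<Longrightarrow> z \<in> carrier G \<Longrightarrow>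
      [F i x y + F i (x \<otimes> y) z = F i y z + F i x (y \<otimes> z)] (mod int p)"
    and ab: "\<And>i. i \<in> I \<Longrightarrow> a i \<in> carrier G" "\<And>i. i \<in> I \<Longrightarrow> b i \<in> carrier G"
      "\<And>i. i \<in> I \<Longrightarrow> a i \<otimes> b i = b i \<otimes> a i"
    and dual: "\<And>i j. i \<in> I \<Longrightarrow> j \<in> I \<Longrightarrow> F j (a i) (b i) - F j (b i) (a i) = (if i = j then 1 else 0)"
  shows "p ^ card I \<le> card (schur_classes G)"
proof -
  define f where "f l = (\<lambda>x y. if x \<in> carrier G \<and> y \<in> carrier G then unit_root p (\<Sum>i\<in>I. l i * F i x y) else 1)" for l
  have f: "f l \<in> schur_cocycles G" for l
  proof (rule cocycleI)
    fix x y z assume xyz: "x \<in> carrier G" "y \<in> carrier G" "z \<in> carrier G"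
    have "[(\<Sum>i\<in>I. l i * (F i x y + F i (x \<otimes> y) z)) = (\<Sum>i\<in>I. l i * (F i y z + F i x (y \<otimes> z)))] (mod int p)"
      by (intro cong_sum cong_mult cong_refl cocycle xyz)
    then have "unit_root p (\<Sum>i\<in>I. l i * (F i x y + F i (x \<otimes> y) z)) = unit_root p (\<Sum>i\<in>I. l i * (F i y z + F i x (y \<otimes> z)))"
      by (simp only: unit_root_eq_iff[OF p])
    then show "f l x y * f l (x \<otimes> y) z = f l y z * f l x (y \<otimes> z)"
      using xyz by (simp add: f_def distrib_left sum.distrib unit_root_add)
  qed (auto simp: f_def unit_root_nonzero)
  let ?L = "I \<rightarrow>\<^sub>E {0..<int p}"
  have "inj_on (\<lambda>l. schur_cohomologous G `` {f l}) ?L"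
  proof (rule inj_onI)
    fix l l' assume l: "l \<in> ?L" "l' \<in> ?L" and "schur_cohomologous G `` {f l} = schur_cohomologous G `` {f l'}"
    then have coh: "(f l, f l') \<in> schur_cohomologous G"
      using eq_equiv_class[OF _ equiv_cohomologous[OF monoid_axioms] f] by blast
    \<comment> \<open>By duality the i-th commuting pair reads off the coefficient of the i-th
      cocycle.\<close>
    have com: "commutation (f l) (a i) (b i) = unit_root p (l i)" if i: "i \<in> I" for l i
    proof -
      have "(\<Sum>j\<in>I. l j * F j (a i) (b i)) - (\<Sum>j\<in>I. l j * F j (b i) (a i))
          = (\<Sum>j\<in>I. l j * (F j (a i) (b i) - F j (b i) (a i)))"
        by (simp add: sum_subtractf right_diff_distrib)
      also have "\<dots> = (\<Sum>j\<in>I. if i = j then l j else 0)"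
        by (intro sum.cong refl) (simp add: dual i)
      also have "\<dots> = l i" using I i by simp
      finally have "(\<Sum>j\<in>I. l j * F j (a i) (b i)) = l i + (\<Sum>j\<in>I. l j * F j (b i) (a i))" by simp
      then show ?thesis using ab i by (simp add: commutation_def f_def unit_root_add unit_root_nonzero)
    qed
    have "l i = l' i" if i: "i \<in> I" for i
    proof -
      have "commutation (f l) (a i) (b i) = commutation (f l') (a i) (b i)"
        by (rule commutation_cohomologous[OF monoid_axioms coh]) (use ab i in auto)
      then have "[l i = l' i] (mod int p)" by (simp add: com[OF i] unit_root_eq_iff[OF p])
      moreover have "0 \<le> l i" "l i < int p" "0 \<le> l' i" "l' i < int p" using l i by (auto simp: PiE_iff)
      ultimately show ?thesis by (simp add: cong_def)
    qed
    then show "l = l'" using l by (intro PiE_ext) auto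
  qed
  moreover have "(\<lambda>l. schur_cohomologous G `` {f l}) ` ?L \<subseteq> schur_classes G"
    using f by (auto intro: quotientI)
  ultimately have "card ?L \<le> card (schur_classes G)" using fin by (rule card_inj_on_le)
  then show ?thesis using I by (simp add: card_PiE)
qed

lemma cong_mod_self: "[a mod m = a] (mod (m::int))"
  by (simp add: cong_def)

text \<open>11 = 2 + 6 + 3: two classes from M(E_1), six from pairing the two generators of E_1/E_1'
  with the three of Z_p^3, and three from M(Z_p^3). Each is given by an explicit cocycle with values
  modulo p.\<close>

theorem heisenberg_schur_classes_ge:
  assumes G: "group G" and p: "odd p" "1 < p" and iso: "G \<cong> heisenberg_mod p \<times>\<times> elem_abelian p 3"
    and fin: "finite (schur_classes G)"
  shows "p ^ 11 \<le> card (schur_classes G)"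
proof -
  interpret group G by fact
  let ?H = "heisenberg_mod p \<times>\<times> elem_abelian p 3"
  obtain \<theta> where \<theta>: "\<theta> \<in> hom G ?H" "bij_betw \<theta> (carrier G) (carrier ?H)"
    using iso by (auto simp: is_iso_def iso_def)
  have carr: "carrier ?H = ({0..<int p} \<times> {0..<int p} \<times> {0..<int p}) \<times> ({..<3} \<rightarrow>\<^sub>E {0..<int p})"
    using p by (simp add: DirProd_def heisenberg_mod_def elem_abelian_carrier)
  define A B C :: "(int \<times> int \<times> int) \<times> (nat \<Rightarrow> int) \<Rightarrow> int"
    where "A = (\<lambda>h. fst (fst h))" and "B = (\<lambda>h. fst (snd (fst h)))" and "C = (\<lambda>h. snd (snd (fst h)))"
  \<comment> \<open>The five coordinates that are additive modulo p: 0 and 1 from E_1, and 2 to 4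
    from the abelian factor. The remaining coordinate \<open>C\<close> is additive only up to
    \<open>u 0 g * u 1 h\<close>.\<close>
  define u :: "nat \<Rightarrow> (int \<times> int \<times> int) \<times> (nat \<Rightarrow> int) \<Rightarrow> int"
    where "u k h = (if k = 0 then A h else if k = 1 then B h else snd h (k - 2))" for k h
  have AB: "A h = u 0 h" "B h = u 1 h" for h by (simp_all add: u_def)
  have u_mult: "[u k (g \<otimes>\<^bsub>?H\<^esub> h) = u k g + u k h] (mod int p)" if "k < 5" for k g h
    using that by (cases g; cases h)
      (auto simp: u_def A_def B_def DirProd_def heisenberg_mod_def elem_abelian_mult cong_mod_self)
  have C_mult: "[C (g \<otimes>\<^bsub>?H\<^esub> h) = C g + C h + u 0 g * u 1 h] (mod int p)" for g h
    by (cases g; cases h) (auto simp: u_def A_def B_def C_def DirProd_def heisenberg_mod_def cong_mod_self)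
  obtain m where m: "p = 2 * m + 1" using p(1) by (rule oddE)
  define q where "q = int m + 1"
  have q: "2 * q = int p + 1" by (simp add: q_def m)
  (* The indices (0,0) and (1,1) stand for the two central extensions of E_1 to class 3; q = 1/2 mod p
     replaces the binomial coefficient a(a-1)/2 by a polynomial that is well defined mod p. *)
  define F :: "nat \<times> nat \<Rightarrow> (int \<times> int \<times> int) \<times> (nat \<Rightarrow> int) \<Rightarrow> (int \<times> int \<times> int) \<times> (nat \<Rightarrow> int) \<Rightarrow> int"
    where "F i g h =
      (if i = (0, 0) then u 0 g * C h + q * u 0 g * (u 0 g - 1) * u 1 h
       else if i = (1, 1) then C g * u 1 h + q * u 0 g * u 1 h * (u 1 h - 1)
       else u (fst i) g * u (snd i) h)" for i g h
  \<comment> \<open>The pair (0,1) is absent because \<open>u 0 g * u 1 h\<close> is, modulo p, a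
    coboundary of \<open>C\<close>, and the generators 0 and 1 do not commute. This leaves its row
    free for the two special indices.\<close>
  define I where "I = {(0, 0), (1, 1), (0, 2), (0, 3), (0, 4), (1, 2), (1, 3), (1, 4), (2, 3), (2, 4), (3::nat, 4::nat)}"
  have I_cases: "i = (0, 0) \<or> i = (1, 1) \<or> (fst i < snd i \<and> snd i < 5 \<and> 2 \<le> snd i)" if "i \<in> I" for i
    using that by (auto simp: I_def)
  have F_cocycle: "[F i x y + F i (x \<otimes>\<^bsub>?H\<^esub> y) z = F i y z + F i x (y \<otimes>\<^bsub>?H\<^esub> z)] (mod int p)"
    if i: "i \<in> I" for i x y z
  proof -
    note m = u_mult[of _ x y] u_mult[of _ y z] C_mult[of x y] C_mult[of y z]
    note c = cong_add cong_mult cong_diff cong_refl m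
    consider "i = (0, 0)" | "i = (1, 1)" | "fst i < snd i" "snd i < 5" "2 \<le> snd i"
      using I_cases[OF i] by blast
    then show ?thesis
    proof cases
      case 1
      have "[F i x y + F i (x \<otimes>\<^bsub>?H\<^esub> y) z = (u 0 x * C y + q * u 0 x * (u 0 x - 1) * u 1 y) +
          ((u 0 x + u 0 y) * C z + q * (u 0 x + u 0 y) * ((u 0 x + u 0 y) - 1) * u 1 z)] (mod int p)"
        unfolding F_def 1 if_P[OF refl] by (intro c) auto
      \<comment> \<open>The two sides differ by a multiple of 2q - 1 = p. The existence of q is
        where oddness of p enters.\<close>
      also have "(u 0 x * C y + q * u 0 x * (u 0 x - 1) * u 1 y) +
          ((u 0 x + u 0 y) * C z + q * (u 0 x + u 0 y) * ((u 0 x + u 0 y) - 1) * u 1 z)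
        = (u 0 y * C z + q * u 0 y * (u 0 y - 1) * u 1 z) +
          (u 0 x * (C y + C z + u 0 y * u 1 z) + q * u 0 x * (u 0 x - 1) * (u 1 y + u 1 z))
          + (2 * q - 1) * (u 0 x * u 0 y * u 1 z)"
        by (simp add: algebra_simps)
      also have "[\<dots> = (u 0 y * C z + q * u 0 y * (u 0 y - 1) * u 1 z) +
          (u 0 x * (C y + C z + u 0 y * u 1 z) + q * u 0 x * (u 0 x - 1) * (u 1 y + u 1 z))] (mod int p)"
        unfolding q by (simp add: cong_iff_dvd_diff)
      also have "[(u 0 y * C z + q * u 0 y * (u 0 y - 1) * u 1 z) +
          (u 0 x * (C y + C z + u 0 y * u 1 z) + q * u 0 x * (u 0 x - 1) * (u 1 y + u 1 z)) = F i y z + F i x (y \<otimes>\<^bsub>?H\<^esub> z)] (mod int p)"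
        unfolding F_def 1 if_P[OF refl] by (rule cong_sym, intro c) auto
      finally show ?thesis .
    next
      case 2
      have "[F i x y + F i (x \<otimes>\<^bsub>?H\<^esub> y) z = (C x * u 1 y + q * u 0 x * u 1 y * (u 1 y - 1)) +
          ((C x + C y + u 0 x * u 1 y) * u 1 z + q * (u 0 x + u 0 y) * u 1 z * (u 1 z - 1))] (mod int p)"
        unfolding F_def 2 by (simp only: prod.inject one_neq_zero if_False simp_thms if_True, intro c) auto
      also have "(C x * u 1 y + q * u 0 x * u 1 y * (u 1 y - 1)) +
          ((C x + C y + u 0 x * u 1 y) * u 1 z + q * (u 0 x + u 0 y) * u 1 z * (u 1 z - 1))
        = (C y * u 1 z + q * u 0 y * u 1 z * (u 1 z - 1)) +
          (C x * (u 1 y + u 1 z) + q * u 0 x * (u 1 y + u 1 z) * ((u 1 y + u 1 z) - 1))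
          + (2 * q - 1) * (- (u 0 x * u 1 y * u 1 z))"
        by (simp add: algebra_simps)
      also have "[\<dots> = (C y * u 1 z + q * u 0 y * u 1 z * (u 1 z - 1)) +
          (C x * (u 1 y + u 1 z) + q * u 0 x * (u 1 y + u 1 z) * ((u 1 y + u 1 z) - 1))] (mod int p)"
        unfolding q by (simp add: cong_iff_dvd_diff)
      also have "[(C y * u 1 z + q * u 0 y * u 1 z * (u 1 z - 1)) +
          (C x * (u 1 y + u 1 z) + q * u 0 x * (u 1 y + u 1 z) * ((u 1 y + u 1 z) - 1)) = F i y z + F i x (y \<otimes>\<^bsub>?H\<^esub> z)] (mod int p)"
        unfolding F_def 2 by (simp only: prod.inject one_neq_zero if_False simp_thms if_True, rule cong_sym, intro c) auto
      finally show ?thesis .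
    next
      case 3
      then have F: "F i g h = u (fst i) g * u (snd i) h" for g h by (auto simp: F_def)
      have "[F i x y + F i (x \<otimes>\<^bsub>?H\<^esub> y) z =
          u (fst i) x * u (snd i) y + (u (fst i) x + u (fst i) y) * u (snd i) z] (mod int p)"
        unfolding F by (intro c) (use 3 in auto)
      also have "u (fst i) x * u (snd i) y + (u (fst i) x + u (fst i) y) * u (snd i) z
          = u (fst i) y * u (snd i) z + u (fst i) x * (u (snd i) y + u (snd i) z)"
        by (simp add: algebra_simps)
      also have "[\<dots> = F i y z + F i x (y \<otimes>\<^bsub>?H\<^esub> z)] (mod int p)"
        unfolding F by (rule cong_sym, intro c) (use 3 in auto)
      finally show ?thesis .
    qed
  qed
  define E :: "nat \<Rightarrow> (int \<times> int \<times> int) \<times> (nat \<Rightarrow> int)"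
    where "E k = ((if k = 0 then 1 else 0, if k = 1 then 1 else 0, 0), \<lambda>i\<in>{..<3}. if i + 2 = k then 1 else 0)" for k
  define Z :: "(int \<times> int \<times> int) \<times> (nat \<Rightarrow> int)" where "Z = ((0, 0, 1), \<lambda>i\<in>{..<3}. 0)"
  \<comment> \<open>The test pairs commute because one member is always central: \<open>Z\<close>
    for the two special indices, and \<open>E (snd i)\<close> with \<open>snd i\<close> at least 2
    otherwise.\<close>
  define a where "a i = (if i = (1, 1) then Z else E (fst i))" for i :: "nat \<times> nat"
  define b where "b i = (if i = (0, 0) then Z else E (snd i))" for i :: "nat \<times> nat"
  have uE: "u k (E l) = (if k = l then 1 else 0)" if "k < 5" "l < 5" for k l
    using that by (auto simp: u_def E_def A_def B_def)
  have uZ: "u k Z = 0" if "k < 5" for k using that by (auto simp: u_def Z_def A_def B_def)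
  have CE: "C (E l) = 0" "C Z = 1" for l by (simp_all add: C_def E_def Z_def)
  have EH: "E k \<in> carrier ?H" "Z \<in> carrier ?H" for k
    unfolding carr using p by (auto simp: E_def Z_def)
  have comm: "a i \<otimes>\<^bsub>?H\<^esub> b i = b i \<otimes>\<^bsub>?H\<^esub> a i" if "i \<in> I" for i
  proof -
    have E2: "E k \<otimes>\<^bsub>?H\<^esub> E l = E l \<otimes>\<^bsub>?H\<^esub> E k" if "2 \<le> l" for k l
      using that by (simp add: E_def DirProd_def heisenberg_mod_def elem_abelian_mult add.commute)
    have EZ: "E k \<otimes>\<^bsub>?H\<^esub> Z = Z \<otimes>\<^bsub>?H\<^esub> E k" for k
      by (simp add: E_def Z_def DirProd_def heisenberg_mod_def elem_abelian_mult add.commute)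
    show ?thesis using I_cases[OF that] by (auto simp: a_def b_def EZ intro: E2)
  qed
  have dual: "F j (a i) (b i) - F j (b i) (a i) = (if i = j then 1 else 0)" if i: "i \<in> I" and j: "j \<in> I" for i j
  proof -
    have F3: "F j g h = u (fst j) g * u (snd j) h" if "fst j < snd j" "2 \<le> snd j" for g h
      using that by (auto simp: F_def)
    have F1: "F (0, 0) g h = u 0 g * C h + q * u 0 g * (u 0 g - 1) * u 1 h" for g h by (simp add: F_def)
    have F2: "F (1, 1) g h = C g * u 1 h + q * u 0 g * u 1 h * (u 1 h - 1)" for g h by (simp add: F_def)
    have u01: "u 0 (E l) = (if l = 0 then 1 else 0)" "u 1 (E l) = (if l = 1 then 1 else 0)" if "l < 5" for l
      using uE[OF _ that, of 0] uE[OF _ that, of 1] by auto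
    have Z01: "u 0 Z = 0" "u 1 Z = 0" using uZ by auto
    consider (1) "i = (0, 0)" | (2) "i = (1, 1)" | (3) "fst i < snd i" "snd i < 5" "2 \<le> snd i"
      using I_cases[OF i] by blast
    then show ?thesis
    proof cases
      case 1
      have ab: "a (0, 0) = E 0" "b (0, 0) = Z" by (simp_all add: a_def b_def)
      show ?thesis using I_cases[OF j]
        by (elim disjE conjE) (auto simp: ab 1 F1 F2 F3 u01 Z01 uZ CE simp del: One_nat_def)
    next
      case 2
      have ab: "a (1, 1) = Z" "b (1, 1) = E 1" by (simp_all add: a_def b_def)
      show ?thesis using I_cases[OF j]
        by (elim disjE conjE) (auto simp: ab 2 F1 F2 F3 u01 Z01 uZ CE simp del: One_nat_def)
    next
      case 3
      then have ab: "a i = E (fst i)" "b i = E (snd i)" by (auto simp: a_def b_def)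
      have ne: "i \<noteq> (0, 0)" "i \<noteq> (1, 1)" using 3 by auto
      show ?thesis using I_cases[OF j]
      proof (elim disjE conjE)
        assume j3: "fst j < snd j" "snd j < 5" "2 \<le> snd j"
        then show ?thesis using 3 by (auto simp: ab F3 uE prod_eq_iff)
      qed (use 3 ne in \<open>simp_all add: ab F1 F2 u01 CE del: One_nat_def\<close>)
    qed
  qed
  have "card I = 11" by (simp add: I_def)
  define \<phi> where "\<phi> = inv_into (carrier G) \<theta>"
  have \<phi>: "\<phi> h \<in> carrier G" "\<theta> (\<phi> h) = h" if "h \<in> carrier ?H" for h
    using that \<theta>(2) by (auto simp: \<phi>_def bij_betw_def inv_into_into f_inv_into_f)
  have "(if c then Z else E k) \<in> carrier ?H" for c k using EH by (cases c) (simp_all only: if_True if_False)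
  then have ab: "a i \<in> carrier ?H" "b i \<in> carrier ?H" for i unfolding a_def b_def by blast+
  have "p ^ card I \<le> card (schur_classes G)"
  proof (rule card_schur_classes_ge[where F = "\<lambda>i g h. F i (\<theta> g) (\<theta> h)" and a = "\<lambda>i. \<phi> (a i)" and b = "\<lambda>i. \<phi> (b i)"])
    show "0 < p" using p by simp
    show "finite I" by (simp add: I_def)
    show "finite (schur_classes G)" by fact
    show "[F i (\<theta> x) (\<theta> y) + F i (\<theta> (x \<otimes>\<^bsub>G\<^esub> y)) (\<theta> z) = F i (\<theta> y) (\<theta> z) + F i (\<theta> x) (\<theta> (y \<otimes>\<^bsub>G\<^esub> z))] (mod int p)"
      if "i \<in> I" "x \<in> carrier G" "y \<in> carrier G" "z \<in> carrier G" for i x y z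
      unfolding hom_mult[OF \<theta>(1) that(2,3)] hom_mult[OF \<theta>(1) that(3,4)] by (rule F_cocycle[OF that(1)])
    show "\<phi> (a i) \<in> carrier G" "\<phi> (b i) \<in> carrier G" for i using \<phi> ab by auto
    show "\<phi> (a i) \<otimes>\<^bsub>G\<^esub> \<phi> (b i) = \<phi> (b i) \<otimes>\<^bsub>G\<^esub> \<phi> (a i)" if "i \<in> I" for i
    proof (rule inj_onD[OF bij_betw_imp_inj_on[OF \<theta>(2)]])
      show "\<theta> (\<phi> (a i) \<otimes>\<^bsub>G\<^esub> \<phi> (b i)) = \<theta> (\<phi> (b i) \<otimes>\<^bsub>G\<^esub> \<phi> (a i))"
        using comm[OF that] \<phi> ab by (simp add: hom_mult[OF \<theta>(1)])
    qed (use \<phi> ab in auto)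
    show "F j (\<theta> (\<phi> (a i))) (\<theta> (\<phi> (b i))) - F j (\<theta> (\<phi> (b i))) (\<theta> (\<phi> (a i))) = (if i = j then 1 else 0)"
      if "i \<in> I" "j \<in> I" for i j
      using dual[OF that] \<phi> ab by simp
  qed
  then show ?thesis using \<open>card I = 11\<close> by simp
qed

section \<open>The bound on n and the two extremal groups\<close>

theorem theorem3p3:
  fixes G :: "('a, 'b) monoid_scheme" and p n :: nat
  assumes "group G" and "finite (carrier G)" and "Factorial_Ring.prime p"
    and "order G = p ^ n"
    and "\<not> comm_group G"
    and "schur_multiplier_order G * p ^ 5 = p ^ (n * (n - 1) div 2)"
  shows "n \<le> 7
    \<and> (n = 7 \<longrightarrow> odd p \<and> G \<cong> heisenberg_mod p \<times>\<times> elem_abelian p 4)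
    \<and> (n = 6 \<longrightarrow> G \<cong> dihedral8 \<times>\<times> elem_abelian 2 3)"
proof -
  interpret p_group G p n using assms by (simp add: p_group_def p_group_axioms_def)
  note M = assms(6)[unfolded schur_multiplier_order_def]
  obtain x y where nc: "x \<in> carrier G" "y \<in> carrier G" "x \<otimes>\<^bsub>G\<^esub> y \<noteq> y \<otimes>\<^bsub>G\<^esub> x"
    using assms(5) group_comm_groupI by blast
  have sum: "(\<Sum>i<n. i) = n * (n - 1) div 2" for n :: nat
    using Sum_Ico_nat[of 0 n] by (simp add: lessThan_atLeast0)
  have "n \<le> 7"
  proof (rule ccontr)
    assume n: "\<not> n \<le> 7"
    define m where "m = n - 1"
    have m: "n = Suc m" "7 \<le> m" using n by (auto simp: m_def)
    \<comment> \<open>The sums up to n and up to m = n - 1 differ by m, so the hypothesis turns this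
      bound into m <= 1 + 5.\<close>
    have "card (schur_classes G) \<le> p ^ ((\<Sum>i<m. i) + 1)"
      using nonabelian_schur_classes_le[OF p_group_axioms[unfolded m(1)] nc] by blast
    then have "p ^ (\<Sum>i<n. i) \<le> p ^ ((\<Sum>i<m. i) + 1) * p ^ 5" unfolding sum[of n] M[symmetric] by simp
    also have "p ^ ((\<Sum>i<m. i) + 1) * p ^ 5 = p ^ ((\<Sum>i<m. i) + 6)" by (simp add: power_add eval_nat_numeral)
    finally have "p ^ ((\<Sum>i<m. i) + m) \<le> p ^ ((\<Sum>i<m. i) + 6)" using m by simp
    then show False using p_gt_1 m by simp
  qed
  moreover have "odd p \<and> G \<cong> heisenberg_mod p \<times>\<times> elem_abelian p 4" if n: "n = 7"
  proof -
    have "card (schur_classes G) * p ^ 5 = p ^ 16 * p ^ 5" unfolding M n by (simp add: power_add[symmetric])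
    then have c: "card (schur_classes G) = p ^ 16"
      by (rule mult_right_cancel[THEN iffD1, rotated]) (use p_pos in simp)
    note * = order_p_power_7[OF n c nc]
    let ?z = "commutator G x y"
    have "?z \<in> commutator_subgroup G" "?z \<noteq> \<one>\<^bsub>G\<^esub>" using commutator_in_derived commutator_one_iff nc by auto
    then have "?z \<in> center G" by (rule derived_order_p(1)[OF *(1)])
    then show ?thesis using exponent_p_imp_heisenberg[OF *(3) _ _ nc(1,2) _ nc(3), of 4] *(2,4) n by simp
  qed
  moreover have "G \<cong> dihedral8 \<times>\<times> elem_abelian 2 3" if n: "n = 6"
  proof -
    have "card (schur_classes G) * p ^ 5 = p ^ 10 * p ^ 5" unfolding M n by (simp add: power_add[symmetric])
    then have c: "card (schur_classes G) = p ^ 10"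
      by (rule mult_right_cancel[THEN iffD1, rotated]) (use p_pos in simp)
    have D: "card (commutator_subgroup G) = p" by (rule order_p_power_6_derived[OF n c nc])
    note * = order_p_power_6[OF n c nc]
    have comm_center: "commutator G a b \<in> center G"
      if "a \<in> carrier G" "b \<in> carrier G" "a \<otimes>\<^bsub>G\<^esub> b \<noteq> b \<otimes>\<^bsub>G\<^esub> a" for a b
      by (rule derived_order_p(1)[OF D]) (use commutator_in_derived commutator_one_iff that in auto)
    have Z: "card (center G) = p ^ Suc 3" using *(1) by (simp add: eval_nat_numeral)
    have "even p"
    proof (rule ccontr)
      assume odd: "odd p"
      have "G \<cong> heisenberg_mod p \<times>\<times> elem_abelian p 3"
        by (rule exponent_p_imp_heisenberg[OF *(2)[OF odd] _ Z nc(1,2) comm_center[OF nc] nc(3)]) (use n in auto)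
      \<comment> \<open>The nonzero cardinality p^10 rules out an infinite quotient.\<close>
      moreover have "finite (schur_classes G)" using c p_pos by (intro card_ge_0_finite) simp
      ultimately have "p ^ 11 \<le> p ^ 10"
        using heisenberg_schur_classes_ge[OF assms(1) odd p_gt_1] c by simp
      then show False using p_gt_1 by simp
    qed
    then obtain s t where st: "p = 2" "\<And>z. z \<in> center G \<Longrightarrow> z \<otimes>\<^bsub>G\<^esub> z = \<one>\<^bsub>G\<^esub>" "s \<in> carrier G" "t \<in> carrier G"
      "s \<otimes>\<^bsub>G\<^esub> t \<noteq> t \<otimes>\<^bsub>G\<^esub> s" "s \<otimes>\<^bsub>G\<^esub> s = \<one>\<^bsub>G\<^esub>" "t \<otimes>\<^bsub>G\<^esub> t = \<one>\<^bsub>G\<^esub>"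
      using *(3) by blast
    have "n = 3 + 3" using n by simp
    then show ?thesis
      by (rule involutions_imp_dihedral[OF st(1) _ Z st(2) st(3,6,4,7) comm_center[OF st(3,4,5)] st(5)])
  qed
  ultimately show ?thesis by blast
qed

end
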